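(* Let $\beta>0$, $d\ge1$ an integer, $\gamma\in(0,2)$, and $C>0$ such that $\mathcal P_S(\beta,d,C/2)$ is non-empty. Then there exists a finite constant $C_1=C_1(\beta,d,\gamma,C)$ such that for any $\epsilon\in(0,1)$ there exist $\mu_\epsilon,\nu_\epsilon\in\mathcal P_S(\beta,d,C)$ with $\mathsf{TV}(\mu_\epsilon,\nu_\epsilon)/\epsilon\in(1/C_1,C_1)$ and $$\mathcal E_\gamma(\mu_\epsilon,\nu_\epsilon)\le C_1\,\mathsf{TV}(\mu_\epsilon,\nu_\epsilon)^{\frac{2\beta+d+\gamma}{2\beta}}\,\log\Big(3+\frac1{\mathsf{TV}(\mu_\epsilon,\nu_\epsilon)}\Big)^{d-1}.$$
   Context: $\mathbb B(0,1)$ is the closed Euclidean unit ball of $\mathbb R^d$. Fourier transform: $\widehat f(\omega)=\int_{\mathbb R^d}e^{-i\langle x,\omega\rangle}f(x)\,dx$. For $f\in L^2(\mathbb R^d)$, $\|f\|_{\beta,2}^2=\int_{\mathbb R^d}\|\omega\|^{2\beta}|\widehat f(\omega)|^2\,d\omega$. $\mathcal P_S(\beta,d,C)$ is the set of probability distributions on $\mathbb R^d$ supported in $\mathbb B(0,1)$ having a density $p\in L^2(\mathbb R^d)$ with $\|p\|_{\beta,2}<C$. $\mathsf{TV}(\mu,\nu)=\sup_{A}[\mu(A)-\nu(A)]$ over measurable sets. The generalized energy distance $\mathcal E_\gamma(\mu,\nu)\ge0$ is given by $\mathcal E_\gamma^2(\mu,\nu)=\mathbb E\big[2\|X-Y\|^\gamma-\|X-X'\|^\gamma-\|Y-Y'\|^\gamma\big]$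 with $(X,X',Y,Y')\sim\mu^{\otimes2}\otimes\nu^{\otimes2}$. *)

theory Defs
  imports "HOL-Probability.Probability"
begin

(* The integral formula is the Fourier transform for integrable f only. It is applied
   below to probability densities in L^2, which lie in L^1 as well. *)
definition fourier :: "(real ^ 'd \<Rightarrow> real) \<Rightarrow> real ^ 'd \<Rightarrow> complex" where
  "fourier f \<omega> = (LINT x|lborel. cis (- (x \<bullet> \<omega>)) * complex_of_real (f x))"

(* Extended-valued: infinite when the integral diverges. *)
definition sobolev_norm_sq :: "real \<Rightarrow> (real ^ 'd \<Rightarrow> real) \<Rightarrow> ennreal" where
  "sobolev_norm_sq \<beta> f =
     (\<integral>\<^sup>+\<omega>. ennreal (norm \<omega> powr (2 * \<beta>) * (cmod (fourier f \<omega>))\<^sup>2) \<partial>lborel)"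

definition sobolev_norm :: "real \<Rightarrow> (real ^ 'd \<Rightarrow> real) \<Rightarrow> ennreal" where
  "sobolev_norm \<beta> f =
     (if sobolev_norm_sq \<beta> f = \<infinity> then \<infinity> else ennreal (sqrt (enn2real (sobolev_norm_sq \<beta> f))))"

(* Since the ball is closed, being supported in it amounts to giving it full mass. *)
definition sobolev_densities :: "real \<Rightarrow> real \<Rightarrow> (real ^ 'd) measure set" where
  "sobolev_densities \<beta> C =
     {\<mu>. prob_space \<mu> \<and> sets \<mu> = sets borel \<and> measure \<mu> (cball 0 1) = 1 \<and>
         (\<exists>p. p \<in> borel_measurable borel \<and> (\<forall>x. 0 \<le> p x) \<and>
              \<mu> = density lborel (\<lambda>x. ennreal (p x)) \<and>
              integrable lborel (\<lambda>x. (p x)\<^sup>2) \<and>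
              sobolev_norm \<beta> p < ennreal C)}"

definition tv_dist :: "'a measure \<Rightarrow> 'a measure \<Rightarrow> real" where
  "tv_dist \<mu> \<nu> = (SUP A\<in>sets \<mu>. measure \<mu> A - measure \<nu> A)"

(* The expectation of (X, X', Y, Y') under the product law of mu, mu, nu, nu. *)
definition energy_dist :: "real \<Rightarrow> (real ^ 'd) measure \<Rightarrow> (real ^ 'd) measure \<Rightarrow> real" where
  "energy_dist \<gamma> \<mu> \<nu> =
     sqrt (\<integral>(x, x', y, y'). 2 * norm (x - y) powr \<gamma> - norm (x - x') powr \<gamma> - norm (y - y') powr \<gamma>
             \<partial>(\<mu> \<Otimes>\<^sub>M (\<mu> \<Otimes>\<^sub>M (\<nu> \<Otimes>\<^sub>M \<nu>))))"

end

(* The perturbation is an oscillating product function f_h(x) = F_h(x_1) B(x_2) ... B(x_d) with wave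
   length h. Here F_h is the real part of (1 - i h D)^K P multiplied by exp(i x / h), for a polynomial P
   vanishing to high order at the ends of an interval; its Fourier transform is (h t)^K times two bumps
   centred at 1/h and -1/h, so f_h has vanishing moments up to order K and lives at frequency 1/h.
   Given p in the class of radius C/2, put q = (1 - delta) p + delta b with the product bump
   b(x) = B(x_1) ... B(x_d), which makes room for the perturbation a f_h of size a M <= delta, and compare
   q + a f_h with q, where a is of order epsilon and h of order epsilon^(1/beta). The Sobolev norm
   stays bounded, the total variation is of order a, and the squared energy distance is of order
   a^2 h^(d + gamma). The last bound comes from |x|^gamma = c int_0^oo s^(-gamma/2-1) (1 - exp(-s |x|^2)) ds:
   for each s the Gaussian kernel factorises over the coordinates, every factor is at most of order
   s^(-1/2), and the oscillating one gains an extra min(1, (h^2 s)^K). *)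

theory Submission
  imports Defs
begin

subsection \<open>Fourier transforms of truncated polynomials\<close>

text \<open>Three demands compete. The perturbation must live in the ball, have Sobolev norm of
  order h^(-\<beta>), and carry almost nothing at low frequencies, since the mixing density
  s^(-\<gamma>/2-1) blows up at s = 0. A compactly supported wave cannot have its transform confined
  to frequencies near 1/h and -1/h. A differential operator keeps the support and puts a zero of
  order K at frequency 0. Any K > (d + \<gamma>) / 2 makes the s-integral converge at 0; its
  effective range then starts at s = h^(-2), where d factors s^(-1/2) and the mixing density give
  h^(d + \<gamma>). Finitely many derivatives suffice, and polynomials cut off at the ends of an
  interval provide them.

  The tie between a and h is forced: a h^(-\<beta>) stays bounded for h of order
  \<epsilon>^(1/\<beta>), and then a h^((d + \<gamma>) / 2) is \<epsilon> to the power (2 \<beta> +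
  d + \<gamma>) / (2 \<beta>). As p may vanish anywhere in the ball, it cannot dominate the
  perturbation; only the bump can.\<close>

definition ft :: "(real \<Rightarrow> complex) \<Rightarrow> real \<Rightarrow> complex" where
  "ft u t = (LINT x|lborel. cis (- (x * t)) * u x)"

text \<open>Polynomials make smoothness at the endpoints algebraic: divisibility by a power of x^2 -
  r^2 counts the order to which \<open>P\<close> vanishes at \<open>r\<close> and
  \<open>-r\<close>.\<close>

definition cutoff :: "real \<Rightarrow> complex poly \<Rightarrow> real \<Rightarrow> complex" where
  "cutoff r P x = indicat_real {-r..r} x *\<^sub>R poly P (complex_of_real x)"

lemma cis_measurable [measurable]: "cis \<in> borel_measurable borel"
  by (intro borel_measurable_continuous_onI continuous_intros)

lemma cutoff_measurable [measurable]: "cutoff r P \<in> borel_measurable borel"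
proof -
  have "(\<lambda>x::real. poly P (complex_of_real x)) \<in> borel_measurable borel"
    by (intro borel_measurable_continuous_onI continuous_intros)
  then show ?thesis
    unfolding cutoff_def by measurable
qed

lemma cutoff_bounded: "\<exists>C\<ge>0. \<forall>x. cmod (cutoff r P x) \<le> C"
proof -
  have "compact ((\<lambda>x::real. poly P (complex_of_real x)) ` {-r..r})"
    by (intro compact_continuous_image continuous_intros compact_Icc)
  then obtain C where C: "\<And>x. x \<in> {-r..r} \<Longrightarrow> cmod (poly P (complex_of_real x)) \<le> C"
    by (meson bounded_iff compact_imp_bounded imageI)
  show ?thesis
    by (intro exI[of _ "max C 0"]) (auto simp: cutoff_def indicator_def intro: order.trans[OF C])
qed

lemma cutoff_integrable: "integrable lborel (cutoff r P)"
proof -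
  have "set_integrable lborel {-r..r} (\<lambda>x::real. poly P (complex_of_real x))"
    by (intro borel_integrable_atLeastAtMost' continuous_intros)
  then show ?thesis
    by (simp add: set_integrable_def cutoff_def[abs_def])
qed

lemma integrable_cis_mult:
  assumes "integrable M (u :: _ \<Rightarrow> complex)" and [measurable]: "g \<in> borel_measurable M"
  shows "integrable M (\<lambda>x. cis (g x) * u x)"
proof -
  have [measurable]: "u \<in> borel_measurable M" using assms by auto
  show ?thesis
    using assms(1) by (rule Bochner_Integration.integrable_bound) (auto simp: norm_mult)
qed

lemma ft_bound:
  assumes "integrable lborel u"
  shows "cmod (ft u t) \<le> (LINT x|lborel. cmod (u x))"
proof -
  have "cmod (ft u t) \<le> (LINT x|lborel. cmod (cis (- (x * t)) * u x))"
    unfolding ft_def by (rule integral_norm_bound)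
  then show ?thesis by (simp add: norm_mult)
qed

text \<open>Integration by parts. Truncation creates jumps at the ends of the interval, and the two
  zeros of \<open>P\<close> are what removes the boundary terms.\<close>

lemma ft_pderiv:
  assumes "r \<ge> 0" "poly P (complex_of_real r) = 0" "poly P (complex_of_real (-r)) = 0"
  shows "ft (cutoff r (pderiv P)) t = \<i> * t * ft (cutoff r P) t"
proof -
  let ?F = "\<lambda>x::real. cis (- (x * t)) * poly P (complex_of_real x)"
  let ?f = "\<lambda>x::real. cis (- (x * t)) * poly (pderiv P) (complex_of_real x)
     - \<i> * t * (cis (- (x * t)) * poly P (complex_of_real x))"
  have *: "has_bochner_integral lborel (\<lambda>x. indicator {-r..r} x *\<^sub>R ?f x) (?F r - ?F (-r))"
  proof (rule has_bochner_integral_FTC_Icc)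
    fix x :: real assume "- r \<le> x" "x \<le> r"
    \<comment> \<open>The derivative is taken in a complex variable, where \<open>exp\<close> and
      \<open>poly\<close> have their standard rules, and then restricted to the real line.\<close>
    have "((\<lambda>z. exp (- (\<i> * z * t)) * poly P z) has_field_derivative
        exp (- (\<i> * x * t)) * poly (pderiv P) x - \<i> * t * (exp (- (\<i> * x * t)) * poly P x)) (at (complex_of_real x))"
      by (auto intro!: derivative_eq_intros simp: algebra_simps)
    from has_vector_derivative_real_field[OF this, of UNIV] have "(?F has_vector_derivative ?f x) (at x)"
      by (simp add: cis_conv_exp mult_ac)
    then show "(?F has_vector_derivative ?f x) (at x within {-r..r})"
      by (rule has_vector_derivative_at_within)
  qed (use assms in \<open>auto intro!: continuous_intros\<close>)
  have eq: "indicator {-r..r} x *\<^sub>R ?f x = cis (- (x * t)) * cutoff r (pderiv P) x - \<i> * t * (cis (- (x * t)) * cutoff r P x)"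
    for x by (simp add: cutoff_def indicator_def)
  have "(LINT x|lborel. cis (- (x * t)) * cutoff r (pderiv P) x - \<i> * t * (cis (- (x * t)) * cutoff r P x)) = 0"
    using * assms unfolding eq has_bochner_integral_iff by simp
  then show ?thesis
    by (subst (asm) Bochner_Integration.integral_diff)
       (auto intro!: integrable_cis_mult cutoff_integrable integrable_mult_right simp: ft_def)
qed

text \<open>Chosen so that (twist h P) exp(i x / h) is - i h times the derivative of P exp(i x / h).\<close>
definition twist :: "real \<Rightarrow> complex poly \<Rightarrow> complex poly" where
  "twist h P = P - smult (\<i> * h) (pderiv P)"

text \<open>Differentiation lowers a zero by one order, so the exponent counts the integrations by
  parts still available without boundary terms.\<close>

lemma power_dvd_pderiv:
  assumes "(q :: complex poly) ^ Suc n dvd P"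
  shows "q ^ n dvd pderiv P"
proof -
  from assms obtain s where "P = q ^ Suc n * s" by blast
  then have "pderiv P = q ^ n * (q * pderiv s + smult (of_nat (Suc n)) (pderiv q * s))"
    by (simp only: pderiv_mult pderiv_power_Suc) (simp add: algebra_simps del: of_nat_Suc)
  then show ?thesis by simp
qed

lemma power_dvd_twist:
  assumes "q ^ Suc n dvd P"
  shows "q ^ n dvd twist h P"
  using assms power_dvd_pderiv[OF assms] dvd_trans[OF le_imp_power_dvd[of n "Suc n" q] assms]
  by (auto simp: twist_def intro!: dvd_diff dvd_smult)

lemma ft_modulate: "ft (\<lambda>x. u x * cis (x * a)) t = ft u (t - a)"
  unfolding ft_def by (intro Bochner_Integration.integral_cong) (auto simp: cis_mult algebra_simps)

text \<open>With s = t - 1/h, \<open>ft_pderiv\<close> turns the twist into the multiplier 1 - i h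
  (i s) = 1 + h s, which is exactly h t: the shift by the carrier frequency moves the zero of the
  multiplier to t = 0.\<close>

lemma ft_twist:
  assumes "r \<ge> 0" "h \<noteq> 0" "poly P (complex_of_real r) = 0" "poly P (complex_of_real (-r)) = 0"
  shows "ft (cutoff r (twist h P)) (t - 1 / h) = h * t * ft (cutoff r P) (t - 1 / h)"
proof -
  have "ft (cutoff r (twist h P)) s = ft (cutoff r P) s - \<i> * h * ft (cutoff r (pderiv P)) s" for s
  proof -
    have "ft (cutoff r (twist h P)) s =
      (LINT x|lborel. cis (- (x * s)) * cutoff r P x - \<i> * h * (cis (- (x * s)) * cutoff r (pderiv P) x))"
      unfolding ft_def by (intro Bochner_Integration.integral_cong)
        (auto simp: cutoff_def twist_def indicator_def algebra_simps)
    also have "\<dots> = ft (cutoff r P) s - \<i> * h * ft (cutoff r (pderiv P)) s"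
      by (subst Bochner_Integration.integral_diff)
        (auto intro!: integrable_cis_mult cutoff_integrable integrable_mult_right simp: ft_def)
    finally show ?thesis .
  qed
  also have "ft (cutoff r (pderiv P)) (t - 1 / h) = \<i> * complex_of_real (t - 1 / h) * ft (cutoff r P) (t - 1 / h)"
    by (rule ft_pderiv) (use assms in auto)
  finally show ?thesis
    using assms(2) by (simp add: field_simps)
qed

lemma ft_twist_pow:
  assumes "r \<ge> 0" "h \<noteq> 0" "[:- (complex_of_real r)\<^sup>2, 0, 1:] ^ K dvd P"
  shows "ft (cutoff r ((twist h ^^ K) P)) (t - 1 / h) = (h * t) ^ K * ft (cutoff r P) (t - 1 / h)"
  using assms(3)
proof (induction K arbitrary: P)
  case (Suc K)
  let ?q = "[:- (complex_of_real r)\<^sup>2, 0, 1:]"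
  have "?q dvd P"
    using Suc.prems by (meson dvd_trans dvd_power zero_less_Suc)
  then obtain s where "P = ?q * s" by blast
  then have 0: "poly P (complex_of_real r) = 0" "poly P (complex_of_real (-r)) = 0"
    by (simp_all add: power2_eq_square)
  have "?q ^ K dvd twist h P"
    by (rule power_dvd_twist) (use Suc.prems in simp)
  \<comment> \<open>The innermost twist is split off: \<open>twist h P\<close> keeps the
    divisibility that the induction hypothesis asks for, while the zeros of \<open>P\<close> pay for
    one application of \<open>ft_twist\<close>.\<close>
  from Suc.IH[OF this] show ?case
    by (simp add: funpow_Suc_right ft_twist[OF assms(1,2) 0] mult_ac del: funpow.simps)
qed simp

text \<open>Every integration by parts trades one order of vanishing at the endpoints for one power
  of 1/|t|.\<close>

lemma ft_cutoff_decay_aux: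
  assumes "r \<ge> 0" "[:- (complex_of_real r)\<^sup>2, 0, 1:] ^ N dvd P"
  shows "\<exists>C. \<forall>t. \<bar>t\<bar> ^ N * cmod (ft (cutoff r P) t) \<le> C"
  using assms(2)
proof (induction N arbitrary: P)
  case 0
  show ?case using ft_bound[OF cutoff_integrable[of r P]] by auto
next
  case (Suc N)
  let ?q = "[:- (complex_of_real r)\<^sup>2, 0, 1:]"
  have "?q dvd P"
    using Suc.prems by (meson dvd_trans dvd_power zero_less_Suc)
  then obtain s where "P = ?q * s" by blast
  then have 0: "poly P (complex_of_real r) = 0" "poly P (complex_of_real (-r)) = 0"
    by (simp_all add: power2_eq_square)
  obtain C where "\<And>t. \<bar>t\<bar> ^ N * cmod (ft (cutoff r (pderiv P)) t) \<le> C"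
    using Suc.IH[OF power_dvd_pderiv[OF Suc.prems]] by blast
  then show ?case
    by (intro exI[of _ C]) (simp add: ft_pderiv[OF assms(1) 0] norm_mult mult_ac)
qed

lemma ft_cutoff_decay:
  assumes "r \<ge> 0" "[:- (complex_of_real r)\<^sup>2, 0, 1:] ^ N dvd P"
  shows "\<exists>C>0. \<forall>t. (1 + \<bar>t\<bar>) ^ N * cmod (ft (cutoff r P) t) \<le> C"
proof -
  obtain C0 where C0: "\<And>t. cmod (ft (cutoff r P) t) \<le> C0"
    using ft_bound[OF cutoff_integrable[of r P]] by blast
  obtain C1 where C1: "\<And>t. \<bar>t\<bar> ^ N * cmod (ft (cutoff r P) t) \<le> C1"
    using ft_cutoff_decay_aux[OF assms] by blast
  have pos: "0 \<le> C0" "0 \<le> C1"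
    using order.trans[OF norm_ge_zero C0] order.trans[OF _ C1[of 0]] by auto
  \<comment> \<open>The last summand 1 makes the constant strictly positive even if both bounds are
    0; later constants divide by it.\<close>
  have "(1 + \<bar>t\<bar>) ^ N * cmod (ft (cutoff r P) t) \<le> 2 ^ N * (C0 + C1) + 1" for t
  proof -
    have "(1 + \<bar>t\<bar>) ^ N \<le> (2 * max 1 \<bar>t\<bar>) ^ N"
      by (intro power_mono) auto
    also have "\<dots> \<le> 2 ^ N * (1 + \<bar>t\<bar> ^ N)"
      by (auto simp: power_mult_distrib max_def)
    finally have "(1 + \<bar>t\<bar>) ^ N * cmod (ft (cutoff r P) t) \<le> 2 ^ N * (1 + \<bar>t\<bar> ^ N) * cmod (ft (cutoff r P) t)"
      by (rule mult_right_mono) simp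
    also have "\<dots> = 2 ^ N * (cmod (ft (cutoff r P) t) + \<bar>t\<bar> ^ N * cmod (ft (cutoff r P) t))"
      by (simp add: algebra_simps)
    also have "\<dots> \<le> 2 ^ N * (C0 + C1)"
      by (intro mult_left_mono add_mono C0 C1) auto
    finally show ?thesis by simp
  qed
  moreover have "2 ^ N * (C0 + C1) + 1 > 0" using pos by (simp add: add_nonneg_pos)
  ultimately show ?thesis by blast
qed

lemma nn_integral_inverse_1_plus_square: "(\<integral>\<^sup>+t. ennreal (1 / (1 + t\<^sup>2)) \<partial>lborel) < \<infinity>"
proof -
  have "integrable lborel (\<lambda>t::real. 1 / (1 + t\<^sup>2))"
    using integrable_inverse_1_plus_square by (simp add: set_integrable_def inverse_eq_divide)
  then show ?thesis by (simp add: integrable_iff_bounded)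
qed

lemma nn_integral_shifted_inverse_1_plus_square:
  "(\<integral>\<^sup>+t. ennreal (1 / (1 + (t - a)\<^sup>2)) \<partial>lborel) = (\<integral>\<^sup>+t. ennreal (1 / (1 + t\<^sup>2)) \<partial>lborel)"
  using nn_integral_real_affine[of "\<lambda>t. ennreal (1 / (1 + t\<^sup>2))" 1 "-a"] by (simp add: add.commute)

lemma pderiv_twist_pow: "pderiv ((twist h ^^ K) P) = (twist h ^^ K) (pderiv P)"
  by (induction K) (simp_all add: twist_def pderiv_diff pderiv_smult)

text \<open>Expanding the twists gives derivatives of \<open>P\<close> with coefficients of the
  order of powers of h, so \<open>h \<le> 1\<close> yields a bound uniform in h. The induction runs
  over all \<open>P\<close>, because the outermost twist also calls for the bound on
  \<open>pderiv P\<close>.\<close>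

lemma twist_pow_bounded:
  "\<exists>C\<ge>0. \<forall>h x. 0 \<le> h \<longrightarrow> h \<le> 1 \<longrightarrow> cmod (cutoff r ((twist h ^^ K) P) x) \<le> C"
proof (induction K arbitrary: P)
  case 0
  then show ?case using cutoff_bounded[of r P] by auto
next
  case (Suc K)
  obtain C where C: "C \<ge> 0" "\<And>h x. 0 \<le> h \<Longrightarrow> h \<le> 1 \<Longrightarrow> cmod (cutoff r ((twist h ^^ K) P) x) \<le> C"
    using Suc.IH[of P] by blast
  obtain D where D: "D \<ge> 0" "\<And>h x. 0 \<le> h \<Longrightarrow> h \<le> 1 \<Longrightarrow> cmod (cutoff r ((twist h ^^ K) (pderiv P)) x) \<le> D"
    using Suc.IH[of "pderiv P"] by blast
  have "cmod (cutoff r ((twist h ^^ Suc K) P) x) \<le> C + D" if h: "0 \<le> h" "h \<le> 1" for h x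
  proof -
    have "cutoff r ((twist h ^^ Suc K) P) x
        = cutoff r ((twist h ^^ K) P) x - \<i> * h * cutoff r ((twist h ^^ K) (pderiv P)) x"
      by (simp add: twist_def[of h "(twist h ^^ K) P"] pderiv_twist_pow cutoff_def indicator_def algebra_simps)
    also have "cmod \<dots> \<le> cmod (cutoff r ((twist h ^^ K) P) x) + h * cmod (cutoff r ((twist h ^^ K) (pderiv P)) x)"
      using h by (intro order.trans[OF norm_triangle_ineq4]) (simp add: norm_mult)
    also have "\<dots> \<le> C + 1 * D"
      using h C D by (intro add_mono mult_mono) auto
    finally show ?thesis by simp
  qed
  then show ?case using C(1) D(1) by (intro exI[of _ "C + D"]) auto
qed

text \<open>The reflected conjugate is the origin of the second bump: a transform concentrated at
  1/h acquires a mirror image at -1/h.\<close>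

lemma ft_Re:
  assumes "integrable lborel u"
  shows "ft (\<lambda>x. complex_of_real (Re (u x))) t = (ft u t + cnj (ft u (- t))) / 2"
proof -
  have "ft (\<lambda>x. complex_of_real (Re (u x))) t
      = (LINT x|lborel. (cis (- (x * t)) * u x + cnj (cis (- (x * (- t))) * u x)) / 2)"
    unfolding ft_def
    by (intro Bochner_Integration.integral_cong refl)
      (simp add: cis_cnj complex_add_cnj distrib_left[symmetric] flip: mult_2)
  also have "\<dots> = (ft u t + (LINT x|lborel. cnj (cis (- (x * (- t))) * u x))) / 2"
    unfolding ft_def integral_divide_zero
    by (subst Bochner_Integration.integral_add)
       (auto intro!: integrable_cis_mult integrable_cnj assms simp del: complex_cnj_mult)
  also have "(LINT x|lborel. cnj (cis (- (x * (- t))) * u x)) = cnj (ft u (- t))"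
    unfolding ft_def by (rule Bochner_Integration.integral_cnj)
  finally show ?thesis .
qed

section \<open>Truncated polynomial bumps\<close>

definition bump :: "real \<Rightarrow> nat \<Rightarrow> real \<Rightarrow> real" where
  "bump r N x = indicat_real {-r..r} x * (r\<^sup>2 - x\<^sup>2) ^ N"

lemma bump_eq_cutoff: "complex_of_real (bump r N x) = cutoff r ([:(complex_of_real r)\<^sup>2, 0, -1:] ^ N) x"
  by (simp add: bump_def cutoff_def poly_power power2_eq_square scaleR_conv_of_real)

text \<open>The bump is built from r^2 - x^2 to be nonnegative, whereas the divisibility lemmas use
  the monic x^2 - r^2; the two differ by the unit -1.\<close>

lemma bump_dvd: "[:- (complex_of_real r)\<^sup>2, 0, 1:] ^ N dvd [:(complex_of_real r)\<^sup>2, 0, -1:] ^ N"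
proof -
  have "[:(complex_of_real r)\<^sup>2, 0, -1:] = [:- (complex_of_real r)\<^sup>2, 0, 1:] * [:-1:]" by simp
  then show ?thesis by (metis dvd_triv_left power_mult_distrib)
qed

lemma bump_nonneg: "0 \<le> bump r N x"
proof (cases "x \<in> {-r..r}")
  case True
  then have "x\<^sup>2 \<le> r\<^sup>2" by (auto intro: power2_le_iff_abs_le[THEN iffD2] simp: abs_le_square_iff[symmetric])
  then show ?thesis by (simp add: bump_def)
qed (simp add: bump_def)

lemma bump_measurable [measurable]: "bump r N \<in> borel_measurable borel"
  unfolding bump_def by measurable

lemma bump_lower:
  assumes "\<bar>x\<bar> \<le> r / 2"
  shows "(3 * r\<^sup>2 / 4) ^ N \<le> bump r N x"
proof -
  have "x\<^sup>2 \<le> (r / 2)\<^sup>2" using assms by (metis abs_ge_zero power2_abs power_mono)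
  then have "(3 * r\<^sup>2 / 4) ^ N \<le> (r\<^sup>2 - x\<^sup>2) ^ N"
    by (intro power_mono) (auto simp: power_divide)
  then show ?thesis using assms
    by (auto simp: bump_def indicator_def)
qed

lemma bump_integrable: "integrable lborel (bump r N)"
  using cutoff_integrable[of r "[:(complex_of_real r)\<^sup>2, 0, -1:] ^ N"]
  unfolding bump_eq_cutoff[symmetric, abs_def] complex_of_real_integrable_eq .

lemma bump_upper: "\<exists>C>0. \<forall>x. bump r N x \<le> C"
proof -
  obtain C where "C \<ge> 0" "\<And>x. cmod (complex_of_real (bump r N x)) \<le> C"
    using cutoff_bounded[of r "[:(complex_of_real r)\<^sup>2, 0, -1:] ^ N"] unfolding bump_eq_cutoff by blast
  then show ?thesis by (intro exI[of _ "C + 1"]) (auto intro: order.trans[OF abs_ge_self] simp: add_increasing2)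
qed

lemma bump_integral_pos:
  assumes "r > 0"
  shows "0 < (LINT x|lborel. bump r N x)"
proof -
  have "0 < r * (3 * r\<^sup>2 / 4) ^ N" using assms by simp
  also have "\<dots> = (LINT x|lborel. indicat_real {-(r/2)..r/2} x * (3 * r\<^sup>2 / 4) ^ N)"
    using assms by simp
  also have "\<dots> \<le> (LINT x|lborel. bump r N x)"
  proof (rule integral_mono)
    show "integrable lborel (\<lambda>x. indicat_real {-(r/2)..r/2} x * (3 * r\<^sup>2 / 4) ^ N)"
      using assms by (intro integrable_mult_left integrable_real_indicator) (auto simp: less_top[symmetric])
  qed (use bump_lower[of _ r N] bump_nonneg bump_integrable in \<open>auto simp: indicator_def\<close>)
  finally show ?thesis .
qed

section \<open>Wave packets at frequency 1/h, uniformly in h\<close>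

lemma weight_decay_bound:
  fixes h t :: real
  assumes "0 < h" "h \<le> 1" "\<bar>a\<bar> = 1 / h" "m + 1 \<le> N"
  shows "(1 + \<bar>h * t\<bar>) ^ m * (1 / (1 + \<bar>t - a\<bar>) ^ N)\<^sup>2 \<le> 2 ^ m * (1 / (1 + (t - a)\<^sup>2))"
proof -
  define v where "v = 1 + \<bar>t - a\<bar>"
  have v: "v \<ge> 1" by (simp add: v_def)
  \<comment> \<open>As |h a| = 1 and h \<le> 1, the weight is controlled by the distance of t from
    the centre a alone; this makes the estimate uniform in h.\<close>
  have "\<bar>h * t\<bar> \<le> \<bar>h * (t - a)\<bar> + \<bar>h * a\<bar>" by (simp add: algebra_simps)
  also have "\<bar>h * a\<bar> = 1" using assms by (simp add: abs_mult)
  also have "\<bar>h * (t - a)\<bar> \<le> \<bar>t - a\<bar>" using assms by (simp add: abs_mult mult_left_le_one_le)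
  finally have "\<bar>h * t\<bar> \<le> \<bar>t - a\<bar> + 1" by simp
  then have "1 + \<bar>h * t\<bar> \<le> 2 * v"
    using abs_ge_zero[of "t - a"] by (simp add: v_def del: abs_ge_zero)
  then have "(1 + \<bar>h * t\<bar>) ^ m \<le> (2 * v) ^ m"
    by (intro power_mono) auto
  then have "(1 + \<bar>h * t\<bar>) ^ m * (1 / v ^ N)\<^sup>2 \<le> (2 * v) ^ m * (1 / v ^ N)\<^sup>2"
    by (rule mult_right_mono) simp
  also have "\<dots> = 2 ^ m * (v ^ m / v ^ (2 * N))"
    by (simp add: power_mult_distrib power_divide power_mult mult.commute)
  \<comment> \<open>\<open>m + 1 \<le> N\<close> gives m \<le> 2 N - 2, so two powers of
    \<open>v\<close> are left over for integrability.\<close>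
  also have "v ^ m / v ^ (2 * N) \<le> v ^ (2 * N - 2) / v ^ (2 * N)"
    using v assms(4) by (intro divide_right_mono power_increasing) auto
  also have "v ^ (2 * N - 2) / v ^ (2 * N) = 1 / v\<^sup>2"
    using v assms(4) by (simp add: power_diff)
  also have "1 / v\<^sup>2 \<le> 1 / (1 + (t - a)\<^sup>2)"
  proof (rule divide_left_mono)
    have "v\<^sup>2 = 1 + (t - a)\<^sup>2 + 2 * \<bar>t - a\<bar>"
      unfolding v_def power2_sum by simp
    then show "1 + (t - a)\<^sup>2 \<le> v\<^sup>2" by simp
    show "0 < v\<^sup>2 * (1 + (t - a)\<^sup>2)"
      using v by (intro mult_pos_pos add_pos_nonneg zero_less_power) auto
  qed simp
  finally show ?thesis by (simp add: v_def)
qed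

text \<open>\<open>g h\<close> majorises the two bumps around 1/h and -1/h, and \<open>m\<close> is
  the polynomial weight that their decay has to absorb. The last clause amounts to testing the
  packet against cos(x / h) and shows that it does not degenerate as h tends to 0.\<close>

lemma wave_packet:
  fixes r :: real and K m :: nat
  assumes r: "r > 0"
  obtains C c h0 :: real and F g :: "real \<Rightarrow> real \<Rightarrow> real"
  where "C > 0" "c > 0" "h0 > 0" "h0 \<le> 1"
    "\<And>h. F h \<in> borel_measurable borel" "\<And>h. g h \<in> borel_measurable borel"
    "\<And>h x. x \<notin> {-r..r} \<Longrightarrow> F h x = 0"
    "\<And>h x. 0 < h \<Longrightarrow> h \<le> h0 \<Longrightarrow> \<bar>F h x\<bar> \<le> C"
    "\<And>h t. 0 < h \<Longrightarrow> h \<le> h0 \<Longrightarrow> cmod (ft (\<lambda>x. complex_of_real (F h x)) t) \<le> \<bar>h * t\<bar> ^ K * g h t"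
    "\<And>h. 0 < h \<Longrightarrow> h \<le> h0 \<Longrightarrow> (\<integral>\<^sup>+t. ennreal ((1 + \<bar>h * t\<bar>) ^ m * (g h t)\<^sup>2) \<partial>lborel) \<le> ennreal C"
    "\<And>h. 0 < h \<Longrightarrow> h \<le> h0 \<Longrightarrow> c \<le> Re (ft (\<lambda>x. complex_of_real (F h x)) (1 / h))"
proof -
  \<comment> \<open>Large enough both for \<open>K\<close> twists and for the \<open>m + 1\<close>
    powers of decay that \<open>weight_decay_bound\<close> asks for.\<close>
  define N where "N = K + m + 1"
  define P where "P = [:(complex_of_real r)\<^sup>2, 0, -1:] ^ N"
  have dvdN: "[:- (complex_of_real r)\<^sup>2, 0, 1:] ^ N dvd P"
    unfolding P_def by (rule bump_dvd)
  have dvdK: "[:- (complex_of_real r)\<^sup>2, 0, 1:] ^ K dvd P"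
    by (rule dvd_trans[OF le_imp_power_dvd dvdN]) (simp add: N_def)
  obtain D where D: "D > 0" "\<And>t. (1 + \<bar>t\<bar>) ^ N * cmod (ft (cutoff r P) t) \<le> D"
    using ft_cutoff_decay[OF _ dvdN] r by auto
  have decay: "cmod (ft (cutoff r P) t) \<le> D * (1 / (1 + \<bar>t\<bar>) ^ N)" for t
    using D(2)[of t] by (simp add: field_simps)
  define I0 where "I0 = (LINT x|lborel. bump r N x)"
  have I0: "I0 > 0" unfolding I0_def by (rule bump_integral_pos[OF r])
  have ft0: "ft (cutoff r P) 0 = complex_of_real I0"
    by (simp add: ft_def I0_def P_def flip: bump_eq_cutoff)
  define H where "H h x = cutoff r ((twist h ^^ K) P) x * cis (x * (1 / h))" for h x
  have H_int: "integrable lborel (H h)" for h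
    unfolding H_def[abs_def]
    unfolding mult.commute[of "cutoff _ _ _"] by (rule integrable_cis_mult[OF cutoff_integrable]) measurable
  have [measurable]: "H h \<in> borel_measurable borel" for h
    using H_int[of h] by auto
  have ftH: "ft (H h) t = (h * t) ^ K * ft (cutoff r P) (t - 1 / h)" if "h > 0" for h t
    unfolding H_def[abs_def] ft_modulate using ft_twist_pow[of r h K P t] r that dvdK by simp
  define F where "F h x = Re (H h x)" for h x
  define g where "g h t = D / 2 * (1 / (1 + \<bar>t - 1 / h\<bar>) ^ N + 1 / (1 + \<bar>t - (- 1 / h)\<bar>) ^ N)" for h t :: real
  have ftF: "ft (\<lambda>x. complex_of_real (F h x)) t = (ft (H h) t + cnj (ft (H h) (- t))) / 2" for h t
    unfolding F_def by (rule ft_Re[OF H_int])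
  obtain B where B: "B \<ge> 0" "\<And>h x. 0 \<le> h \<Longrightarrow> h \<le> 1 \<Longrightarrow> cmod (cutoff r ((twist h ^^ K) P) x) \<le> B"
    using twist_pow_bounded[of r K P] by blast
  define J where "J = enn2real (\<integral>\<^sup>+t. ennreal (1 / (1 + t\<^sup>2)) \<partial>lborel)"
  have J: "(\<integral>\<^sup>+t. ennreal (1 / (1 + (t - a)\<^sup>2)) \<partial>lborel) = ennreal J" for a
    unfolding J_def nn_integral_shifted_inverse_1_plus_square
    using nn_integral_inverse_1_plus_square by simp
  have Jc: "(\<integral>\<^sup>+t. ennreal k * ennreal (1 / (1 + (t - a)\<^sup>2)) \<partial>lborel) = ennreal k * ennreal J" for a k
    by (subst nn_integral_cmult) (simp_all add: J)
  \<comment> \<open>At frequency 1/h the mirror bump is evaluated at distance 2/h from its centre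
    and is at most D h. Below \<open>h0\<close> this is at most half of the main contribution
    \<open>I0\<close>, whence (I0 - I0 / 2) / 2 = I0 / 4.\<close>
  define h0 where "h0 = min 1 (I0 / (2 * D))"
  have h0: "h0 > 0" "h0 \<le> 1" using I0 D by (auto simp: h0_def)
  define C where "C = B + D\<^sup>2 * 2 ^ m * J + 1"
  have J0: "J \<ge> 0" by (simp add: J_def)
  show thesis
  proof (rule that[of C "I0 / 4" h0 F g])
    show "C > 0" using B J0 by (auto simp: C_def intro!: add_nonneg_pos add_nonneg_nonneg mult_nonneg_nonneg)
    show "I0 / 4 > 0" "h0 > 0" "h0 \<le> 1" using I0 h0 by auto
    show "F h \<in> borel_measurable borel" "g h \<in> borel_measurable borel" for h
      unfolding F_def[abs_def] g_def[abs_def] by measurable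
    show "F h x = 0" if "x \<notin> {-r..r}" for h x
      using that by (auto simp: F_def H_def cutoff_def)
    show "\<bar>F h x\<bar> \<le> C" if "0 < h" "h \<le> h0" for h x
    proof -
      have "\<bar>F h x\<bar> \<le> cmod (H h x)" unfolding F_def by (rule abs_Re_le_cmod)
      also have "\<dots> \<le> B" using that h0 B by (simp add: H_def norm_mult)
      finally show ?thesis using J0 by (simp add: C_def add_increasing2)
    qed
    show "cmod (ft (\<lambda>x. complex_of_real (F h x)) t) \<le> \<bar>h * t\<bar> ^ K * g h t" if "0 < h" "h \<le> h0" for h t
    proof -
      have "cmod (ft (\<lambda>x. complex_of_real (F h x)) t) \<le> (cmod (ft (H h) t) + cmod (ft (H h) (- t))) / 2"
        unfolding ftF using norm_triangle_ineq[of "ft (H h) t" "cnj (ft (H h) (- t))"]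
        by (simp add: norm_divide)
      also have "\<dots> = \<bar>h * t\<bar> ^ K * ((cmod (ft (cutoff r P) (t - 1 / h)) + cmod (ft (cutoff r P) (- t - 1 / h))) / 2)"
        using that(1) by (simp add: ftH norm_mult norm_power algebra_simps flip: of_real_mult)
      also have "\<dots> \<le> \<bar>h * t\<bar> ^ K * ((D * (1 / (1 + \<bar>t - 1 / h\<bar>) ^ N) + D * (1 / (1 + \<bar>- t - 1 / h\<bar>) ^ N)) / 2)"
        by (intro mult_left_mono divide_right_mono add_mono decay) auto
      also have "\<bar>- t - 1 / h\<bar> = \<bar>t - (- 1 / h)\<bar>" by simp
      finally show ?thesis by (simp add: g_def algebra_simps)
    qed
    show "(\<integral>\<^sup>+t. ennreal ((1 + \<bar>h * t\<bar>) ^ m * (g h t)\<^sup>2) \<partial>lborel) \<le> ennreal C" if h: "0 < h" "h \<le> h0" for h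
    proof -
      have h1: "h \<le> 1" using h h0 by simp
      have le: "(1 + \<bar>h * t\<bar>) ^ m * (g h t)\<^sup>2
          \<le> D\<^sup>2 / 2 * 2 ^ m * (1 / (1 + (t - 1 / h)\<^sup>2)) + D\<^sup>2 / 2 * 2 ^ m * (1 / (1 + (t - (- 1 / h))\<^sup>2))" for t
      proof -
        have "(g h t)\<^sup>2 \<le> D\<^sup>2 / 2 * ((1 / (1 + \<bar>t - 1 / h\<bar>) ^ N)\<^sup>2 + (1 / (1 + \<bar>t - (- 1 / h)\<bar>) ^ N)\<^sup>2)"
        proof -
          have "(D / 2 * (a + b))\<^sup>2 \<le> D\<^sup>2 / 2 * (a\<^sup>2 + b\<^sup>2)" for a b :: real
          proof -
            have "D\<^sup>2 / 2 * (a\<^sup>2 + b\<^sup>2) = (D / 2 * (a + b))\<^sup>2 + (D / 2 * (a - b))\<^sup>2"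
              by (simp add: power2_eq_square field_simps)
            then show ?thesis by simp
          qed
          then show ?thesis unfolding g_def .
        qed
        then have "(1 + \<bar>h * t\<bar>) ^ m * (g h t)\<^sup>2 \<le> (1 + \<bar>h * t\<bar>) ^ m *
            (D\<^sup>2 / 2 * ((1 / (1 + \<bar>t - 1 / h\<bar>) ^ N)\<^sup>2 + (1 / (1 + \<bar>t - (- 1 / h)\<bar>) ^ N)\<^sup>2))"
          by (rule mult_left_mono) simp
        also have "\<dots> = D\<^sup>2 / 2 * ((1 + \<bar>h * t\<bar>) ^ m * (1 / (1 + \<bar>t - 1 / h\<bar>) ^ N)\<^sup>2)
            + D\<^sup>2 / 2 * ((1 + \<bar>h * t\<bar>) ^ m * (1 / (1 + \<bar>t - (- 1 / h)\<bar>) ^ N)\<^sup>2)"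
          by (simp only: distrib_left mult_ac)
        also have "\<dots> \<le> D\<^sup>2 / 2 * (2 ^ m * (1 / (1 + (t - 1 / h)\<^sup>2))) + D\<^sup>2 / 2 * (2 ^ m * (1 / (1 + (t - (- 1 / h))\<^sup>2)))"
          using h h1 by (intro add_mono mult_left_mono weight_decay_bound) (auto simp: N_def)
        finally show ?thesis by (simp only: mult.assoc)
      qed
      have "(\<integral>\<^sup>+t. ennreal ((1 + \<bar>h * t\<bar>) ^ m * (g h t)\<^sup>2) \<partial>lborel)
        \<le> (\<integral>\<^sup>+t. ennreal (D\<^sup>2 / 2 * 2 ^ m) * ennreal (1 / (1 + (t - 1 / h)\<^sup>2))
             + ennreal (D\<^sup>2 / 2 * 2 ^ m) * ennreal (1 / (1 + (t - (- 1 / h))\<^sup>2)) \<partial>lborel)"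
        by (intro nn_integral_mono) (use le in \<open>simp del: ennreal_plus add: ennreal_leI
            flip: ennreal_mult' ennreal_plus\<close>)
      also have "\<dots> = ennreal (D\<^sup>2 / 2 * 2 ^ m) * ennreal J + ennreal (D\<^sup>2 / 2 * 2 ^ m) * ennreal J"
        by (subst nn_integral_add, measurable) (simp only: Jc)
      also have "\<dots> = ennreal (D\<^sup>2 * 2 ^ m * J)"
        using J0 by (simp flip: ennreal_mult' ennreal_plus add: field_simps)
      also have "\<dots> \<le> ennreal C" using B by (intro ennreal_leI) (simp add: C_def)
      finally show ?thesis .
    qed
    show "I0 / 4 \<le> Re (ft (\<lambda>x. complex_of_real (F h x)) (1 / h))" if h: "0 < h" "h \<le> h0" for h
    proof -
      \<comment> \<open>At t = 1/h the factor (h t)^K is 1 and the shifted transform is evaluated at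
        0, where it equals the integral \<open>I0\<close> of the bump.\<close>
      have "Re (ft (\<lambda>x. complex_of_real (F h x)) (1 / h)) = (I0 + Re (ft (H h) (- (1 / h)))) / 2"
        unfolding ftF using h by (simp add: ftH ft0)
      moreover have "cmod (ft (H h) (- (1 / h))) \<le> I0 / 2"
      proof -
        have "cmod (ft (H h) (- (1 / h))) = cmod (ft (cutoff r P) (- 2 / h))"
          using h by (simp add: ftH norm_mult norm_power)
        also have "\<dots> \<le> D * (1 / (1 + \<bar>- 2 / h\<bar>) ^ N)" by (rule decay)
        also have "\<dots> \<le> D * (1 / (1 / h) ^ 1)"
        proof (intro mult_left_mono divide_left_mono)
          have "(1 / h) ^ 1 \<le> (1 + \<bar>- 2 / h\<bar>) ^ 1" using h by (simp add: field_simps)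
          also have "\<dots> \<le> (1 + \<bar>- 2 / h\<bar>) ^ N" by (rule power_increasing) (auto simp: N_def)
          finally show "(1 / h) ^ 1 \<le> (1 + \<bar>- 2 / h\<bar>) ^ N" .
        qed (use D h in \<open>auto intro!: divide_pos_pos zero_less_power add_pos_nonneg\<close>)
        also have "\<dots> \<le> D * (I0 / (2 * D))"
          using h D by (intro mult_left_mono) (auto simp: h0_def)
        finally show ?thesis using D by simp
      qed
      then have "- (I0 / 2) \<le> Re (ft (H h) (- (1 / h)))"
        using abs_Re_le_cmod[of "ft (H h) (- (1 / h))"] by linarith
      ultimately show ?thesis using I0 by (simp add: field_simps)
    qed
  qed
qed

subsection \<open>Tensor products on Euclidean space\<close>

text \<open>Lebesgue measure is a product over basis vectors, while coordinates of
  \<open>real ^ 'd\<close> carry indices; \<open>axis_index\<close> translates between the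
  two.\<close>

lemma prod_Basis_cart:
  "(\<Prod>b\<in>Basis. f (axis_index b) (x \<bullet> b)) = (\<Prod>i\<in>UNIV. f i ((x :: real ^ 'd) $ i))"
proof -
  have "(Basis :: (real ^ 'd) set) = range (\<lambda>i. axis i 1)"
    by (auto simp: Basis_vec_def)
  then have "(\<Prod>b\<in>Basis. f (axis_index b) (x \<bullet> b)) = (\<Prod>b\<in>range (\<lambda>i::'d. axis i 1). f (axis_index b) (x \<bullet> b))"
    by simp
  also have "\<dots> = (\<Prod>i\<in>UNIV. f i (x $ i))"
    by (subst prod.reindex) (auto simp: inj_on_def axis_eq_axis cart_eq_inner_axis)
  finally show ?thesis .
qed

lemma prod_Basis_cart':
  "(\<Prod>b\<in>(Basis :: (real ^ 'd) set). g (axis_index b)) = (\<Prod>i\<in>UNIV. g i)"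
  using prod_Basis_cart[of "\<lambda>i _. g i" 0] by simp

lemma nn_integral_cart_prod:
  fixes f :: "'d::finite \<Rightarrow> real \<Rightarrow> ennreal"
  assumes [measurable]: "\<And>i. f i \<in> borel_measurable borel"
  shows "(\<integral>\<^sup>+x. (\<Prod>i\<in>UNIV. f i (x $ i)) \<partial>(lborel :: (real ^ 'd) measure)) = (\<Prod>i\<in>UNIV. \<integral>\<^sup>+x. f i x \<partial>lborel)"
  using nn_integral_lborel_prod[of "\<lambda>b::real^'d. f (axis_index b)"]
  unfolding prod_Basis_cart prod_Basis_cart'[of "\<lambda>i. \<integral>\<^sup>+x. f i x \<partial>lborel"] by simp

text \<open>Lebesgue measure is the image of a product of one-dimensional copies under the
  coordinate map, so Fubini for finite products carries over.\<close>

lemma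
  fixes f :: "'d::finite \<Rightarrow> real \<Rightarrow> 'a::{real_normed_field, banach, second_countable_topology}"
  assumes int: "\<And>i. integrable lborel (f i)"
  shows integrable_cart_prod: "integrable (lborel :: (real ^ 'd) measure) (\<lambda>x. \<Prod>i\<in>UNIV. f i (x $ i))" (is ?A)
    and integral_cart_prod: "(LINT x|(lborel :: (real ^ 'd) measure). (\<Prod>i\<in>UNIV. f i (x $ i))) = (\<Prod>i\<in>UNIV. LINT x|lborel. f i x)" (is ?B)
proof -
  interpret product_sigma_finite "\<lambda>_::real^'d. lborel :: real measure" ..
  have [measurable]: "f i \<in> borel_measurable borel" for i
    using int[of i] by auto
  let ?S = "\<lambda>g::real^'d \<Rightarrow> real. \<Sum>b\<in>Basis. g b *\<^sub>R b"
  let ?h = "\<lambda>x::real^'d. \<Prod>b\<in>Basis. f (axis_index b) (x \<bullet> b)"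
  have m [measurable]: "?S \<in> measurable (\<Pi>\<^sub>M b\<in>Basis. lborel) borel" by simp
  have *: "?h (?S g) = (\<Prod>b\<in>Basis. f (axis_index b) (g b))" for g
    by (intro prod.cong refl) simp
  have "integrable (\<Pi>\<^sub>M b\<in>(Basis :: (real^'d) set). lborel) (\<lambda>g. \<Prod>b\<in>Basis. f (axis_index b) (g b))"
    by (rule product_integrable_prod) (auto intro: int)
  then show ?A
    unfolding prod_Basis_cart[symmetric]
    by (subst lborel_eq, subst integrable_distr_eq) (simp_all add: *)
  have "(LINT g|(\<Pi>\<^sub>M b\<in>(Basis :: (real^'d) set). lborel). (\<Prod>b\<in>Basis. f (axis_index b) (g b))) = (\<Prod>i\<in>UNIV. LINT x|lborel. f i x)"
    by (subst product_integral_prod) (auto intro: int simp: prod_Basis_cart'[of "\<lambda>i. LINT x|lborel. f i x"])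
  then show ?B
    unfolding prod_Basis_cart[symmetric]
    by (subst lborel_eq, subst integral_distr) (simp_all add: *)
qed

lemma fourier_cart_prod:
  fixes u :: "'d::finite \<Rightarrow> real \<Rightarrow> real"
  assumes "\<And>i. integrable lborel (u i)"
  shows "fourier (\<lambda>x. \<Prod>i\<in>UNIV. u i (x $ i)) \<omega> = (\<Prod>i\<in>UNIV. ft (\<lambda>x. complex_of_real (u i x)) (\<omega> $ i))"
proof -
  have "cis (- (x \<bullet> \<omega>)) = (\<Prod>i\<in>UNIV. cis (- (x $ i * \<omega> $ i)))" for x :: "real ^ 'd"
    by (simp add: inner_vec_def cis_conv_exp sum_distrib_left sum_negf flip: exp_sum)
  then have "cis (- (x \<bullet> \<omega>)) * complex_of_real (\<Prod>i\<in>UNIV. u i (x $ i))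
      = (\<Prod>i\<in>UNIV. cis (- (x $ i * \<omega> $ i)) * complex_of_real (u i (x $ i)))" for x :: "real ^ 'd"
    by (simp add: prod.distrib)
  then show ?thesis
    unfolding fourier_def ft_def
    by (simp only:) (rule integral_cart_prod, intro integrable_cis_mult, auto intro: assms)
qed

lemma one_plus_sum_le_prod:
  fixes a :: "'i \<Rightarrow> real"
  assumes "finite I" "\<And>i. i \<in> I \<Longrightarrow> 0 \<le> a i"
  shows "1 + (\<Sum>i\<in>I. a i) \<le> (\<Prod>i\<in>I. 1 + a i)"
  using assms
proof (induction I rule: finite_induct)
  case (insert i I)
  have "1 + (\<Sum>i\<in>insert i I. a i) \<le> (1 + a i) * (1 + (\<Sum>i\<in>I. a i))"
    using insert by (simp add: algebra_simps sum_nonneg)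
  also have "\<dots> \<le> (1 + a i) * (\<Prod>i\<in>I. 1 + a i)"
    using insert by (intro mult_left_mono) auto
  finally show ?case using insert by simp
qed simp

lemma ft_measurable [measurable]:
  assumes "integrable lborel u"
  shows "ft u \<in> borel_measurable borel"
proof -
  have [measurable]: "u \<in> borel_measurable borel" using assms by auto
  show ?thesis unfolding ft_def by measurable
qed

text \<open>The weight does not factorise, but |\<omega>| is at most the sum of the |\<omega>_i|,
  hence at most the product of the 1 + |\<omega>_i|. The loss is harmless when a single coordinate
  oscillates: the others contribute factors that do not depend on h.\<close>

lemma sobolev_cart_prod:
  fixes u :: "'d::finite \<Rightarrow> real \<Rightarrow> real"
  assumes u: "\<And>i. integrable lborel (u i)" and "\<beta> > 0"
  shows "sobolev_norm_sq \<beta> (\<lambda>x. \<Prod>i\<in>UNIV. u i (x $ i))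
    \<le> (\<Prod>i\<in>UNIV. \<integral>\<^sup>+t. ennreal ((1 + \<bar>t\<bar>) powr (2 * \<beta>) * (cmod (ft (\<lambda>x. complex_of_real (u i x)) t))\<^sup>2) \<partial>lborel)"
proof -
  have [measurable]: "ft (\<lambda>x. complex_of_real (u i x)) \<in> borel_measurable borel" for i
    by (intro ft_measurable) (use u in simp)
  have "norm \<omega> powr (2 * \<beta>) * (cmod (fourier (\<lambda>x. \<Prod>i\<in>UNIV. u i (x $ i)) \<omega>))\<^sup>2
     \<le> (\<Prod>i\<in>UNIV. (1 + \<bar>\<omega> $ i\<bar>) powr (2 * \<beta>) * (cmod (ft (\<lambda>x. complex_of_real (u i x)) (\<omega> $ i)))\<^sup>2)" for \<omega> :: "real ^ 'd"
  proof -
    have "norm \<omega> \<le> (\<Sum>i\<in>UNIV. \<bar>\<omega> $ i\<bar>)" by (rule norm_le_l1_cart)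
    also have "\<dots> \<le> (\<Prod>i\<in>UNIV. 1 + \<bar>\<omega> $ i\<bar>)"
      using one_plus_sum_le_prod[of UNIV "\<lambda>i. \<bar>\<omega> $ i\<bar>"] by simp
    finally have "norm \<omega> powr (2 * \<beta>) \<le> (\<Prod>i\<in>UNIV. 1 + \<bar>\<omega> $ i\<bar>) powr (2 * \<beta>)"
      using assms by (intro powr_mono2) auto
    also have "\<dots> = (\<Prod>i\<in>UNIV. (1 + \<bar>\<omega> $ i\<bar>) powr (2 * \<beta>))"
      by (rule prod_powr_distrib)
    finally show ?thesis
      by (simp add: fourier_cart_prod[OF u] prod.distrib mult_right_mono flip: prod_norm prod_power_distrib)
  qed
  then have "sobolev_norm_sq \<beta> (\<lambda>x. \<Prod>i\<in>UNIV. u i (x $ i)) \<le> (\<integral>\<^sup>+\<omega>. (\<Prod>i\<in>UNIV.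
       ennreal ((1 + \<bar>\<omega> $ i\<bar>) powr (2 * \<beta>) * (cmod (ft (\<lambda>x. complex_of_real (u i x)) (\<omega> $ i)))\<^sup>2)) \<partial>(lborel :: (real ^ 'd) measure))"
    unfolding sobolev_norm_sq_def
    by (intro nn_integral_mono) (simp add: prod_ennreal ennreal_leI)
  also have "\<dots> = (\<Prod>i\<in>UNIV. \<integral>\<^sup>+t. ennreal ((1 + \<bar>t\<bar>) powr (2 * \<beta>) * (cmod (ft (\<lambda>x. complex_of_real (u i x)) t))\<^sup>2) \<partial>lborel)"
    by (rule nn_integral_cart_prod) measurable
  finally show ?thesis .
qed

section \<open>Quadratic forms of the Gaussian kernel\<close>

definition gauss_form :: "real \<Rightarrow> ('a::euclidean_space \<Rightarrow> real) \<Rightarrow> ('a \<Rightarrow> real) \<Rightarrow> real" where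
  "gauss_form s f g = (LINT x|lborel. f x * (LINT y|lborel. exp (- s * (norm (x - y))\<^sup>2) * g y))"

lemma integrable_gauss_mult:
  fixes u :: "'a::euclidean_space \<Rightarrow> real"
  assumes u: "integrable lborel u" and s: "s \<ge> 0"
  shows "integrable lborel (\<lambda>y. exp (- s * (norm (x - y))\<^sup>2) * u y)"
    and "\<bar>LINT y|lborel. exp (- s * (norm (x - y))\<^sup>2) * u y\<bar> \<le> (LINT y|lborel. \<bar>u y\<bar>)"
proof -
  have [measurable]: "u \<in> borel_measurable borel" using u by auto
  have le: "\<bar>exp (- s * (norm (x - y))\<^sup>2) * u y\<bar> \<le> \<bar>u y\<bar>" for y
    using s by (simp add: abs_mult mult_left_le_one_le)
  show 1: "integrable lborel (\<lambda>y. exp (- s * (norm (x - y))\<^sup>2) * u y)"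
    using u by (rule Bochner_Integration.integrable_bound) (use le in auto)
  have "\<bar>LINT y|lborel. exp (- s * (norm (x - y))\<^sup>2) * u y\<bar> \<le> (LINT y|lborel. \<bar>exp (- s * (norm (x - y))\<^sup>2) * u y\<bar>)"
    by (rule integral_abs_bound)
  also have "\<dots> \<le> (LINT y|lborel. \<bar>u y\<bar>)"
    using 1 u le by (intro integral_mono integrable_abs)
  finally show "\<bar>LINT y|lborel. exp (- s * (norm (x - y))\<^sup>2) * u y\<bar> \<le> (LINT y|lborel. \<bar>u y\<bar>)" .
qed

lemma integrable_mult_gauss:
  fixes u v :: "'a::euclidean_space \<Rightarrow> real"
  assumes u: "integrable lborel u" and v: "integrable lborel v" and s: "s \<ge> 0"
  shows "integrable lborel (\<lambda>x. u x * (LINT y|lborel. exp (- s * (norm (x - y))\<^sup>2) * v y))"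
proof -
  have [measurable]: "u \<in> borel_measurable borel" "v \<in> borel_measurable borel" using u v by auto
  have "integrable lborel (\<lambda>x. u x * (LINT y|lborel. \<bar>v y\<bar>))" using u by simp
  then show ?thesis
  proof (rule Bochner_Integration.integrable_bound)
    show "AE x in lborel. norm (u x * (LINT y|lborel. exp (- s * (norm (x - y))\<^sup>2) * v y)) \<le> norm (u x * (LINT y|lborel. \<bar>v y\<bar>))"
      using integrable_gauss_mult(2)[OF v s]
      by (auto simp: abs_mult intro!: AE_I2 mult_left_mono intro: order.trans[OF _ abs_ge_self])
  qed measurable
qed

lemma gauss_form_cart_prod:
  fixes u :: "'d::finite \<Rightarrow> real \<Rightarrow> real"
  assumes u: "\<And>i. integrable lborel (u i)" and s: "s \<ge> 0"
  shows "gauss_form s (\<lambda>x::real^'d. \<Prod>i\<in>UNIV. u i (x $ i)) (\<lambda>x. \<Prod>i\<in>UNIV. u i (x $ i))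
    = (\<Prod>i\<in>UNIV. gauss_form s (u i) (u i))"
proof -
  have "(LINT y|lborel. exp (- s * (norm (x - y))\<^sup>2) * (\<Prod>i\<in>UNIV. u i (y $ i)))
      = (\<Prod>i\<in>UNIV. LINT y|lborel. exp (- s * (norm (x $ i - y))\<^sup>2) * u i y)" for x :: "real ^ 'd"
  proof -
    have "exp (- s * (norm (x - y))\<^sup>2) * (\<Prod>i\<in>UNIV. u i (y $ i)) = (\<Prod>i\<in>UNIV. exp (- s * (norm (x $ i - y $ i))\<^sup>2) * u i (y $ i))" for y
    proof -
      have "(norm (x - y))\<^sup>2 = (\<Sum>i\<in>UNIV. (norm (x $ i - y $ i))\<^sup>2)"
        by (simp add: power2_norm_eq_inner inner_vec_def) (simp add: power2_eq_square)
      then have "exp (- s * (norm (x - y))\<^sup>2) = (\<Prod>i\<in>UNIV. exp (- s * (norm (x $ i - y $ i))\<^sup>2))"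
        by (simp add: sum_distrib_left flip: exp_sum)
      then show ?thesis by (simp add: prod.distrib)
    qed
    then show ?thesis
      by (simp only:) (rule integral_cart_prod, rule integrable_gauss_mult[OF u s])
  qed
  then show ?thesis
    unfolding gauss_form_def
    by (simp only: flip: prod.distrib) (rule integral_cart_prod, rule integrable_mult_gauss[OF u u s])
qed

lemma char_std_normal_cis:
  "(LINT z|std_normal_distribution. cis (a * z)) = complex_of_real (exp (- a\<^sup>2 / 2))"
  using fun_cong[OF char_std_normal_distribution, of a] by (simp add: char_def cis_conv_exp)

lemma cnj_ft_of_real: "cnj (ft (\<lambda>x. complex_of_real (u x)) t) = ft (\<lambda>x. complex_of_real (u x)) (- t)"
proof -
  have "cnj (ft (\<lambda>x. complex_of_real (u x)) t) = (LINT x|lborel. cnj (cis (- (x * t)) * complex_of_real (u x)))"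
    unfolding ft_def by (rule Bochner_Integration.integral_cnj[symmetric])
  then show ?thesis by (simp add: ft_def cis_cnj)
qed

text \<open>Justifies the exchanges of integrals below: \<open>u\<close> provides integrability in
  the first variable, and in the second, which ranges over a probability space, boundedness is
  enough.\<close>

lemma integrable_fst_bounded:
  fixes u :: "'a \<Rightarrow> complex" and w :: "'a \<times> 'b \<Rightarrow> complex"
  assumes u: "integrable M u" and "sigma_finite_measure M" and "prob_space N"
    and w[measurable]: "w \<in> borel_measurable (M \<Otimes>\<^sub>M N)" and le: "\<And>p. cmod (w p) \<le> B"
  shows "integrable (M \<Otimes>\<^sub>M N) (\<lambda>p. u (fst p) * w p)"
proof -
  interpret M: sigma_finite_measure M by fact
  interpret N: prob_space N by fact
  interpret pair_sigma_finite M N ..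
  have [measurable]: "u \<in> borel_measurable M" using u by auto
  have "integrable (M \<Otimes>\<^sub>M N) (\<lambda>p. u (fst p))"
    by (rule Fubini_integrable) (use u in \<open>auto simp: N.prob_space\<close>)
  then have "integrable (M \<Otimes>\<^sub>M N) (\<lambda>p. u (fst p) * complex_of_real B)" by simp
  then show ?thesis
  proof (rule Bochner_Integration.integrable_bound)
    show "AE p in M \<Otimes>\<^sub>M N. norm (u (fst p) * w p) \<le> norm (u (fst p) * complex_of_real B)"
      using le by (auto simp: norm_mult intro!: AE_I2 mult_left_mono intro: order.trans[OF _ abs_ge_self])
  qed measurable
qed

text \<open>The kernel is itself a characteristic function: exp(-s x^2) is the mean of cis(sqrt(2 s)
  x z) for a standard normal z. Exchanging the order of integration turns the form into a Gaussian
  average of squared moduli of the transform.\<close>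

lemma gauss_form_ft:
  fixes u :: "real \<Rightarrow> real"
  assumes u: "integrable lborel u" and s: "s > 0"
  shows "gauss_form s u u = (LINT z|std_normal_distribution. (cmod (ft (\<lambda>x. complex_of_real (u x)) (sqrt (2 * s) * z)))\<^sup>2)"
proof -
  let ?N = "std_normal_distribution"
  let ?U = "\<lambda>x. complex_of_real (u x)"
  let ?c = "sqrt (2 * s)"
  interpret N: prob_space ?N by (rule prob_space_normal_density) simp
  interpret P: pair_sigma_finite lborel ?N ..
  have U: "integrable lborel ?U" using u by simp
  have [measurable]: "u \<in> borel_measurable borel" using u by auto
  have [measurable]: "ft ?U \<in> borel_measurable borel" by (rule ft_measurable[OF U])
  have ker: "complex_of_real (exp (- s * (norm (x - y))\<^sup>2)) = (LINT z|?N. cis (?c * (x - y) * z))" for x y :: real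
    unfolding char_std_normal_cis using s by (simp add: power_mult_distrib)
  have inner: "complex_of_real (LINT y|lborel. exp (- s * (norm (x - y))\<^sup>2) * u y)
      = (LINT z|?N. cis (?c * x * z) * ft ?U (?c * z))" for x
  proof -
    have "complex_of_real (LINT y|lborel. exp (- s * (norm (x - y))\<^sup>2) * u y)
        = (LINT y|lborel. (LINT z|?N. ?U y * cis (?c * (x - y) * z)))"
      unfolding integral_mult_right_zero ker[symmetric] integral_complex_of_real[symmetric]
      by (intro Bochner_Integration.integral_cong) auto
    also have "\<dots> = (LINT z|?N. (LINT y|lborel. ?U y * cis (?c * (x - y) * z)))"
    proof (rule P.Fubini_integral[symmetric])
      have "integrable (lborel \<Otimes>\<^sub>M ?N) (\<lambda>p. ?U (fst p) * cis (?c * (x - fst p) * snd p))"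
        by (rule integrable_fst_bounded[where B = 1])
          (auto intro: U lborel.sigma_finite_measure_axioms N.prob_space_axioms)
      then show "integrable (lborel \<Otimes>\<^sub>M ?N) (\<lambda>(y, z). ?U y * cis (?c * (x - y) * z))"
        by (simp add: case_prod_beta')
    qed
    also have "\<dots> = (LINT z|?N. cis (?c * x * z) * ft ?U (?c * z))"
      unfolding ft_def integral_mult_right_zero[symmetric]
      by (intro Bochner_Integration.integral_cong refl) (simp add: cis_mult algebra_simps flip: mult.assoc)
    finally show ?thesis .
  qed
  obtain B where B: "\<And>t. cmod (ft ?U t) \<le> B" using ft_bound[OF U] by blast
  have "complex_of_real (gauss_form s u u) = (LINT x|lborel. ?U x * complex_of_real (LINT y|lborel. exp (- s * (norm (x - y))\<^sup>2) * u y))"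
    unfolding gauss_form_def by (simp flip: integral_complex_of_real)
  also have "\<dots> = (LINT x|lborel. (LINT z|?N. ?U x * (cis (?c * x * z) * ft ?U (?c * z))))"
    unfolding inner by simp
  also have "\<dots> = (LINT z|?N. (LINT x|lborel. ?U x * (cis (?c * x * z) * ft ?U (?c * z))))"
  proof (rule P.Fubini_integral[symmetric])
    have "integrable (lborel \<Otimes>\<^sub>M ?N) (\<lambda>p. ?U (fst p) * (cis (?c * fst p * snd p) * ft ?U (?c * snd p)))"
      by (rule integrable_fst_bounded[where B = B])
        (auto simp: norm_mult intro: B U lborel.sigma_finite_measure_axioms N.prob_space_axioms)
    then show "integrable (lborel \<Otimes>\<^sub>M ?N) (\<lambda>(x, z). ?U x * (cis (?c * x * z) * ft ?U (?c * z)))"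
      by (simp add: case_prod_beta')
  qed
  also have "\<dots> = (LINT z|?N. ft ?U (?c * z) * ft ?U (- (?c * z)))"
    unfolding ft_def[of _ "- _"] integral_mult_right_zero[symmetric]
    by (intro Bochner_Integration.integral_cong refl) (simp add: mult_ac)
  \<comment> \<open>For real \<open>u\<close> the transform at -t is the conjugate of the transform
    at t, so the product is a squared modulus.\<close>
  also have "\<dots> = (LINT z|?N. complex_of_real ((cmod (ft ?U (?c * z)))\<^sup>2))"
    unfolding cnj_ft_of_real[symmetric] complex_mult_cnj cmod_power2 by simp
  also have "\<dots> = complex_of_real (LINT z|?N. (cmod (ft ?U (?c * z)))\<^sup>2)"
    by (rule integral_complex_of_real)
  finally show ?thesis by (simp only: of_real_eq_iff)
qed

text \<open>Substituting t = sqrt(2 s) z produces the factor s^(-1/2), and the normal density at t /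
  sqrt(2 s) is exp(-t^2 / (4 s)) divided by sqrt(2 pi) \<ge> 1.\<close>

lemma gauss_form_bounds:
  fixes u :: "real \<Rightarrow> real"
  assumes u: "integrable lborel u" and s: "s > 0" and D: "D \<ge> 0"
    and le: "(\<integral>\<^sup>+t. ennreal ((cmod (ft (\<lambda>x. complex_of_real (u x)) t))\<^sup>2 * exp (- t\<^sup>2 / (4 * s))) \<partial>lborel) \<le> ennreal D"
  shows "0 \<le> gauss_form s u u" "gauss_form s u u \<le> D * s powr (-1/2)"
proof -
  let ?N = "std_normal_distribution"
  let ?U = "\<lambda>x. complex_of_real (u x)"
  let ?c = "sqrt (2 * s)"
  have U: "integrable lborel ?U" using u by simp
  have [measurable]: "ft ?U \<in> borel_measurable borel" by (rule ft_measurable[OF U])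
  show "0 \<le> gauss_form s u u" unfolding gauss_form_ft[OF u s] by simp
  define X where "X = (\<integral>\<^sup>+z. ennreal ((cmod (ft ?U (?c * z)))\<^sup>2) \<partial>?N)"
  have "X = (\<integral>\<^sup>+z. ennreal (std_normal_density z) * ennreal ((cmod (ft ?U (?c * z)))\<^sup>2) \<partial>lborel)"
    unfolding X_def by (subst nn_integral_density) auto
  moreover have "(\<integral>\<^sup>+t. ennreal (std_normal_density (t / ?c)) * ennreal ((cmod (ft ?U t))\<^sup>2) \<partial>lborel)
      = ennreal ?c * (\<integral>\<^sup>+z. ennreal (std_normal_density z) * ennreal ((cmod (ft ?U (?c * z)))\<^sup>2) \<partial>lborel)"
    using nn_integral_real_affine[of "\<lambda>t. ennreal (std_normal_density (t / ?c)) * ennreal ((cmod (ft ?U t))\<^sup>2)" ?c 0] s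
    by simp
  moreover have "(\<integral>\<^sup>+t. ennreal (std_normal_density (t / ?c)) * ennreal ((cmod (ft ?U t))\<^sup>2) \<partial>lborel)
      \<le> (\<integral>\<^sup>+t. ennreal ((cmod (ft ?U t))\<^sup>2 * exp (- t\<^sup>2 / (4 * s))) \<partial>lborel)"
  proof (rule nn_integral_mono)
    fix t :: real
    have "1 \<le> sqrt (2 * pi)" using pi_gt3 by simp
    then have "std_normal_density (t / ?c) \<le> exp (- t\<^sup>2 / (4 * s))"
      unfolding std_normal_density_def using s
      by (intro mult_left_le_one_le[THEN order.trans]) (auto simp: power_divide)
    then have "std_normal_density (t / ?c) * (cmod (ft ?U t))\<^sup>2 \<le> exp (- t\<^sup>2 / (4 * s)) * (cmod (ft ?U t))\<^sup>2"
      by (rule mult_right_mono) simp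
    then have "ennreal (std_normal_density (t / ?c) * (cmod (ft ?U t))\<^sup>2) \<le> ennreal ((cmod (ft ?U t))\<^sup>2 * exp (- t\<^sup>2 / (4 * s)))"
      unfolding mult.commute[of "(cmod (ft ?U t))\<^sup>2"] by (rule ennreal_leI)
    then show "ennreal (std_normal_density (t / ?c)) * ennreal ((cmod (ft ?U t))\<^sup>2) \<le> ennreal ((cmod (ft ?U t))\<^sup>2 * exp (- t\<^sup>2 / (4 * s)))"
      by (subst ennreal_mult'[symmetric]) simp_all
  qed
  ultimately have cX: "ennreal ?c * X \<le> ennreal D" using le by simp
  have c: "?c > 0" using s by simp
  have "X = ennreal (1 / ?c) * (ennreal ?c * X)"
    using c by (simp add: mult.assoc[symmetric] ennreal_mult'[symmetric])
  also have "\<dots> \<le> ennreal (1 / ?c) * ennreal D" by (intro mult_left_mono cX) simp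
  also have "\<dots> = ennreal (D / ?c)" using c D by (simp add: ennreal_mult'[symmetric])
  finally have X: "X \<le> ennreal (D / ?c)" .
  have "gauss_form s u u = enn2real X"
    unfolding gauss_form_ft[OF u s] X_def by (subst integral_eq_nn_integral) auto
  also have "\<dots> \<le> D / ?c" using X c D by (intro enn2real_leI) auto
  also have "\<dots> \<le> D / sqrt s"
    using s D by (intro divide_left_mono) auto
  also have "\<dots> = D * s powr (-1/2)"
    using powr_minus_divide[of s "1/2"] powr_half_sqrt[of s] s by simp
  finally show "gauss_form s u u \<le> D * s powr (-1/2)" .
qed

subsection \<open>The energy distance as a Gaussian mixture\<close>

text \<open>The mixing density that represents |x|^\<gamma> by Gaussians. It is extended by 0 to s
  \<le> 0, so that all integrals run over the whole line.\<close>

definition riesz :: "real \<Rightarrow> real \<Rightarrow> real" where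
  "riesz \<gamma> s = indicat_real {0<..} s * s powr (- \<gamma> / 2 - 1)"

lemma riesz_measurable [measurable]: "riesz \<gamma> \<in> borel_measurable borel"
  unfolding riesz_def by measurable

lemma riesz_nonneg: "0 \<le> riesz \<gamma> s"
  by (simp add: riesz_def)

lemma nn_integral_powr_from_0:
  assumes "p > -1" "b \<ge> 0"
  shows "(\<integral>\<^sup>+s. ennreal (indicat_real {0..b} s * s powr p) \<partial>lborel) = ennreal (b powr (p + 1) / (p + 1))"
  using nn_integral_has_integral_lebesgue[OF _ has_integral_powr_from_0[OF assms]] by simp

lemma nn_integral_powr_to_inf:
  assumes "p < -1" "b > 0"
  shows "(\<integral>\<^sup>+s. ennreal (indicat_real {b..} s * s powr p) \<partial>lborel) = ennreal (- (b powr (p + 1)) / (p + 1))"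
  using nn_integral_has_integral_lebesgue[OF _ has_integral_powr_to_inf[OF assms]] by simp

text \<open>Below s = b the factor (s / b)^k restores integrability at 0, above it the tail
  converges by itself; the two ranges give the two summands of the constant. For b = h^(-2) and q =
  d / 2 the power of b becomes h^(d + \<gamma>).\<close>

lemma nn_integral_riesz_min:
  assumes p: "- \<gamma> / 2 - q < 0" and k: "- \<gamma> / 2 - q + real k > 0" and b: "b > 0"
  shows "(\<integral>\<^sup>+s. ennreal (riesz \<gamma> s * (s powr (- q) * min 1 ((s / b) ^ k))) \<partial>lborel)
    \<le> ennreal (b powr (- \<gamma> / 2 - q) * (1 / (- \<gamma> / 2 - q + real k) + 1 / (\<gamma> / 2 + q)))"
proof -
  have le: "riesz \<gamma> s * (s powr (- q) * min 1 ((s / b) ^ k))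
      \<le> (1 / b ^ k) * (indicat_real {0..b} s * s powr (- \<gamma> / 2 - q + real k - 1)) + indicat_real {b..} s * s powr (- \<gamma> / 2 - q - 1)" for s
  proof (cases "s > 0")
    case True
    have e: "riesz \<gamma> s * s powr (- q) = s powr (- \<gamma> / 2 - q - 1)"
    proof -
      have "riesz \<gamma> s * s powr (- q) = s powr (- \<gamma> / 2 - 1 + - q)"
        unfolding powr_add using True by (simp add: riesz_def)
      also have "- \<gamma> / 2 - 1 + - q = - \<gamma> / 2 - q - 1" by simp
      finally show ?thesis .
    qed
    have e2: "s powr (- \<gamma> / 2 - q + real k - 1) = s powr (- \<gamma> / 2 - q - 1) * s ^ k"
      unfolding powr_realpow[OF True, symmetric] powr_add[symmetric] by (simp add: algebra_simps)
    show ?thesis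
    proof (cases "s \<le> b")
      case le: True
      have "s powr (- \<gamma> / 2 - q - 1) * min 1 ((s / b) ^ k) \<le> s powr (- \<gamma> / 2 - q - 1) * (s / b) ^ k"
        by (intro mult_left_mono) auto
      also have "\<dots> \<le> (1 / b ^ k) * (indicat_real {0..b} s * s powr (- \<gamma> / 2 - q + real k - 1)) + indicat_real {b..} s * s powr (- \<gamma> / 2 - q - 1)"
        unfolding e2 using True le by (simp add: power_divide)
      finally show ?thesis by (simp only: e flip: mult.assoc)
    next
      case False
      have "s powr (- \<gamma> / 2 - q - 1) * min 1 ((s / b) ^ k) \<le> s powr (- \<gamma> / 2 - q - 1) * 1"
        by (intro mult_left_mono) auto
      also have "\<dots> \<le> (1 / b ^ k) * (indicat_real {0..b} s * s powr (- \<gamma> / 2 - q + real k - 1)) + indicat_real {b..} s * s powr (- \<gamma> / 2 - q - 1)"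
        using False by simp
      finally show ?thesis by (simp only: e flip: mult.assoc)
    qed
  qed (use b in \<open>auto simp: riesz_def\<close>)
  have "- \<gamma> / 2 - q + real k - 1 > -1" "- \<gamma> / 2 - q - 1 < -1"
    and e: "- \<gamma> / 2 - q + real k - 1 + 1 = - \<gamma> / 2 - q + real k" "- \<gamma> / 2 - q - 1 + 1 = - \<gamma> / 2 - q"
    using p k by linarith+
  note i = nn_integral_powr_from_0[OF this(1) less_imp_le[OF b]] nn_integral_powr_to_inf[OF this(2) b]
  have i1: "(\<integral>\<^sup>+s. ennreal a * ennreal (indicat_real {0..b} s * s powr (- \<gamma> / 2 - q + real k - 1)) \<partial>lborel)
      = ennreal a * ennreal (b powr (- \<gamma> / 2 - q + real k) / (- \<gamma> / 2 - q + real k))" for a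
    unfolding i(1)[unfolded e, symmetric] by (rule nn_integral_cmult) measurable
  note i2 = i(2)[unfolded e]
  have "(\<integral>\<^sup>+s. ennreal (riesz \<gamma> s * (s powr (- q) * min 1 ((s / b) ^ k))) \<partial>lborel)
      \<le> (\<integral>\<^sup>+s. ennreal (1 / b ^ k) * ennreal (indicat_real {0..b} s * s powr (- \<gamma> / 2 - q + real k - 1))
          + ennreal (indicat_real {b..} s * s powr (- \<gamma> / 2 - q - 1)) \<partial>lborel)"
    by (intro nn_integral_mono)
      (use b le in \<open>simp add: ennreal_leI del: ennreal_plus flip: ennreal_mult' ennreal_plus\<close>)
  also have "\<dots> = ennreal (1 / b ^ k) * ennreal (b powr (- \<gamma> / 2 - q + real k) / (- \<gamma> / 2 - q + real k))
      + ennreal (- (b powr (- \<gamma> / 2 - q)) / (- \<gamma> / 2 - q))"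
    by (subst nn_integral_add, measurable) (simp only: i1 i2)
  also have "\<dots> = ennreal (b powr (- \<gamma> / 2 - q) * (1 / (- \<gamma> / 2 - q + real k) + 1 / (\<gamma> / 2 + q)))"
  proof -
    have "1 / b ^ k * (b powr (- \<gamma> / 2 - q + real k) / (- \<gamma> / 2 - q + real k)) = b powr (- \<gamma> / 2 - q) / (- \<gamma> / 2 - q + real k)"
      using b k by (simp add: powr_add powr_realpow)
    moreover have "- (b powr (- \<gamma> / 2 - q)) / (- \<gamma> / 2 - q) = b powr (- \<gamma> / 2 - q) / (\<gamma> / 2 + q)"
      using p by (simp add: field_simps)
    ultimately show ?thesis
      using b p k by (simp add: distrib_left divide_nonneg_nonneg flip: ennreal_mult' ennreal_plus)
  qed
  finally show ?thesis .
qed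

lemma one_minus_exp_le: "1 - exp (- s) \<le> min 1 (s :: real)"
  using exp_ge_add_one_self[of "- s"] by (simp add: min_def)

text \<open>The constant is the integral at r = 1, and the substitution s -> r^2 s handles every
  other r > 0. Since 1 - exp(-s) \<le> min 1 s, the integral converges at 0 because \<gamma> < 2 and
  at infinity because \<gamma> > 0.\<close>

lemma powr_subordination:
  assumes "0 < \<gamma>" "\<gamma> < 2"
  obtains c :: real where "c > 0"
    "\<And>r. r \<ge> 0 \<Longrightarrow> (\<integral>\<^sup>+s. ennreal (riesz \<gamma> s * (1 - exp (- s * r\<^sup>2))) \<partial>lborel) = ennreal (c * r powr \<gamma>)"
proof -
  define I where "I = (\<integral>\<^sup>+s. ennreal (riesz \<gamma> s * (1 - exp (- s))) \<partial>lborel)"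
  have "I \<le> (\<integral>\<^sup>+s. ennreal (riesz \<gamma> s * (s powr (- 0) * min 1 ((s / 1) ^ 1))) \<partial>lborel)"
    unfolding I_def
  proof (intro nn_integral_mono ennreal_leI)
    fix s :: real
    show "riesz \<gamma> s * (1 - exp (- s)) \<le> riesz \<gamma> s * (s powr (- 0) * min 1 ((s / 1) ^ 1))"
      using one_minus_exp_le[of s] by (cases "s > 0") (auto simp: riesz_def intro!: mult_left_mono)
  qed
  also have "\<dots> < \<infinity>"
    using nn_integral_riesz_min[of \<gamma> 0 1 1] assms by (auto intro: le_less_trans)
  finally have fin: "I < \<infinity>" .
  \<comment> \<open>Positivity of the constant: on the interval from 1 to 2 the integrand is at
    least the product of the extreme values of its two monotone factors.\<close>
  have "0 < ennreal (2 powr (- \<gamma> / 2 - 1) * (1 - exp (- 1)))"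
    by (simp add: ennreal_zero_less_mult_iff)
  also have "\<dots> = (\<integral>\<^sup>+s. ennreal (2 powr (- \<gamma> / 2 - 1) * (1 - exp (- 1))) * indicator {1..2::real} s \<partial>lborel)"
    by (subst nn_integral_cmult_indicator) auto
  also have "\<dots> \<le> I"
    unfolding I_def
  proof (rule nn_integral_mono)
    fix s :: real
    have "2 powr (- \<gamma> / 2 - 1) * (1 - exp (- 1)) \<le> riesz \<gamma> s * (1 - exp (- s))" if "s \<in> {1..2}"
      using that assms by (auto simp: riesz_def intro!: mult_mono powr_mono2')
    then show "ennreal (2 powr (- \<gamma> / 2 - 1) * (1 - exp (- 1))) * indicator {1..2} s \<le> ennreal (riesz \<gamma> s * (1 - exp (- s)))"
      by (auto simp: indicator_def ennreal_leI)
  qed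
  finally have pos: "I > 0" .
  show thesis
  proof (rule that[of "enn2real I"])
    show "enn2real I > 0" using fin pos by (simp add: enn2real_positive_iff)
    fix r :: real assume r: "r \<ge> 0"
    show "(\<integral>\<^sup>+s. ennreal (riesz \<gamma> s * (1 - exp (- s * r\<^sup>2))) \<partial>lborel) = ennreal (enn2real I * r powr \<gamma>)"
    \<comment> \<open>The substitution degenerates at r = 0, where both sides are 0 because
      \<open>0 powr \<gamma> = 0\<close>.\<close>
    proof (cases "r = 0")
      case False
      with r have r: "r > 0" by simp
      have r2: "r\<^sup>2 = r powr 2" using r by simp
      have "I = ennreal (r\<^sup>2) * (\<integral>\<^sup>+s. ennreal (riesz \<gamma> (r\<^sup>2 * s) * (1 - exp (- (r\<^sup>2 * s)))) \<partial>lborel)"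
        unfolding I_def using r by (subst nn_integral_real_affine[of _ "r\<^sup>2" 0]) auto
      also have "(\<lambda>s. ennreal (riesz \<gamma> (r\<^sup>2 * s) * (1 - exp (- (r\<^sup>2 * s)))))
          = (\<lambda>s. ennreal (r powr (- \<gamma> - 2)) * ennreal (riesz \<gamma> s * (1 - exp (- s * r\<^sup>2))))"
      proof
        fix s
        have "(r\<^sup>2) powr (- \<gamma> / 2 - 1) = r powr (- \<gamma> - 2)"
          unfolding r2 powr_powr by (simp add: algebra_simps)
        then have "riesz \<gamma> (r\<^sup>2 * s) = r powr (- \<gamma> - 2) * riesz \<gamma> s"
          using r by (cases "s > 0") (auto simp: riesz_def powr_mult zero_less_mult_iff indicator_def)
        then show "ennreal (riesz \<gamma> (r\<^sup>2 * s) * (1 - exp (- (r\<^sup>2 * s)))) = ennreal (r powr (- \<gamma> - 2)) * ennreal (riesz \<gamma> s * (1 - exp (- s * r\<^sup>2)))"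
          by (simp add: mult_ac flip: ennreal_mult')
      qed
      also have "(\<integral>\<^sup>+s. ennreal (r powr (- \<gamma> - 2)) * ennreal (riesz \<gamma> s * (1 - exp (- s * r\<^sup>2))) \<partial>lborel)
          = ennreal (r powr (- \<gamma> - 2)) * (\<integral>\<^sup>+s. ennreal (riesz \<gamma> s * (1 - exp (- s * r\<^sup>2))) \<partial>lborel)"
        by (rule nn_integral_cmult) measurable
      finally have "ennreal (r powr \<gamma>) * I = ennreal (r powr \<gamma> * (r\<^sup>2 * r powr (- \<gamma> - 2))) * (\<integral>\<^sup>+s. ennreal (riesz \<gamma> s * (1 - exp (- s * r\<^sup>2))) \<partial>lborel)"
        by (simp add: ennreal_mult' mult.assoc)
      also have "r powr \<gamma> * (r\<^sup>2 * r powr (- \<gamma> - 2)) = 1"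
        unfolding r2 powr_add[symmetric] using r by simp
      finally have "(\<integral>\<^sup>+s. ennreal (riesz \<gamma> s * (1 - exp (- s * r\<^sup>2))) \<partial>lborel) = ennreal (r powr \<gamma>) * ennreal (enn2real I)"
        using fin by simp
      then show ?thesis by (simp add: ennreal_mult' mult.commute)
    qed simp
  qed
qed

section \<open>Expectations of distance powers and of Gaussian kernels\<close>

definition gauss_mean :: "real \<Rightarrow> 'a::euclidean_space measure \<Rightarrow> 'a measure \<Rightarrow> real" where
  "gauss_mean s \<mu> \<nu> = (LINT p|(\<mu> \<Otimes>\<^sub>M \<nu>). exp (- s * (norm (fst p - snd p))\<^sup>2))"

lemma integrable_gauss_kernel:
  assumes "prob_space M" "h \<in> borel_measurable M" "s \<ge> 0"
  shows "integrable M (\<lambda>p. exp (- s * (norm (h p :: 'a :: euclidean_space))\<^sup>2))"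
proof -
  interpret prob_space M by fact
  note [measurable] = assms(2)
  show ?thesis
    by (rule integrable_const_bound[of _ 1]) (use assms in auto)
qed

text \<open>The integrands are nonnegative, so Tonelli moves the expectation inside the s-integral.
  Support in the unit ball bounds the distance by 2, and the resulting finiteness is what permits
  subtracting three such formulas from each other later.\<close>

lemma mean_powr_eq:
  fixes \<mu> \<nu> :: "'a::euclidean_space measure"
  assumes sub: "c > 0" "\<forall>r\<ge>0. (\<integral>\<^sup>+s. ennreal (riesz \<gamma> s * (1 - exp (- s * r\<^sup>2))) \<partial>lborel) = ennreal (c * r powr \<gamma>)"
    and "\<gamma> > 0" "prob_space \<mu>" "prob_space \<nu>" and sets[measurable_cong]: "sets \<mu> = sets borel" "sets \<nu> = sets borel"
    and "measure \<mu> (cball 0 1) = 1" "measure \<nu> (cball 0 1) = 1"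
  shows "integrable (\<mu> \<Otimes>\<^sub>M \<nu>) (\<lambda>p. norm (fst p - snd p) powr \<gamma>)"
    and "integrable lborel (\<lambda>s. riesz \<gamma> s * (1 - gauss_mean s \<mu> \<nu>))"
    and "(LINT p|(\<mu> \<Otimes>\<^sub>M \<nu>). norm (fst p - snd p) powr \<gamma>) = (LINT s|lborel. riesz \<gamma> s * (1 - gauss_mean s \<mu> \<nu>)) / c"
proof -
  interpret \<mu>: prob_space \<mu> by fact
  interpret \<nu>: prob_space \<nu> by fact
  interpret P: pair_prob_space \<mu> \<nu> ..
  interpret Q: pair_sigma_finite "\<mu> \<Otimes>\<^sub>M \<nu>" lborel ..
  let ?M = "\<mu> \<Otimes>\<^sub>M \<nu>"
  let ?k = "\<lambda>p::'a \<times> 'a. norm (fst p - snd p) powr \<gamma>"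
  have [measurable]: "cball (0 :: 'a) 1 \<in> sets borel" by simp
  have [measurable]: "?k \<in> borel_measurable ?M" by measurable
  have A: "AE x in \<mu>. x \<in> cball 0 1" "AE x in \<nu>. x \<in> cball 0 1"
    using \<mu>.prob_eq_1[of "cball 0 1"] \<nu>.prob_eq_1[of "cball 0 1"] assms by simp_all
  have "AE p in ?M. fst p \<in> cball 0 1 \<and> snd p \<in> cball 0 1"
  proof (rule P.AE_pair_measure)
    show "AE x in \<mu>. AE y in \<nu>. fst (x, y) \<in> cball 0 1 \<and> snd (x, y) \<in> cball 0 1"
      using A(1) by (rule AE_mp) (use A(2) in \<open>auto intro!: AE_I2\<close>)
  qed measurable
  then have "AE p in ?M. norm (?k p) \<le> 2 powr \<gamma>"
  proof (rule AE_mp, intro AE_I2 impI)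
    fix p :: "'a \<times> 'a" assume "fst p \<in> cball 0 1 \<and> snd p \<in> cball 0 1"
    then have "norm (fst p - snd p) \<le> 2"
      using norm_triangle_ineq4[of "fst p" "snd p"] by simp
    then show "norm (?k p) \<le> 2 powr \<gamma>" using \<open>\<gamma> > 0\<close> by (simp add: powr_mono2)
  qed
  then show int: "integrable ?M ?k"
    by (intro P.integrable_const_bound[of _ "2 powr \<gamma>"]) auto
  have gm: "(\<integral>\<^sup>+p. ennreal (riesz \<gamma> s * (1 - exp (- s * (norm (fst p - snd p))\<^sup>2))) \<partial>?M) = ennreal (riesz \<gamma> s * (1 - gauss_mean s \<mu> \<nu>))" for s
  proof (cases "s > 0")
    case True
    have ie: "integrable ?M (\<lambda>p. exp (- s * (norm (fst p - snd p))\<^sup>2))"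
      using True by (intro integrable_gauss_kernel P.prob_space_axioms) auto
    have "(\<integral>\<^sup>+p. ennreal (riesz \<gamma> s * (1 - exp (- s * (norm (fst p - snd p))\<^sup>2))) \<partial>?M)
       = ennreal (LINT p|?M. riesz \<gamma> s * (1 - exp (- s * (norm (fst p - snd p))\<^sup>2)))"
      using True ie by (intro nn_integral_eq_integral) (auto intro!: AE_I2 mult_nonneg_nonneg riesz_nonneg)
    also have "(LINT p|?M. riesz \<gamma> s * (1 - exp (- s * (norm (fst p - snd p))\<^sup>2))) = riesz \<gamma> s * (1 - gauss_mean s \<mu> \<nu>)"
      using ie by (simp add: gauss_mean_def Bochner_Integration.integral_diff P.prob_space)
    finally show ?thesis .
  qed (simp add: riesz_def)
  have gm_le: "0 \<le> riesz \<gamma> s * (1 - gauss_mean s \<mu> \<nu>)" for s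
  proof (cases "s > 0")
    case True
    have "gauss_mean s \<mu> \<nu> \<le> (LINT p|?M. 1)"
      unfolding gauss_mean_def using True
      by (intro integral_mono integrable_gauss_kernel P.prob_space_axioms) auto
    then show ?thesis by (simp add: P.prob_space riesz_nonneg)
  qed (simp add: riesz_def)
  have [measurable]: "(\<lambda>s. gauss_mean s \<mu> \<nu>) \<in> borel_measurable borel"
    unfolding gauss_mean_def by measurable
  have "(\<integral>\<^sup>+s. ennreal (riesz \<gamma> s * (1 - gauss_mean s \<mu> \<nu>)) \<partial>lborel)
      = (\<integral>\<^sup>+s. (\<integral>\<^sup>+p. ennreal (riesz \<gamma> s * (1 - exp (- s * (norm (fst p - snd p))\<^sup>2))) \<partial>?M) \<partial>lborel)"
    by (simp only: gm)
  also have "\<dots> = (\<integral>\<^sup>+p. (\<integral>\<^sup>+s. ennreal (riesz \<gamma> s * (1 - exp (- s * (norm (fst p - snd p))\<^sup>2))) \<partial>lborel) \<partial>?M)"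
    by (rule Q.Fubini') measurable
  also have "\<dots> = (\<integral>\<^sup>+p. ennreal (c * ?k p) \<partial>?M)"
    by (intro nn_integral_cong sub(2)[rule_format]) simp
  also have "\<dots> = ennreal (c * (LINT p|?M. ?k p))"
    using int sub(1) by (subst nn_integral_eq_integral) auto
  finally have eq: "(\<integral>\<^sup>+s. ennreal (riesz \<gamma> s * (1 - gauss_mean s \<mu> \<nu>)) \<partial>lborel) = ennreal (c * (LINT p|?M. ?k p))" .
  have nn: "0 \<le> c * (LINT p|?M. ?k p)" using sub(1) by simp
  show "integrable lborel (\<lambda>s. riesz \<gamma> s * (1 - gauss_mean s \<mu> \<nu>))"
    by (rule integrableI_nn_integral_finite[OF _ _ eq]) (use gm_le in auto)
  have "(LINT s|lborel. riesz \<gamma> s * (1 - gauss_mean s \<mu> \<nu>)) = c * (LINT p|?M. ?k p)"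
    using eq nn gm_le by (subst integral_eq_nn_integral) auto
  then show "(LINT p|?M. ?k p) = (LINT s|lborel. riesz \<gamma> s * (1 - gauss_mean s \<mu> \<nu>)) / c"
    using sub(1) by simp
qed

lemma (in prob_space) distr_pair_snd:
  assumes "sigma_finite_measure N"
  shows "distr (M \<Otimes>\<^sub>M N) N snd = N"
proof (intro measure_eqI)
  interpret N: sigma_finite_measure N by fact
  fix A assume A: "A \<in> sets (distr (M \<Otimes>\<^sub>M N) N snd)"
  then have "emeasure (distr (M \<Otimes>\<^sub>M N) N snd) A = emeasure (M \<Otimes>\<^sub>M N) (space M \<times> A)"
    by (auto simp: emeasure_distr space_pair_measure dest: sets.sets_into_space intro!: arg_cong2[where f = emeasure])
  with A show "emeasure (distr (M \<Otimes>\<^sub>M N) N snd) A = emeasure N A"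
    by (simp add: N.emeasure_pair_measure_Times emeasure_space_1)
qed simp

text \<open>Each of the pairs (x, y), (x, x') and (y, y') is a marginal of the fourfold product, so
  each term is pushed forward to the law of its own pair.\<close>

lemma integral_four_fold:
  fixes k :: "'a \<times> 'a \<Rightarrow> real"
  assumes "prob_space \<mu>" "prob_space \<nu>"
    and eq: "sets \<mu> = sets \<nu>"
    and i1: "integrable (\<mu> \<Otimes>\<^sub>M \<nu>) k" and i2: "integrable (\<mu> \<Otimes>\<^sub>M \<mu>) k" and i3: "integrable (\<nu> \<Otimes>\<^sub>M \<nu>) k"
  shows "(\<integral>(x, x', y, y'). 2 * k (x, y) - k (x, x') - k (y, y') \<partial>(\<mu> \<Otimes>\<^sub>M (\<mu> \<Otimes>\<^sub>M (\<nu> \<Otimes>\<^sub>M \<nu>))))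
    = 2 * (LINT p|(\<mu> \<Otimes>\<^sub>M \<nu>). k p) - (LINT p|(\<mu> \<Otimes>\<^sub>M \<mu>). k p) - (LINT p|(\<nu> \<Otimes>\<^sub>M \<nu>). k p)"
proof -
  interpret \<mu>: prob_space \<mu> by fact
  interpret \<nu>: prob_space \<nu> by fact
  interpret \<nu>\<nu>: pair_prob_space \<nu> \<nu> ..
  interpret T: pair_prob_space \<mu> "\<nu> \<Otimes>\<^sub>M \<nu>" ..
  let ?T = "\<mu> \<Otimes>\<^sub>M (\<nu> \<Otimes>\<^sub>M \<nu>)"
  let ?M = "\<mu> \<Otimes>\<^sub>M ?T"
  have dT: "distr ?T \<mu> fst = \<mu>" "distr ?T (\<nu> \<Otimes>\<^sub>M \<nu>) snd = \<nu> \<Otimes>\<^sub>M \<nu>"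
    by (rule \<nu>\<nu>.distr_pair_fst, rule \<mu>.distr_pair_snd, unfold_locales)
  have dy: "distr ?T \<nu> (\<lambda>w. fst (snd w)) = \<nu>"
  proof -
    have "distr ?T \<nu> (\<lambda>w. fst (snd w)) = distr (distr ?T (\<nu> \<Otimes>\<^sub>M \<nu>) snd) \<nu> fst"
      by (subst distr_distr) (auto simp: o_def)
    then show ?thesis by (simp add: dT \<nu>.distr_pair_fst)
  qed
  \<comment> \<open>Writing \<open>id x\<close> exhibits the projection as a product of two maps,
    the form that \<open>pair_measure_distr\<close> expects.\<close>
  have d1: "distr ?M (\<mu> \<Otimes>\<^sub>M \<mu>) (\<lambda>(x, w). (id x, fst w)) = \<mu> \<Otimes>\<^sub>M \<mu>"
    by (subst pair_measure_distr[symmetric]) (auto simp: dT distr_id id_def \<mu>.sigma_finite_measure_axioms)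
  have d2: "distr ?M (\<mu> \<Otimes>\<^sub>M \<nu>) (\<lambda>(x, w). (id x, fst (snd w))) = \<mu> \<Otimes>\<^sub>M \<nu>"
    by (subst pair_measure_distr[symmetric]) (auto simp: dy distr_id id_def \<nu>.sigma_finite_measure_axioms)
  have d3: "distr ?M (\<nu> \<Otimes>\<^sub>M \<nu>) (\<lambda>w. snd (snd w)) = \<nu> \<Otimes>\<^sub>M \<nu>"
  proof -
    have "distr ?M (\<nu> \<Otimes>\<^sub>M \<nu>) (\<lambda>w. snd (snd w)) = distr (distr ?M ?T snd) (\<nu> \<Otimes>\<^sub>M \<nu>) snd"
      by (subst distr_distr) (auto simp: o_def)
    also have "distr ?M ?T snd = ?T" by (rule \<mu>.distr_pair_snd) unfold_locales
    finally show ?thesis by (simp add: dT)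
  qed
  have m: "k \<in> borel_measurable (\<mu> \<Otimes>\<^sub>M \<mu>)" "k \<in> borel_measurable (\<mu> \<Otimes>\<^sub>M \<nu>)" "k \<in> borel_measurable (\<nu> \<Otimes>\<^sub>M \<nu>)"
    using i1 i2 i3 by auto
  have 1: "integrable ?M (\<lambda>w. k (fst w, fst (snd w)))" "(LINT w|?M. k (fst w, fst (snd w))) = (LINT p|(\<mu> \<Otimes>\<^sub>M \<mu>). k p)"
    using i2 integrable_distr_eq[of "\<lambda>(x, w). (id x, fst w)" ?M "\<mu> \<Otimes>\<^sub>M \<mu>" k] integral_distr[of "\<lambda>(x, w). (id x, fst w)" ?M "\<mu> \<Otimes>\<^sub>M \<mu>" k] m
    unfolding d1 by (simp_all add: case_prod_beta')
  have 2: "integrable ?M (\<lambda>w. k (fst w, fst (snd (snd w))))" "(LINT w|?M. k (fst w, fst (snd (snd w)))) = (LINT p|(\<mu> \<Otimes>\<^sub>M \<nu>). k p)"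
    using i1 integrable_distr_eq[of "\<lambda>(x, w). (id x, fst (snd w))" ?M "\<mu> \<Otimes>\<^sub>M \<nu>" k] integral_distr[of "\<lambda>(x, w). (id x, fst (snd w))" ?M "\<mu> \<Otimes>\<^sub>M \<nu>" k] m
    unfolding d2 by (simp_all add: case_prod_beta')
  have 3: "integrable ?M (\<lambda>w. k (snd (snd w)))" "(LINT w|?M. k (snd (snd w))) = (LINT p|(\<nu> \<Otimes>\<^sub>M \<nu>). k p)"
    using i3 integrable_distr_eq[of "\<lambda>w. snd (snd w)" ?M "\<nu> \<Otimes>\<^sub>M \<nu>" k] integral_distr[of "\<lambda>w. snd (snd w)" ?M "\<nu> \<Otimes>\<^sub>M \<nu>" k] m
    unfolding d3 by simp_all
  have "(\<integral>(x, x', y, y'). 2 * k (x, y) - k (x, x') - k (y, y') \<partial>?M)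
    = (LINT w|?M. 2 * k (fst w, fst (snd (snd w))) - k (fst w, fst (snd w)) - k (snd (snd w)))"
    by (intro Bochner_Integration.integral_cong) (auto simp: case_prod_beta')
  also have "\<dots> = 2 * (LINT p|(\<mu> \<Otimes>\<^sub>M \<nu>). k p) - (LINT p|(\<mu> \<Otimes>\<^sub>M \<mu>). k p) - (LINT p|(\<nu> \<Otimes>\<^sub>M \<nu>). k p)"
    using 1 2 3 by simp
  finally show ?thesis .
qed

text \<open>Reduces the energy distance to a bound \<open>b s\<close> on the Gaussian discrepancy at
  each scale s. The constant \<open>c\<close> is fixed before the measures, which is what later
  makes the final constant independent of \<epsilon>.\<close>

lemma energy_dist_bound:
  assumes "0 < \<gamma>" "\<gamma> < 2"
  obtains c :: real where "c > 0"
    "\<And>(\<mu> :: (real ^ 'd) measure) \<nu> b D. prob_space \<mu> \<Longrightarrow> prob_space \<nu> \<Longrightarrow> sets \<mu> = sets borel \<Longrightarrow> sets \<nu> = sets borel \<Longrightarrow>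
      measure \<mu> (cball 0 1) = 1 \<Longrightarrow> measure \<nu> (cball 0 1) = 1 \<Longrightarrow> D \<ge> 0 \<Longrightarrow>
      (\<And>s. s > 0 \<Longrightarrow> gauss_mean s \<mu> \<mu> + gauss_mean s \<nu> \<nu> - 2 * gauss_mean s \<mu> \<nu> \<le> b s) \<Longrightarrow>
      (\<integral>\<^sup>+s. ennreal (riesz \<gamma> s * b s) \<partial>lborel) \<le> ennreal D \<Longrightarrow>
      energy_dist \<gamma> \<mu> \<nu> \<le> sqrt (c * D)"
proof -
  obtain c :: real where c: "c > 0"
    "\<forall>r\<ge>0. (\<integral>\<^sup>+s. ennreal (riesz \<gamma> s * (1 - exp (- s * r\<^sup>2))) \<partial>lborel) = ennreal (c * r powr \<gamma>)"
    using powr_subordination[OF assms] by metis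
  show thesis
  proof (rule that[of "1 / c"])
    show "1 / c > 0" using c(1) by simp
    fix \<mu> \<nu> :: "(real ^ 'd) measure" and b :: "real \<Rightarrow> real" and D :: real
    assume P: "prob_space \<mu>" "prob_space \<nu>" "sets \<mu> = sets borel" "sets \<nu> = sets borel"
      "measure \<mu> (cball 0 1) = 1" "measure \<nu> (cball 0 1) = 1" and D: "D \<ge> 0"
      and b: "\<And>s. s > 0 \<Longrightarrow> gauss_mean s \<mu> \<mu> + gauss_mean s \<nu> \<nu> - 2 * gauss_mean s \<mu> \<nu> \<le> b s"
      and bD: "(\<integral>\<^sup>+s. ennreal (riesz \<gamma> s * b s) \<partial>lborel) \<le> ennreal D"
    note M = mean_powr_eq[OF c assms(1)]
    note M1 = M[OF P(1,2,3,4,5,6)] and M2 = M[OF P(1,1,3,3,5,5)] and M3 = M[OF P(2,2,4,4,6,6)]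
    let ?k = "\<lambda>p::(real^'d) \<times> (real^'d). norm (fst p - snd p) powr \<gamma>"
    let ?g = "\<lambda>\<mu> \<nu> s. riesz \<gamma> s * (1 - gauss_mean s \<mu> (\<nu> :: (real ^ 'd) measure))"
    let ?h = "\<lambda>s. 2 * ?g \<mu> \<nu> s - ?g \<mu> \<mu> s - ?g \<nu> \<nu> s"
    have "(\<integral>(x, x', y, y'). 2 * norm (x - y) powr \<gamma> - norm (x - x') powr \<gamma> - norm (y - y') powr \<gamma>
             \<partial>(\<mu> \<Otimes>\<^sub>M (\<mu> \<Otimes>\<^sub>M (\<nu> \<Otimes>\<^sub>M \<nu>))))
       = 2 * (LINT p|(\<mu> \<Otimes>\<^sub>M \<nu>). ?k p) - (LINT p|(\<mu> \<Otimes>\<^sub>M \<mu>). ?k p) - (LINT p|(\<nu> \<Otimes>\<^sub>M \<nu>). ?k p)"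
      using integral_four_fold[OF P(1,2) _ M1(1) M2(1) M3(1)] P(3,4) by simp
    also have "\<dots> = (LINT s|lborel. ?h s) / c"
      unfolding M1(3) M2(3) M3(3) using M1(2) M2(2) M3(2) by (simp add: diff_divide_distrib)
    also have "\<dots> \<le> D / c"
    proof (rule divide_right_mono)
      have "(\<integral>\<^sup>+s. ennreal (?h s) \<partial>lborel) \<le> (\<integral>\<^sup>+s. ennreal (riesz \<gamma> s * b s) \<partial>lborel)"
      proof (intro nn_integral_mono ennreal_leI)
        fix s
        \<comment> \<open>The constants in 1 - \<open>gauss_mean\<close> cancel, as 2 - 1 - 1 = 0;
          only the signs of the Gaussian means are reversed.\<close>
        have "?h s = riesz \<gamma> s * (gauss_mean s \<mu> \<mu> + gauss_mean s \<nu> \<nu> - 2 * gauss_mean s \<mu> \<nu>)"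
          by (simp add: algebra_simps)
        also have "\<dots> \<le> riesz \<gamma> s * b s"
          using b[of s] by (cases "s > 0") (auto intro: mult_left_mono riesz_nonneg simp: riesz_def)
        finally show "?h s \<le> riesz \<gamma> s * b s" .
      qed
      also note bD
      finally show "(LINT s|lborel. ?h s) \<le> D" by (rule integral_real_bounded[OF D])
    qed (use c in simp)
    finally show "energy_dist \<gamma> \<mu> \<nu> \<le> sqrt (1 / c * D)"
      unfolding energy_dist_def by (intro real_sqrt_le_mono) simp
  qed
qed

lemma gauss_mean_density:
  fixes p q :: "'a::euclidean_space \<Rightarrow> real"
  assumes p: "integrable lborel p" "\<And>x. 0 \<le> p x" and q: "integrable lborel q" "\<And>x. 0 \<le> q x"
    and P: "prob_space (density lborel p)" "prob_space (density lborel q)" and s: "s \<ge> 0"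
  shows "gauss_mean s (density lborel p) (density lborel q) = gauss_form s p q"
proof -
  have [measurable]: "p \<in> borel_measurable borel" "q \<in> borel_measurable borel" using p q by auto
  interpret A: prob_space "density lborel p" by fact
  interpret B: prob_space "density lborel q" by fact
  interpret R: pair_prob_space "density lborel p" "density lborel q" ..
  have "integrable (density lborel p \<Otimes>\<^sub>M density lborel q) (\<lambda>w. exp (- s * (norm (fst w - snd w))\<^sup>2))"
    using s by (intro integrable_gauss_kernel R.prob_space_axioms) auto
  from R.integral_fst'[OF this]
  have "gauss_mean s (density lborel p) (density lborel q)
    = (LINT x|density lborel p. (LINT y|density lborel q. exp (- s * (norm (x - y))\<^sup>2)))"
    by (simp add: gauss_mean_def)
  also have "\<dots> = gauss_form s p q"
    unfolding gauss_form_def using p q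
    by (simp add: integral_density mult.commute[of "q _"])
  finally show ?thesis .
qed

lemma gauss_mean_commute:
  fixes \<mu> \<nu> :: "'a::euclidean_space measure"
  assumes "prob_space \<mu>" "prob_space \<nu>" and sets [measurable_cong]: "sets \<mu> = sets borel" "sets \<nu> = sets borel"
  shows "gauss_mean s \<mu> \<nu> = gauss_mean s \<nu> \<mu>"
proof -
  interpret A: prob_space \<mu> by fact
  interpret B: prob_space \<nu> by fact
  interpret R: pair_prob_space \<mu> \<nu> ..
  have "(\<lambda>p::'a \<times> 'a. exp (- s * (norm (fst p - snd p))\<^sup>2)) \<in> borel_measurable (\<mu> \<Otimes>\<^sub>M \<nu>)" by measurable
  from R.integral_product_swap[OF this] show ?thesis
    by (simp add: gauss_mean_def case_prod_beta' norm_minus_commute)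
qed

text \<open>Bilinear expansion of the form; the kernel is symmetric, so the two mixed terms coincide
  and give the factor 2. The right-hand side is the squared maximum mean discrepancy of the Gaussian
  kernel and sees only the difference of the densities.\<close>

lemma gauss_mean_diff:
  fixes p q :: "'a::euclidean_space \<Rightarrow> real"
  assumes p: "integrable lborel p" "\<And>x. 0 \<le> p x" and q: "integrable lborel q" "\<And>x. 0 \<le> q x"
    and P: "prob_space (density lborel p)" "prob_space (density lborel q)" and s: "s \<ge> 0"
  shows "gauss_mean s (density lborel p) (density lborel p) + gauss_mean s (density lborel q) (density lborel q)
      - 2 * gauss_mean s (density lborel p) (density lborel q) = gauss_form s (\<lambda>x. p x - q x) (\<lambda>x. p x - q x)"
proof -
  have "gauss_mean s (density lborel p) (density lborel p) + gauss_mean s (density lborel q) (density lborel q)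
      - 2 * gauss_mean s (density lborel p) (density lborel q)
    = gauss_form s p p + gauss_form s q q - gauss_form s p q - gauss_form s q p"
    using gauss_mean_commute[OF P, of s] gauss_mean_density[OF p p P(1) P(1) s] gauss_mean_density[OF p q P s]
      gauss_mean_density[OF q q P(2) P(2) s] gauss_mean_density[OF q p P(2) P(1) s]
    by simp
  also have "\<dots> = gauss_form s (\<lambda>x. p x - q x) (\<lambda>x. p x - q x)"
  proof -
    note I = integrable_mult_gauss[OF p(1) p(1) s] integrable_mult_gauss[OF p(1) q(1) s]
      integrable_mult_gauss[OF q(1) p(1) s] integrable_mult_gauss[OF q(1) q(1) s]
    have L: "(LINT y|lborel. exp (- s * (norm (x - y))\<^sup>2) * (p y - q y))
      = (LINT y|lborel. exp (- s * (norm (x - y))\<^sup>2) * p y) - (LINT y|lborel. exp (- s * (norm (x - y))\<^sup>2) * q y)" for x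
      unfolding right_diff_distrib
      by (rule Bochner_Integration.integral_diff[OF integrable_gauss_mult(1)[OF p(1) s] integrable_gauss_mult(1)[OF q(1) s]])
    have "(p x - q x) * (LINT y|lborel. exp (- s * (norm (x - y))\<^sup>2) * (p y - q y))
      = p x * (LINT y|lborel. exp (- s * (norm (x - y))\<^sup>2) * p y) - p x * (LINT y|lborel. exp (- s * (norm (x - y))\<^sup>2) * q y)
       - q x * (LINT y|lborel. exp (- s * (norm (x - y))\<^sup>2) * p y) + q x * (LINT y|lborel. exp (- s * (norm (x - y))\<^sup>2) * q y)" for x
      unfolding L by (simp only: algebra_simps)
    then show ?thesis
      unfolding gauss_form_def
      by (simp only: Bochner_Integration.integral_add Bochner_Integration.integral_diff
          Bochner_Integration.integrable_diff I)
  qed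
  finally show ?thesis .
qed

subsection \<open>Perturbed densities\<close>

lemma prod_if_single:
  fixes a c :: "'a::comm_monoid_mult"
  shows "(\<Prod>i\<in>(UNIV :: 'd::finite set). if i = j then a else c) = a * c ^ (CARD('d) - 1)"
proof -
  have "(\<Prod>i\<in>(UNIV :: 'd set). if i = j then a else c) = a * (\<Prod>i\<in>UNIV - {j}. if i = j then a else c)"
    by (subst prod.remove[of _ j]) auto
  also have "(\<Prod>i\<in>UNIV - {j}. if i = j then a else c) = (\<Prod>i\<in>UNIV - {j}. c)"
    by (intro prod.cong) auto
  finally show ?thesis by simp
qed

text \<open>A single term of the exponential series is at most its sum.\<close>

lemma power_le_fact_exp:
  fixes x :: real
  assumes "x \<ge> 0"
  shows "x ^ k \<le> fact k * exp x"
proof -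
  have "(\<Sum>n\<in>{k}. x ^ n /\<^sub>R fact n) \<le> (\<Sum>n. x ^ n /\<^sub>R fact n)"
    by (intro sum_le_suminf summable_exp_generic) (use assms in auto)
  also have "\<dots> = exp x" by (rule sums_unique[OF exp_converges, symmetric])
  finally show ?thesis by (simp add: field_simps)
qed

text \<open>This profile serves the coordinates that do not oscillate and also majorises the one
  that does; for the latter it has the positive lower bound \<open>b0\<close> on the inner half of
  its support.\<close>

lemma bump_profile:
  fixes r \<beta> :: real
  assumes r: "r > 0" and "\<beta> > 0"
  obtains b0 S :: real and B :: "real \<Rightarrow> real" and b1 :: real
  where "b0 > 0" "S \<ge> 0" "B \<in> borel_measurable borel" "\<And>x. 0 \<le> B x" "\<And>x. B x \<le> b1"
    "\<And>x. x \<notin> {-r..r} \<Longrightarrow> B x = 0" "\<And>x. \<bar>x\<bar> \<le> r / 2 \<Longrightarrow> b0 \<le> B x"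
    "integrable lborel B" "(LINT x|lborel. B x) = 1"
    "(\<integral>\<^sup>+t. ennreal ((1 + \<bar>t\<bar>) powr (2 * \<beta>) * (cmod (ft (\<lambda>x. complex_of_real (B x)) t))\<^sup>2) \<partial>lborel) \<le> ennreal S"
proof -
  \<comment> \<open>As N - 1 \<ge> \<beta>, the squared decay (1 + |t|)^(-2 N) times the Sobolev
    weight is still at most (1 + |t|)^(-2).\<close>
  define N where "N = nat \<lceil>\<beta>\<rceil> + 1"
  define \<kappa> where "\<kappa> = 1 / (LINT x|lborel. bump r N x)"
  have \<kappa>: "\<kappa> > 0" unfolding \<kappa>_def using bump_integral_pos[OF r] by simp
  define B where "B x = \<kappa> * bump r N x" for x
  define P where "P = [:(complex_of_real r)\<^sup>2, 0, -1:] ^ N"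
  obtain D where D: "D > 0" "\<And>t. (1 + \<bar>t\<bar>) ^ N * cmod (ft (cutoff r P) t) \<le> D"
    using ft_cutoff_decay[OF _ bump_dvd[of r N]] r unfolding P_def by (metis less_imp_le)
  have ftB: "ft (\<lambda>x. complex_of_real (B x)) t = \<kappa> * ft (cutoff r P) t" for t
    by (simp add: B_def ft_def P_def bump_eq_cutoff mult.left_commute flip: integral_mult_right_zero)
  obtain b1 where b1: "\<And>x. bump r N x \<le> b1" using bump_upper by blast
  define J where "J = enn2real (\<integral>\<^sup>+t. ennreal (1 / (1 + t\<^sup>2)) \<partial>lborel)"
  have J: "(\<integral>\<^sup>+t. ennreal (1 / (1 + t\<^sup>2)) \<partial>lborel) = ennreal J"
    unfolding J_def using nn_integral_inverse_1_plus_square by simp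
  have J0: "J \<ge> 0" by (simp add: J_def)
  have le: "(1 + \<bar>t\<bar>) powr (2 * \<beta>) * (cmod (ft (\<lambda>x. complex_of_real (B x)) t))\<^sup>2 \<le> (\<kappa> * D)\<^sup>2 * (1 / (1 + t\<^sup>2))" for t
  proof -
    let ?v = "1 + \<bar>t\<bar>"
    have "cmod (ft (\<lambda>x. complex_of_real (B x)) t) \<le> \<kappa> * D / ?v ^ N"
      using D(2)[of t] \<kappa> by (simp add: ftB norm_mult field_simps)
    then have c: "(cmod (ft (\<lambda>x. complex_of_real (B x)) t))\<^sup>2 \<le> (\<kappa> * D / ?v ^ N)\<^sup>2"
      by (rule power_mono) simp
    have "?v powr (2 * \<beta>) \<le> ?v powr (2 * real (N - 1))"
      by (rule powr_mono) (use real_nat_ceiling_ge[of \<beta>] in \<open>auto simp: N_def\<close>)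
    then have "?v powr (2 * \<beta>) * (cmod (ft (\<lambda>x. complex_of_real (B x)) t))\<^sup>2 \<le> ?v powr (2 * real (N - 1)) * (\<kappa> * D / ?v ^ N)\<^sup>2"
      using c by (intro mult_mono) auto
    also have "?v powr (2 * real (N - 1)) = (?v ^ (N - 1))\<^sup>2"
      using powr_realpow[of ?v "2 * (N - 1)"] by (simp add: power_mult[symmetric] mult.commute)
    also have "(?v ^ (N - 1))\<^sup>2 * (\<kappa> * D / ?v ^ N)\<^sup>2 = (\<kappa> * D)\<^sup>2 * (1 / ?v\<^sup>2)"
      by (simp add: N_def power_divide power_mult_distrib)
    also have "1 / ?v\<^sup>2 \<le> 1 / (1 + t\<^sup>2)"
    proof (rule divide_left_mono)
      have "?v\<^sup>2 = 1 + t\<^sup>2 + 2 * \<bar>t\<bar>" unfolding power2_sum by simp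
      then show "1 + t\<^sup>2 \<le> ?v\<^sup>2" by simp
      show "0 < ?v\<^sup>2 * (1 + t\<^sup>2)" by (intro mult_pos_pos add_pos_nonneg zero_less_power) auto
    qed simp
    finally show ?thesis by (simp add: mult_left_mono)
  qed
  show thesis
  proof (rule that[of "\<kappa> * (3 * r\<^sup>2 / 4) ^ N" "(\<kappa> * D)\<^sup>2 * J" B "\<kappa> * b1"])
    show "\<kappa> * (3 * r\<^sup>2 / 4) ^ N > 0" "(\<kappa> * D)\<^sup>2 * J \<ge> 0" using \<kappa> r J0 by auto
    show "B \<in> borel_measurable borel" unfolding B_def[abs_def] by measurable
    show "0 \<le> B x" "B x \<le> \<kappa> * b1" "x \<notin> {-r..r} \<Longrightarrow> B x = 0" for x
      using \<kappa> b1 bump_nonneg[of r N x] by (auto simp: B_def bump_def)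
    show "\<bar>x\<bar> \<le> r / 2 \<Longrightarrow> \<kappa> * (3 * r\<^sup>2 / 4) ^ N \<le> B x" for x
      using bump_lower[of x r N] \<kappa> by (auto simp: B_def intro!: mult_left_mono)
    show "integrable lborel B" unfolding B_def[abs_def] by (intro integrable_mult_right bump_integrable)
    show "(LINT x|lborel. B x) = 1" using \<kappa> by (simp add: B_def[abs_def] \<kappa>_def)
    have "(\<integral>\<^sup>+t. ennreal ((1 + \<bar>t\<bar>) powr (2 * \<beta>) * (cmod (ft (\<lambda>x. complex_of_real (B x)) t))\<^sup>2) \<partial>lborel)
      \<le> (\<integral>\<^sup>+t. ennreal ((\<kappa> * D)\<^sup>2) * ennreal (1 / (1 + t\<^sup>2)) \<partial>lborel)"
      by (intro nn_integral_mono) (use le in \<open>simp add: ennreal_leI flip: ennreal_mult'\<close>)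
    also have "\<dots> = ennreal ((\<kappa> * D)\<^sup>2 * J)"
      by (subst nn_integral_cmult) (simp_all add: J ennreal_mult')
    finally show "(\<integral>\<^sup>+t. ennreal ((1 + \<bar>t\<bar>) powr (2 * \<beta>) * (cmod (ft (\<lambda>x. complex_of_real (B x)) t))\<^sup>2) \<partial>lborel) \<le> ennreal ((\<kappa> * D)\<^sup>2 * J)" .
  qed
qed

text \<open>Since 1 + |t| \<le> (1 + |h t|) / h, the Sobolev weight costs h^(-2 \<beta>). The
  exponent \<open>m\<close> leaves room for the squared factor (h t)^(2 K) and for the power 2
  \<beta> of 1 + |h t|, rounded up.\<close>

lemma packet_sobolev_pointwise:
  fixes h t \<beta> :: real
  assumes h: "0 < h" "h \<le> 1" and "\<beta> > 0" and z: "0 \<le> z" "z \<le> \<bar>h * t\<bar> ^ K * y"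
    and m: "m = 2 * K + nat \<lceil>2 * \<beta>\<rceil>"
  shows "(1 + \<bar>t\<bar>) powr (2 * \<beta>) * z\<^sup>2 \<le> h powr (- 2 * \<beta>) * ((1 + \<bar>h * t\<bar>) ^ m * y\<^sup>2)"
proof -
  let ?v = "1 + \<bar>h * t\<bar>"
  have "1 + \<bar>t\<bar> \<le> ?v / h" using h by (simp add: field_simps abs_mult)
  then have "(1 + \<bar>t\<bar>) powr (2 * \<beta>) \<le> (?v / h) powr (2 * \<beta>)"
    using assms by (intro powr_mono2) auto
  also have "\<dots> = h powr (- 2 * \<beta>) * ?v powr (2 * \<beta>)"
    using h by (simp add: powr_divide powr_minus field_simps)
  also have "\<dots> \<le> h powr (- 2 * \<beta>) * ?v powr (real (nat \<lceil>2 * \<beta>\<rceil>))"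
    by (intro mult_left_mono powr_mono) (use real_nat_ceiling_ge[of "2 * \<beta>"] in auto)
  also have "?v powr (real (nat \<lceil>2 * \<beta>\<rceil>)) = ?v ^ nat \<lceil>2 * \<beta>\<rceil>"
    by (intro powr_realpow) (simp add: add_pos_nonneg)
  finally have 1: "(1 + \<bar>t\<bar>) powr (2 * \<beta>) \<le> h powr (- 2 * \<beta>) * ?v ^ nat \<lceil>2 * \<beta>\<rceil>" .
  have "z\<^sup>2 \<le> (\<bar>h * t\<bar> ^ K * y)\<^sup>2" using z by (intro power_mono)
  also have "\<dots> = \<bar>h * t\<bar> ^ (2 * K) * y\<^sup>2" by (simp only: power_mult_distrib power_mult[symmetric] mult.commute[of K])
  also have "\<dots> \<le> ?v ^ (2 * K) * y\<^sup>2" by (intro mult_right_mono power_mono) auto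
  finally have 2: "z\<^sup>2 \<le> ?v ^ (2 * K) * y\<^sup>2" .
  have "(1 + \<bar>t\<bar>) powr (2 * \<beta>) * z\<^sup>2 \<le> (h powr (- 2 * \<beta>) * ?v ^ nat \<lceil>2 * \<beta>\<rceil>) * (?v ^ (2 * K) * y\<^sup>2)"
    using 1 2 by (intro mult_mono) auto
  then show ?thesis by (simp only: m power_add mult_ac)
qed

text \<open>Two bounds under one minimum. The exponential is at most 1; and with u = t^2 / (4 s) one
  has (h t)^(2 K) exp(-u) = (4 h^2 s)^K u^K exp(-u), where u^K exp(-u) \<le> K!. The constant 4^K K!
  is at least 1 and so covers both.\<close>

lemma packet_energy_pointwise:
  fixes h t s :: real
  assumes s: "s > 0" and z: "0 \<le> z" "z \<le> \<bar>h * t\<bar> ^ K * y" and m: "2 * K \<le> m"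
  shows "z\<^sup>2 * exp (- t\<^sup>2 / (4 * s)) \<le> (4 ^ K * fact K * min 1 ((h\<^sup>2 * s) ^ K)) * ((1 + \<bar>h * t\<bar>) ^ m * y\<^sup>2)"
proof -
  let ?v = "1 + \<bar>h * t\<bar>"
  let ?E = "exp (- t\<^sup>2 / (4 * s))"
  have v: "1 \<le> ?v ^ m" by (rule one_le_power) simp
  have z2: "z\<^sup>2 \<le> \<bar>h * t\<bar> ^ (2 * K) * y\<^sup>2"
  proof -
    have "z\<^sup>2 \<le> (\<bar>h * t\<bar> ^ K * y)\<^sup>2" using z by (intro power_mono)
    also have "\<dots> = \<bar>h * t\<bar> ^ (2 * K) * y\<^sup>2" by (simp only: power_mult_distrib power_mult[symmetric] mult.commute[of K])
    finally show ?thesis .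
  qed
  have c1: "1 \<le> 4 ^ K * (fact K :: real)"
    using mult_mono[of 1 "4 ^ K" 1 "fact K :: real"] by (simp add: fact_ge_1)
  have a: "z\<^sup>2 * ?E \<le> 4 ^ K * fact K * (?v ^ m * y\<^sup>2)"
  proof -
    have "z\<^sup>2 * ?E \<le> z\<^sup>2 * 1" using s by (intro mult_left_mono) auto
    also have "\<dots> \<le> \<bar>h * t\<bar> ^ (2 * K) * y\<^sup>2" using z2 by simp
    also have "\<dots> \<le> ?v ^ (2 * K) * y\<^sup>2" by (intro mult_right_mono power_mono) auto
    also have "\<dots> \<le> ?v ^ m * y\<^sup>2" by (intro mult_right_mono power_increasing m) auto
    also have "\<dots> \<le> 4 ^ K * fact K * (?v ^ m * y\<^sup>2)"
      using mult_right_mono[OF c1, of "?v ^ m * y\<^sup>2"] by simp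
    finally show ?thesis .
  qed
  have b: "z\<^sup>2 * ?E \<le> 4 ^ K * fact K * (h\<^sup>2 * s) ^ K * (?v ^ m * y\<^sup>2)"
  proof -
    have "z\<^sup>2 * ?E \<le> \<bar>h * t\<bar> ^ (2 * K) * y\<^sup>2 * ?E" using z2 by (intro mult_right_mono) auto
    also have "\<bar>h * t\<bar> ^ (2 * K) = (h\<^sup>2) ^ K * (4 * s) ^ K * (t\<^sup>2 / (4 * s)) ^ K"
    proof -
      have "(h * t)\<^sup>2 = h\<^sup>2 * (4 * s) * (t\<^sup>2 / (4 * s))" using s by (simp add: power_mult_distrib)
      moreover have "\<bar>h * t\<bar> ^ (2 * K) = ((h * t)\<^sup>2) ^ K" by (simp only: power_mult power2_abs)
      ultimately show ?thesis by (simp only: power_mult_distrib)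
    qed
    also have "\<dots> * y\<^sup>2 * ?E = ((h\<^sup>2) ^ K * (4 * s) ^ K * y\<^sup>2) * ((t\<^sup>2 / (4 * s)) ^ K * ?E)"
      by (simp only: mult_ac)
    also have "\<dots> \<le> ((h\<^sup>2) ^ K * (4 * s) ^ K * y\<^sup>2) * fact K"
    proof (intro mult_left_mono)
      have "(t\<^sup>2 / (4 * s)) ^ K * ?E \<le> (fact K * exp (t\<^sup>2 / (4 * s))) * ?E"
        using s by (intro mult_right_mono power_le_fact_exp) auto
      also have "\<dots> = fact K" by (simp add: mult.assoc flip: exp_add)
      finally show "(t\<^sup>2 / (4 * s)) ^ K * ?E \<le> fact K" .
    qed (use s in auto)
    also have "\<dots> = 4 ^ K * fact K * (h\<^sup>2 * s) ^ K * (1 * y\<^sup>2)"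
      by (simp add: power_mult_distrib mult_ac)
    also have "\<dots> \<le> 4 ^ K * fact K * (h\<^sup>2 * s) ^ K * (?v ^ m * y\<^sup>2)"
      using s v by (intro mult_left_mono mult_right_mono) auto
    finally show ?thesis .
  qed
  show ?thesis
    using a b by (cases "(h\<^sup>2 * s) ^ K \<le> 1") (simp_all add: min_def)
qed

lemma nn_integral_le_cmult:
  assumes [measurable]: "G \<in> borel_measurable M" and le: "\<And>x. f x \<le> c * G x" and "c \<ge> 0"
    and G: "(\<integral>\<^sup>+x. ennreal (G x) \<partial>M) \<le> ennreal C" and "C \<ge> 0"
  shows "(\<integral>\<^sup>+x. ennreal (f x) \<partial>M) \<le> ennreal (c * C)"
proof -
  have "(\<integral>\<^sup>+x. ennreal (f x) \<partial>M) \<le> (\<integral>\<^sup>+x. ennreal c * ennreal (G x) \<partial>M)"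
    by (intro nn_integral_mono) (use le \<open>c \<ge> 0\<close> in \<open>simp add: ennreal_leI flip: ennreal_mult'\<close>)
  also have "\<dots> = ennreal c * (\<integral>\<^sup>+x. ennreal (G x) \<partial>M)"
    by (rule nn_integral_cmult) measurable
  also have "\<dots> \<le> ennreal c * ennreal C" by (intro mult_left_mono G) simp
  finally show ?thesis using \<open>c \<ge> 0\<close> by (simp add: ennreal_mult')
qed

text \<open>All constants are independent of h. Domination by \<open>b\<close> will give
  nonnegativity and the upper bound on total variation, mean zero preserves the mass, and the test
  function \<open>w\<close> bounds total variation from below.\<close>

lemma oscillating_perturbation:
  fixes \<beta> :: real and K :: nat
  assumes "\<beta> > 0" and K: "K \<ge> 1"
  obtains M c h0 S :: real and b :: "real ^ 'd::finite \<Rightarrow> real" and b1 :: real and f :: "real \<Rightarrow> real ^ 'd \<Rightarrow> real"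
  where "M > 0" "c > 0" "h0 > 0" "h0 \<le> 1" "S \<ge> 0"
    "integrable lborel b" "\<And>x. 0 \<le> b x" "\<And>x. b x \<le> b1" "\<And>x. x \<notin> cball 0 1 \<Longrightarrow> b x = 0" "(LINT x|lborel. b x) = 1"
    "sobolev_norm_sq \<beta> b \<le> ennreal S"
    "\<And>h. 0 < h \<Longrightarrow> h \<le> h0 \<Longrightarrow> integrable lborel (f h)"
    "\<And>h x. 0 < h \<Longrightarrow> h \<le> h0 \<Longrightarrow> \<bar>f h x\<bar> \<le> M * b x"
    "\<And>h. 0 < h \<Longrightarrow> h \<le> h0 \<Longrightarrow> (LINT x|lborel. f h x) = 0"
    "\<And>h. 0 < h \<Longrightarrow> h \<le> h0 \<Longrightarrow> \<exists>w\<in>borel_measurable borel. (\<forall>x. 0 \<le> w x \<and> w x \<le> 1) \<and> c \<le> (LINT x|lborel. w x * f h x)"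
    "\<And>h. 0 < h \<Longrightarrow> h \<le> h0 \<Longrightarrow> sobolev_norm_sq \<beta> (f h) \<le> ennreal (h powr (- 2 * \<beta>) * S)"
    "\<And>h s. 0 < h \<Longrightarrow> h \<le> h0 \<Longrightarrow> s > 0 \<Longrightarrow>
       gauss_form s (f h) (f h) \<le> S * (s powr (- real CARD('d) / 2) * min 1 ((s / (1 / h\<^sup>2)) ^ K))"
proof -
  define d where "d = CARD('d)"
  have d: "d \<ge> 1" unfolding d_def using zero_less_card_finite[where 'a = 'd] by linarith
  \<comment> \<open>The cube of half-width 1/d lies in the unit ball, because the Euclidean norm is
    at most the sum of the |x_i|.\<close>
  define r :: real where "r = 1 / real d"
  have r: "r > 0" using d by (simp add: r_def)
  define m where "m = 2 * K + nat \<lceil>2 * \<beta>\<rceil>"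
  \<comment> \<open>The choice of the oscillating coordinate is arbitrary; \<open>undefined\<close>
    names one.\<close>
  define j :: 'd where "j = undefined"
  obtain B :: "real \<Rightarrow> real" and b0 b1 SB :: real
    where B: "b0 > 0" "SB \<ge> 0" "B \<in> borel_measurable borel" "\<And>x. 0 \<le> B x" "\<And>x. B x \<le> b1"
      "\<And>x. x \<notin> {-r..r} \<Longrightarrow> B x = 0" "\<And>x. \<bar>x\<bar> \<le> r / 2 \<Longrightarrow> b0 \<le> B x"
      "integrable lborel B" "(LINT x|lborel. B x) = 1"
      "(\<integral>\<^sup>+t. ennreal ((1 + \<bar>t\<bar>) powr (2 * \<beta>) * (cmod (ft (\<lambda>x. complex_of_real (B x)) t))\<^sup>2) \<partial>lborel) \<le> ennreal SB"
  proof -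
    show ?thesis
    proof (rule bump_profile[OF r assms(1)], goal_cases)
      case (1 b0 SB B b1)
      then show ?case by (rule that)
    qed
  qed
  note [measurable] = B(3)
  \<comment> \<open>The packet lives on the inner half, where \<open>B\<close> is at least
    \<open>b0\<close>; hence \<open>M = C / b0\<close> makes \<open>M * B\<close> dominate it
    everywhere.\<close>
  from r have r2: "r / 2 > 0" by simp
  obtain F g :: "real \<Rightarrow> real \<Rightarrow> real" and C c h0 :: real
    where F: "C > 0" "c > 0" "h0 > 0" "h0 \<le> 1"
    "\<And>h. F h \<in> borel_measurable borel" "\<And>h. g h \<in> borel_measurable borel"
    "\<And>h x. x \<notin> {-(r/2)..r/2} \<Longrightarrow> F h x = 0"
    "\<And>h x. 0 < h \<Longrightarrow> h \<le> h0 \<Longrightarrow> \<bar>F h x\<bar> \<le> C"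
    "\<And>h t. 0 < h \<Longrightarrow> h \<le> h0 \<Longrightarrow> cmod (ft (\<lambda>x. complex_of_real (F h x)) t) \<le> \<bar>h * t\<bar> ^ K * g h t"
    "\<And>h. 0 < h \<Longrightarrow> h \<le> h0 \<Longrightarrow> (\<integral>\<^sup>+t. ennreal ((1 + \<bar>h * t\<bar>) ^ m * (g h t)\<^sup>2) \<partial>lborel) \<le> ennreal C"
    "\<And>h. 0 < h \<Longrightarrow> h \<le> h0 \<Longrightarrow> c \<le> Re (ft (\<lambda>x. complex_of_real (F h x)) (1 / h))"
  proof -
    show ?thesis
    proof (rule wave_packet[OF r2, of K m], goal_cases)
      case (1 C c h0 F g)
      then show ?case by (rule that)
    qed
  qed
  note [measurable] = F(5,6)
  define M where "M = C / b0"
  have M: "M > 0" using B F by (simp add: M_def)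
  have FB: "\<bar>F h x\<bar> \<le> M * B x" if "0 < h" "h \<le> h0" for h x
  proof (cases "x \<in> {-(r/2)..r/2}")
    case True
    then have "b0 \<le> B x" using B(7)[of x] by auto
    have "\<bar>F h x\<bar> \<le> M * b0" using F(8)[OF that, of x] B(1) by (simp add: M_def)
    also have "\<dots> \<le> M * B x" using \<open>b0 \<le> B x\<close> M by simp
    finally show ?thesis .
  qed (use F(7) B(4) M in simp)
  have Fint: "integrable lborel (F h)" if "0 < h" "h \<le> h0" for h
  proof (rule Bochner_Integration.integrable_bound)
    show "integrable lborel (\<lambda>x. M * B x)" using B(8) by simp
    show "AE x in lborel. norm (F h x) \<le> norm (M * B x)"
      using FB[OF that] B(4) M by (auto simp: abs_mult)
  qed measurable
  define b :: "real ^ 'd \<Rightarrow> real" where "b x = (\<Prod>i\<in>UNIV. B (x $ i))" for x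
  define W where "W h i = (if i = j then F h else B)" for h and i :: 'd
  define f :: "real \<Rightarrow> real ^ 'd \<Rightarrow> real" where "f h x = (\<Prod>i\<in>UNIV. W h i (x $ i))" for h x
  have Wint: "integrable lborel (W h i)" if "0 < h" "h \<le> h0" for h i
    unfolding W_def using Fint[OF that] B(8) by simp
  \<comment> \<open>One constant for three bounds: the summands serve the Sobolev norm of
    \<open>b\<close>, the Sobolev norm of \<open>f h\<close> and its Gaussian form.\<close>
  define S where "S = SB ^ d + C * SB ^ (d - 1) + 4 ^ K * fact K * C * SB ^ (d - 1)"
  have S: "S \<ge> 0" "SB ^ d \<le> S" "C * SB ^ (d - 1) \<le> S" "4 ^ K * fact K * C * SB ^ (d - 1) \<le> S"
    using B(2) F(1) by (auto simp: S_def add_nonneg_nonneg)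
  show thesis
  proof (rule that[of M "c / 2" h0 S b "b1 ^ d" f])
    show "M > 0" "c / 2 > 0" "h0 > 0" "h0 \<le> 1" "S \<ge> 0" using M F S by auto
    show "integrable lborel b" unfolding b_def[abs_def] by (rule integrable_cart_prod) (rule B(8))
    show b_nn: "0 \<le> b x" for x unfolding b_def by (intro prod_nonneg) (simp add: B(4))
    show "b x \<le> b1 ^ d" for x
    proof -
      have "b x \<le> (\<Prod>i\<in>(UNIV::'d set). b1)" unfolding b_def by (intro prod_mono) (simp add: B(4,5))
      then show ?thesis by (simp add: d_def)
    qed
    show "b x = 0" if "x \<notin> cball 0 1" for x
    proof -
      have "\<exists>i. r < \<bar>x $ i\<bar>"
      proof (rule ccontr)
        assume "\<not> (\<exists>i. r < \<bar>x $ i\<bar>)"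
        then have "(\<Sum>i\<in>UNIV. \<bar>x $ i\<bar>) \<le> (\<Sum>i\<in>(UNIV::'d set). r)"
          by (intro sum_mono) (simp add: not_less)
        also have "\<dots> = 1" using d by (simp add: r_def flip: d_def)
        finally have "norm x \<le> 1" using norm_le_l1_cart[of x] by linarith
        with that show False by simp
      qed
      then obtain i where "r < \<bar>x $ i\<bar>" by blast
      then have "B (x $ i) = 0" by (intro B(6)) auto
      then show ?thesis unfolding b_def by (intro prod_zero) auto
    qed
    show "(LINT x|lborel. b x) = 1" unfolding b_def
      using integral_cart_prod[of "\<lambda>_::'d. B"] B(8,9) by simp
    show "sobolev_norm_sq \<beta> b \<le> ennreal S"
    proof -
      have "sobolev_norm_sq \<beta> b \<le> (\<Prod>i\<in>(UNIV::'d set). ennreal SB)"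
        unfolding b_def[abs_def]
        by (rule order.trans[OF sobolev_cart_prod[OF B(8) assms(1)]]) (intro prod_mono_ennreal B(10))
      also have "\<dots> = ennreal (SB ^ d)" using B(2) by (simp add: d_def ennreal_power)
      also have "\<dots> \<le> ennreal S" using S by (intro ennreal_leI)
      finally show ?thesis .
    qed
    fix h :: real assume h: "0 < h" "h \<le> h0"
    have h1: "h \<le> 1" using h F(4) by simp
    show "integrable lborel (f h)" unfolding f_def[abs_def] by (rule integrable_cart_prod) (rule Wint[OF h])
    show "\<bar>f h x\<bar> \<le> M * b x" for x
    proof -
      have "\<bar>f h x\<bar> = (\<Prod>i\<in>UNIV. \<bar>W h i (x $ i)\<bar>)" by (simp add: f_def abs_prod)
      also have "\<dots> \<le> (\<Prod>i\<in>UNIV. (if i = j then M else 1) * B (x $ i))"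
        by (intro prod_mono) (auto simp: W_def FB[OF h] B(4))
      also have "\<dots> = M * b x"
        by (simp add: prod.distrib b_def)
      finally show ?thesis .
    qed
    \<comment> \<open>The integral is the transform at t = 0, where the factor |h t|^K vanishes
      because K \<ge> 1.\<close>
    have F0: "(LINT x|lborel. F h x) = 0"
    proof -
      have "cmod (ft (\<lambda>x. complex_of_real (F h x)) 0) \<le> 0"
        using F(9)[OF h, of 0] K by (simp add: power_0_left)
      then show ?thesis by (simp add: ft_def)
    qed
    have prodW: "(\<Prod>i\<in>UNIV. LINT x|lborel. (if i = j then G else B) x) = (LINT x|lborel. G x)" for G :: "real \<Rightarrow> real"
    proof -
      have "(\<Prod>i\<in>UNIV. LINT x|lborel. (if i = j then G else B) x) = (\<Prod>i\<in>(UNIV::'d set). if i = j then (LINT x|lborel. G x) else 1)"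
        by (intro prod.cong refl) (simp add: B(9))
      then show ?thesis by (simp add: prod_if_single)
    qed
    show f0: "(LINT x|lborel. f h x) = 0"
    proof -
      have "(LINT x|lborel. f h x) = (\<Prod>i\<in>UNIV. LINT x|lborel. W h i x)"
        unfolding f_def by (rule integral_cart_prod) (rule Wint[OF h])
      then show ?thesis unfolding W_def prodW F0 .
    qed
    show "\<exists>w\<in>borel_measurable borel. (\<forall>x. 0 \<le> w x \<and> w x \<le> 1) \<and> c / 2 \<le> (LINT x|lborel. w x * f h x)"
    proof (intro bexI conjI allI)
      \<comment> \<open>The cosine detects the frequency 1/h, and the affine change brings it into
        the unit interval. Its constant part integrates to 0 against \<open>f h\<close>, hence
        \<open>c / 2\<close>.\<close>
      let ?w = "\<lambda>x::real^'d. (1 + cos (x $ j / h)) / 2"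
      have c: "0 \<le> (1 + c) / 2" "(1 + c) / 2 \<le> 1" if "- 1 \<le> c" "c \<le> 1" for c :: real
        using that by simp_all
      show "0 \<le> ?w x" for x by (rule c) simp_all
      show "?w x \<le> 1" for x by (rule c) simp_all
      have cF: "integrable lborel (\<lambda>x. cos (x / h) * F h x)"
        using Fint[OF h] by (rule Bochner_Integration.integrable_bound) (auto simp: abs_mult mult_left_le_one_le)
      have e: "cos (x $ j / h) * f h x = (\<Prod>i\<in>UNIV. (if i = j then (\<lambda>x. cos (x / h) * F h x) else B) (x $ i))" for x
      proof -
        have "(\<Prod>i\<in>UNIV. (if i = j then (\<lambda>x. cos (x / h) * F h x) else B) (x $ i))
           = (\<Prod>i\<in>UNIV. (if i = j then cos (x $ j / h) else 1) * W h i (x $ i))"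
          by (intro prod.cong) (auto simp: W_def)
        then show ?thesis by (simp add: prod.distrib f_def)
      qed
      have i: "integrable lborel ((if i = j then (\<lambda>x. cos (x / h) * F h x) else B))" for i
        using cF B(8) by simp
      have "integrable lborel (\<lambda>x. cos (x $ j / h) * f h x)"
        unfolding e by (rule integrable_cart_prod[OF i])
      moreover have "(LINT x|lborel. cos (x $ j / h) * f h x) = (LINT x|lborel. cos (x / h) * F h x)"
        unfolding e integral_cart_prod[OF i] prodW ..
      moreover have "(LINT x|lborel. cos (x / h) * F h x) = Re (ft (\<lambda>x. complex_of_real (F h x)) (1 / h))"
        unfolding ft_def
        by (subst integral_Re[symmetric]) (use integrable_cis_mult[of lborel "\<lambda>x. complex_of_real (F h x)" "\<lambda>x. - (x * (1 / h))"] Fint[OF h] in auto)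
      ultimately have "c \<le> (LINT x|lborel. cos (x $ j / h) * f h x)" and ci: "integrable lborel (\<lambda>x. cos (x $ j / h) * f h x)"
        using F(11)[OF h] by simp_all
      moreover have "(LINT x|lborel. ?w x * f h x) = (LINT x|lborel. f h x / 2 + (cos (x $ j / h) * f h x) / 2)"
        by (intro Bochner_Integration.integral_cong) (auto simp: field_simps)
      moreover have "\<dots> = (LINT x|lborel. f h x) / 2 + (LINT x|lborel. cos (x $ j / h) * f h x) / 2"
        using ci \<open>integrable lborel (f h)\<close> by simp
      ultimately show "c / 2 \<le> (LINT x|lborel. ?w x * f h x)" using f0 by simp
      show "?w \<in> borel_measurable borel" by measurable
    qed
    have mG: "(\<lambda>t. (1 + \<bar>h * t\<bar>) ^ m * (g h t)\<^sup>2) \<in> borel_measurable lborel" by measurable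
    show "sobolev_norm_sq \<beta> (f h) \<le> ennreal (h powr (- 2 * \<beta>) * S)"
    proof -
      have 1: "(\<integral>\<^sup>+t. ennreal ((1 + \<bar>t\<bar>) powr (2 * \<beta>) * (cmod (ft (\<lambda>x. complex_of_real (F h x)) t))\<^sup>2) \<partial>lborel) \<le> ennreal (h powr (- 2 * \<beta>) * C)"
        by (rule nn_integral_le_cmult[OF mG packet_sobolev_pointwise[OF h(1) h1 assms(1) norm_ge_zero F(9)[OF h] m_def] _ F(10)[OF h]])
          (use F(1) in auto)
      have "sobolev_norm_sq \<beta> (f h) \<le> (\<Prod>i\<in>(UNIV::'d set). if i = j then ennreal (h powr (- 2 * \<beta>) * C) else ennreal SB)"
        unfolding f_def[abs_def]
        by (rule order.trans[OF sobolev_cart_prod[OF Wint[OF h] assms(1)]]) (intro prod_mono_ennreal, use 1 B(10) in \<open>auto simp: W_def\<close>)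
      also have "\<dots> = ennreal (h powr (- 2 * \<beta>) * (C * SB ^ (d - 1)))"
        unfolding prod_if_single using B(2) F(1) by (simp add: d_def ennreal_power mult.assoc flip: ennreal_mult')
      also have "\<dots> \<le> ennreal (h powr (- 2 * \<beta>) * S)" using S by (intro ennreal_leI mult_left_mono) auto
      finally show ?thesis .
    qed
    fix s :: real assume s: "s > 0"
    define \<mu> where "\<mu> = min 1 ((s / (1 / h\<^sup>2)) ^ K)"
    have \<mu>: "\<mu> \<ge> 0" using s by (simp add: \<mu>_def)
    have mK: "2 * K \<le> m" by (simp add: m_def)
    have DF: "(\<integral>\<^sup>+t. ennreal ((cmod (ft (\<lambda>x. complex_of_real (F h x)) t))\<^sup>2 * exp (- t\<^sup>2 / (4 * s))) \<partial>lborel) \<le> ennreal ((4 ^ K * fact K * \<mu>) * C)"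
    proof (rule nn_integral_le_cmult[OF mG _ _ F(10)[OF h]])
      show "(cmod (ft (\<lambda>x. complex_of_real (F h x)) t))\<^sup>2 * exp (- t\<^sup>2 / (4 * s))
         \<le> (4 ^ K * fact K * \<mu>) * ((1 + \<bar>h * t\<bar>) ^ m * (g h t)\<^sup>2)" for t
        using packet_energy_pointwise[OF s norm_ge_zero F(9)[OF h] mK] by (simp add: \<mu>_def mult.commute[of s])
    qed (use \<mu> F(1) in auto)
    \<comment> \<open>The Gaussian is at most 1 and the Sobolev weight at least 1, so
      \<open>SB\<close> also bounds the Gaussian average of the profile.\<close>
    have DB: "(\<integral>\<^sup>+t. ennreal ((cmod (ft (\<lambda>x. complex_of_real (B x)) t))\<^sup>2 * exp (- t\<^sup>2 / (4 * s))) \<partial>lborel) \<le> ennreal SB"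
    proof (rule order.trans[OF nn_integral_mono B(10)], rule ennreal_leI)
      fix t :: real
      have "(cmod (ft (\<lambda>x. complex_of_real (B x)) t))\<^sup>2 * exp (- t\<^sup>2 / (4 * s)) \<le> (cmod (ft (\<lambda>x. complex_of_real (B x)) t))\<^sup>2 * (1 + \<bar>t\<bar>) powr (2 * \<beta>)"
      proof (rule mult_left_mono)
        have "exp (- t\<^sup>2 / (4 * s)) \<le> 1" using s by simp
        also have "1 \<le> (1 + \<bar>t\<bar>) powr (2 * \<beta>)" using assms(1) by (intro ge_one_powr_ge_zero) auto
        finally show "exp (- t\<^sup>2 / (4 * s)) \<le> (1 + \<bar>t\<bar>) powr (2 * \<beta>)" .
      qed simp
      then show "(cmod (ft (\<lambda>x. complex_of_real (B x)) t))\<^sup>2 * exp (- t\<^sup>2 / (4 * s)) \<le> (1 + \<bar>t\<bar>) powr (2 * \<beta>) * (cmod (ft (\<lambda>x. complex_of_real (B x)) t))\<^sup>2"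
        by (simp only: mult.commute)
    qed
    let ?p = "s powr (-1/2)"
    have nn: "0 \<le> 4 ^ K * fact K * \<mu> * C" using \<mu> F(1) by simp
    note qF = gauss_form_bounds[OF Fint[OF h] s nn DF]
    note qB = gauss_form_bounds[OF B(8) s B(2) DB]
    have "gauss_form s (f h) (f h) = (\<Prod>i\<in>UNIV. gauss_form s (W h i) (W h i))"
      unfolding f_def[abs_def] by (rule gauss_form_cart_prod[OF Wint[OF h]]) (use s in simp)
    also have "\<dots> \<le> (\<Prod>i\<in>UNIV. (if i = j then 4 ^ K * fact K * \<mu> * C else SB) * ?p)"
      by (intro prod_mono) (use qF qB in \<open>auto simp: W_def\<close>)
    also have "\<dots> = (4 ^ K * fact K * C * SB ^ (d - 1)) * (?p ^ d * \<mu>)"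
      by (simp add: prod.distrib prod_if_single d_def)
    also have "\<dots> \<le> S * (?p ^ d * \<mu>)"
      using S \<mu> by (intro mult_right_mono) auto
    also have "?p ^ d = s powr (- real CARD('d) / 2)"
      using s by (subst powr_power) (simp_all add: d_def)
    finally show "gauss_form s (f h) (f h) \<le> S * (s powr (- real CARD('d) / 2) * min 1 ((s / (1 / h\<^sup>2)) ^ K))"
      by (simp add: \<mu>_def)
  qed
qed

section \<open>Sobolev norms, total variation and membership in the class\<close>

lemma fourier_measurable [measurable]:
  fixes f :: "real ^ 'd \<Rightarrow> real"
  assumes "integrable lborel f"
  shows "fourier f \<in> borel_measurable borel"
proof -
  have [measurable]: "f \<in> borel_measurable borel" using assms by auto
  show ?thesis unfolding fourier_def[abs_def] by measurable
qed

text \<open>Applies |x + y|^2 \<le> 2 |x|^2 + 2 |y|^2 at every frequency; this stays meaningful for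
  infinite norms and leaves explicit constants to budget with.\<close>

lemma sobolev_norm_sq_lincomb:
  fixes p q :: "real ^ 'd \<Rightarrow> real"
  assumes p: "integrable lborel p" and q: "integrable lborel q"
  shows "sobolev_norm_sq \<beta> (\<lambda>x. a * p x + c * q x)
    \<le> ennreal (2 * a\<^sup>2) * sobolev_norm_sq \<beta> p + ennreal (2 * c\<^sup>2) * sobolev_norm_sq \<beta> q"
proof -
  note [measurable] = fourier_measurable[OF p] fourier_measurable[OF q]
  have eq: "fourier (\<lambda>x. a * p x + c * q x) \<omega> = a * fourier p \<omega> + c * fourier q \<omega>" for \<omega>
  proof -
    have m: "(\<lambda>x. - (x \<bullet> \<omega>)) \<in> borel_measurable lborel" by measurable
    have i: "integrable lborel (\<lambda>x. cis (- (x \<bullet> \<omega>)) * complex_of_real (p x))" "integrable lborel (\<lambda>x. cis (- (x \<bullet> \<omega>)) * complex_of_real (q x))"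
      using p q by (auto intro!: integrable_cis_mult)
    have "fourier (\<lambda>x. a * p x + c * q x) \<omega>
      = (LINT x|lborel. a * (cis (- (x \<bullet> \<omega>)) * complex_of_real (p x)) + c * (cis (- (x \<bullet> \<omega>)) * complex_of_real (q x)))"
      unfolding fourier_def by (intro Bochner_Integration.integral_cong) (auto simp: algebra_simps)
    also have "\<dots> = a * fourier p \<omega> + c * fourier q \<omega>"
      using i by (subst Bochner_Integration.integral_add) (auto simp: fourier_def)
    finally show ?thesis .
  qed
  have le: "(cmod (fourier (\<lambda>x. a * p x + c * q x) \<omega>))\<^sup>2 \<le> 2 * a\<^sup>2 * (cmod (fourier p \<omega>))\<^sup>2 + 2 * c\<^sup>2 * (cmod (fourier q \<omega>))\<^sup>2" for \<omega>
  proof -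
    have "cmod (fourier (\<lambda>x. a * p x + c * q x) \<omega>) \<le> \<bar>a\<bar> * cmod (fourier p \<omega>) + \<bar>c\<bar> * cmod (fourier q \<omega>)"
      unfolding eq by (rule order.trans[OF norm_triangle_ineq]) (simp add: norm_mult)
    then have "(cmod (fourier (\<lambda>x. a * p x + c * q x) \<omega>))\<^sup>2 \<le> (\<bar>a\<bar> * cmod (fourier p \<omega>) + \<bar>c\<bar> * cmod (fourier q \<omega>))\<^sup>2"
      by (rule power_mono) simp
    also have "\<dots> \<le> 2 * (\<bar>a\<bar> * cmod (fourier p \<omega>))\<^sup>2 + 2 * (\<bar>c\<bar> * cmod (fourier q \<omega>))\<^sup>2"
      using sum_squares_bound[of "\<bar>a\<bar> * cmod (fourier p \<omega>)" "\<bar>c\<bar> * cmod (fourier q \<omega>)"] unfolding power2_sum by linarith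
    finally show ?thesis by (simp only: power_mult_distrib power2_abs mult.assoc)
  qed
  have "sobolev_norm_sq \<beta> (\<lambda>x. a * p x + c * q x)
    \<le> (\<integral>\<^sup>+\<omega>. ennreal (2 * a\<^sup>2) * ennreal (norm \<omega> powr (2 * \<beta>) * (cmod (fourier p \<omega>))\<^sup>2)
        + ennreal (2 * c\<^sup>2) * ennreal (norm \<omega> powr (2 * \<beta>) * (cmod (fourier q \<omega>))\<^sup>2) \<partial>lborel)"
    unfolding sobolev_norm_sq_def
  proof (rule nn_integral_mono)
    fix \<omega> :: "real ^ 'd"
    have "norm \<omega> powr (2 * \<beta>) * (cmod (fourier (\<lambda>x. a * p x + c * q x) \<omega>))\<^sup>2
      \<le> norm \<omega> powr (2 * \<beta>) * (2 * a\<^sup>2 * (cmod (fourier p \<omega>))\<^sup>2 + 2 * c\<^sup>2 * (cmod (fourier q \<omega>))\<^sup>2)"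
      by (intro mult_left_mono le) simp
    also have "\<dots> = 2 * a\<^sup>2 * (norm \<omega> powr (2 * \<beta>) * (cmod (fourier p \<omega>))\<^sup>2) + 2 * c\<^sup>2 * (norm \<omega> powr (2 * \<beta>) * (cmod (fourier q \<omega>))\<^sup>2)"
      by (simp only: distrib_left mult_ac)
    finally show "ennreal (norm \<omega> powr (2 * \<beta>) * (cmod (fourier (\<lambda>x. a * p x + c * q x) \<omega>))\<^sup>2)
       \<le> ennreal (2 * a\<^sup>2) * ennreal (norm \<omega> powr (2 * \<beta>) * (cmod (fourier p \<omega>))\<^sup>2)
        + ennreal (2 * c\<^sup>2) * ennreal (norm \<omega> powr (2 * \<beta>) * (cmod (fourier q \<omega>))\<^sup>2)"
      by (simp add: ennreal_leI del: ennreal_plus flip: ennreal_mult' ennreal_plus)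
  qed
  also have "\<dots> = ennreal (2 * a\<^sup>2) * sobolev_norm_sq \<beta> p + ennreal (2 * c\<^sup>2) * sobolev_norm_sq \<beta> q"
  proof -
    have k: "(\<integral>\<^sup>+\<omega>. ennreal k * ennreal (norm \<omega> powr (2 * \<beta>) * (cmod (fourier f \<omega>))\<^sup>2) \<partial>lborel) = ennreal k * sobolev_norm_sq \<beta> f"
      if [measurable]: "fourier f \<in> borel_measurable borel" for k and f :: "real ^ 'd \<Rightarrow> real"
      unfolding sobolev_norm_sq_def by (rule nn_integral_cmult) measurable
    show ?thesis
      by (subst nn_integral_add, measurable)
        (simp only: k[OF fourier_measurable[OF p]] k[OF fourier_measurable[OF q]])
  qed
  finally show ?thesis .
qed

lemma sobolev_norm_less_iff:
  assumes "C > 0"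
  shows "sobolev_norm \<beta> p < ennreal C \<longleftrightarrow> sobolev_norm_sq \<beta> p < ennreal (C\<^sup>2)"
proof (cases "sobolev_norm_sq \<beta> p = \<infinity>")
  case False
  then obtain x where x: "x \<ge> 0" "sobolev_norm_sq \<beta> p = ennreal x"
    by (cases "sobolev_norm_sq \<beta> p") auto
  have "sqrt x < C \<longleftrightarrow> x < C\<^sup>2"
    using assms real_sqrt_less_iff[of x "C\<^sup>2"] by simp
  then show ?thesis using x assms by (simp add: sobolev_norm_def ennreal_less_iff)
qed (simp add: sobolev_norm_def)

text \<open>Among weights with values between 0 and 1, the integral of w (p - q) is largest for the
  indicator of p > q. Hence a smooth test function bounds the supremum over sets from below.\<close>

lemma tv_dist_density_bounds:
  fixes p q :: "'a::euclidean_space \<Rightarrow> real"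
  assumes p: "integrable lborel p" "\<And>x. 0 \<le> p x" and q: "integrable lborel q" "\<And>x. 0 \<le> q x"
    and P: "prob_space (density lborel p)" "prob_space (density lborel q)"
    and w: "w \<in> borel_measurable borel" "\<And>x. 0 \<le> w x" "\<And>x. w x \<le> 1"
  shows "(LINT x|lborel. w x * (p x - q x)) \<le> tv_dist (density lborel p) (density lborel q)"
    and "tv_dist (density lborel p) (density lborel q) \<le> (LINT x|lborel. \<bar>p x - q x\<bar>)"
proof -
  note [measurable] = w(1)
  have [measurable]: "p \<in> borel_measurable borel" "q \<in> borel_measurable borel" using p q by auto
  interpret p: prob_space "density lborel p" by fact
  interpret q: prob_space "density lborel q" by fact
  have i: "integrable lborel (\<lambda>x. indicator A x * f x)" if "A \<in> sets borel" "integrable lborel f" for A and f :: "'a \<Rightarrow> real"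
    using that integrable_mult_indicator[of A lborel f] by simp
  have md: "measure (density lborel f) A = (LINT x|lborel. indicator A x * f x)"
    if "integrable lborel f" "\<And>x. 0 \<le> f x" "A \<in> sets borel" for A and f :: "'a \<Rightarrow> real"
  proof -
    have [measurable]: "f \<in> borel_measurable borel" using that by auto
    have "emeasure (density lborel f) A = (\<integral>\<^sup>+x. ennreal (indicator A x * f x) \<partial>lborel)"
      using that by (subst emeasure_density) (auto intro!: nn_integral_cong simp: indicator_def)
    also have "\<dots> = ennreal (LINT x|lborel. indicator A x * f x)"
      using that i by (intro nn_integral_eq_integral) auto
    finally show ?thesis using that by (simp add: measure_def)
  qed
  have diff: "measure (density lborel p) A - measure (density lborel q) A = (LINT x|lborel. indicator A x * (p x - q x))"
    if "A \<in> sets borel" for A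
    using that p q by (simp add: md right_diff_distrib i)
  have ipq: "integrable lborel (\<lambda>x. p x - q x)" using p q by simp
  have bdd: "bdd_above ((\<lambda>A. measure (density lborel p) A - measure (density lborel q) A) ` sets (density lborel p))"
    by (rule bdd_aboveI2[of _ _ 1]) (smt (verit) measure_nonneg p.prob_le_1)
  define G where "G = {x. 0 < p x - q x}"
  have [measurable]: "G \<in> sets borel" unfolding G_def by measurable
  have wi: "integrable lborel (\<lambda>x. w x * (p x - q x))"
    using ipq by (rule Bochner_Integration.integrable_bound) (use w in \<open>auto simp: abs_mult mult_left_le_one_le\<close>)
  have "(LINT x|lborel. w x * (p x - q x)) \<le> (LINT x|lborel. indicator G x * (p x - q x))"
  proof (rule integral_mono[OF wi i[OF _ ipq]])
    show "w x * (p x - q x) \<le> indicator G x * (p x - q x)" for x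
      using w(2,3)[of x] by (auto simp: G_def indicator_def mult_left_le_one_le mult_nonneg_nonpos)
  qed measurable
  also have "\<dots> \<le> tv_dist (density lborel p) (density lborel q)"
    unfolding tv_dist_def by (subst diff[symmetric], measurable) (rule cSUP_upper[OF _ bdd], simp)
  finally show "(LINT x|lborel. w x * (p x - q x)) \<le> tv_dist (density lborel p) (density lborel q)" .
  show "tv_dist (density lborel p) (density lborel q) \<le> (LINT x|lborel. \<bar>p x - q x\<bar>)"
    unfolding tv_dist_def
  proof (rule cSUP_least)
    fix A assume "A \<in> sets (density lborel p)"
    then have A: "A \<in> sets borel" by simp
    show "measure (density lborel p) A - measure (density lborel q) A \<le> (LINT x|lborel. \<bar>p x - q x\<bar>)"
      unfolding diff[OF A] using A ipq by (intro integral_mono i) (auto simp: indicator_def)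
  qed auto
qed

text \<open>The factor 2 of \<open>sobolev_norm_sq_lincomb\<close> splits C^2 in halves:
  \<open>p\<close>, of radius \<open>C / 2\<close>, uses strictly less than one, and
  \<open>e\<close>, of squared norm at most C^2 / 4, fits into the other. An arbitrary
  \<open>e\<close> covers both \<delta> b and \<delta> b + a f_h.\<close>

lemma mixture_in_sobolev_densities:
  fixes p e :: "real ^ 'd \<Rightarrow> real"
  assumes C: "C > 0" and \<delta>: "0 \<le> \<delta>" "\<delta> \<le> 1"
    and p: "p \<in> borel_measurable borel" "\<And>x. 0 \<le> p x" "integrable lborel (\<lambda>x. (p x)\<^sup>2)"
      "prob_space (density lborel p)" "measure (density lborel p) (cball 0 1) = 1"
      "sobolev_norm_sq \<beta> p < ennreal ((C / 2)\<^sup>2)"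
    and e: "integrable lborel e" "\<And>x. 0 \<le> e x" "\<And>x. e x \<le> m" "\<And>x. x \<notin> cball 0 1 \<Longrightarrow> e x = 0" "(LINT x|lborel. e x) = \<delta>"
      "sobolev_norm_sq \<beta> e \<le> ennreal (C\<^sup>2 / 4)"
  shows "integrable lborel (\<lambda>x. (1 - \<delta>) * p x + e x)" "prob_space (density lborel (\<lambda>x. (1 - \<delta>) * p x + e x))"
    "measure (density lborel (\<lambda>x. (1 - \<delta>) * p x + e x)) (cball 0 1) = 1"
    "density lborel (\<lambda>x. (1 - \<delta>) * p x + e x) \<in> sobolev_densities \<beta> C"
proof -
  note [measurable] = p(1)
  have [measurable]: "e \<in> borel_measurable borel" using e(1) by auto
  interpret p: prob_space "density lborel p" by fact
  let ?q = "\<lambda>x. (1 - \<delta>) * p x + e x"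
  let ?\<mu> = "density lborel ?q"
  have p1: "(\<integral>\<^sup>+x. ennreal (p x) \<partial>lborel) = 1"
    using p.emeasure_space_1 by (simp add: emeasure_density)
  have pint: "integrable lborel p" "(LINT x|lborel. p x) = 1"
    using p(2) p1 integrableI_nn_integral_finite[of p lborel 1] integral_eq_nn_integral[of p lborel] by auto
  have cb [measurable]: "cball 0 1 \<in> sets (borel :: (real ^ 'd) measure)" by simp
  show qint: "integrable lborel ?q" using pint e by simp
  have q0: "0 \<le> ?q x" for x using \<delta> p(2) e(2) by simp
  have qB: "emeasure ?\<mu> (cball 0 1) = 1"
  proof -
    have "emeasure (density lborel p) (cball 0 1) = 1"
      using p(5) by (simp add: p.emeasure_eq_measure)
    then have pc: "(\<integral>\<^sup>+x. ennreal (p x) * indicator (cball 0 1) x \<partial>lborel) = 1"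
      by (simp add: emeasure_density)
    have "emeasure ?\<mu> (cball 0 1) = (\<integral>\<^sup>+x. ennreal (1 - \<delta>) * (ennreal (p x) * indicator (cball 0 1) x) + ennreal (e x) \<partial>lborel)"
    proof (subst emeasure_density)
      have "ennreal (?q x) * indicator (cball 0 1) x = ennreal (1 - \<delta>) * (ennreal (p x) * indicator (cball 0 1) x) + ennreal (e x)" for x
        using \<delta> p(2)[of x] e(2)[of x] e(4)[of x]
        by (cases "x \<in> cball 0 1") (auto simp: ennreal_plus ennreal_mult')
      then show "(\<integral>\<^sup>+x. ennreal (?q x) * indicator (cball 0 1) x \<partial>lborel) = (\<integral>\<^sup>+x. ennreal (1 - \<delta>) * (ennreal (p x) * indicator (cball 0 1) x) + ennreal (e x) \<partial>lborel)"
        by simp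
    qed measurable
    also have "\<dots> = ennreal (1 - \<delta>) * 1 + ennreal \<delta>"
    proof (subst nn_integral_add)
      have "(\<integral>\<^sup>+x. ennreal (e x) \<partial>lborel) = ennreal \<delta>"
        using e by (subst nn_integral_eq_integral) auto
      then show "(\<integral>\<^sup>+x. ennreal (1 - \<delta>) * (ennreal (p x) * indicator (cball 0 1) x) \<partial>lborel) + (\<integral>\<^sup>+x. ennreal (e x) \<partial>lborel) = ennreal (1 - \<delta>) * 1 + ennreal \<delta>"
        by (simp add: nn_integral_cmult pc)
    qed measurable
    also have "\<dots> = 1" using \<delta> by (simp flip: ennreal_plus)
    finally show ?thesis .
  qed
  show prob: "prob_space ?\<mu>"
  proof
    have "emeasure ?\<mu> (space ?\<mu>) = (\<integral>\<^sup>+x. ennreal (?q x) \<partial>lborel)"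
      by (subst emeasure_density) auto
    also have "\<dots> = ennreal (LINT x|lborel. ?q x)"
      using qint q0 by (intro nn_integral_eq_integral) auto
    also have "(LINT x|lborel. ?q x) = 1" using pint e by simp
    finally show "emeasure ?\<mu> (space ?\<mu>) = 1" by simp
  qed
  show meas: "measure ?\<mu> (cball 0 1) = 1" using qB by (simp add: measure_def)
  have sq: "integrable lborel (\<lambda>x. (?q x)\<^sup>2)"
  proof (rule Bochner_Integration.integrable_bound)
    \<comment> \<open>Boundedness of \<open>e\<close> gives e^2 \<le> m e, so its square is
      integrable because \<open>e\<close> is.\<close>
    show "integrable lborel (\<lambda>x. 2 * (p x)\<^sup>2 + 2 * (m * e x))" using p(3) e(1) by simp
    show "AE x in lborel. norm ((?q x)\<^sup>2) \<le> norm (2 * (p x)\<^sup>2 + 2 * (m * e x))"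
    proof (intro AE_I2)
      fix x
      have "(?q x)\<^sup>2 \<le> (p x + e x)\<^sup>2"
        using q0 \<delta> p(2)[of x] by (intro power_mono) (auto simp: mult_left_le_one_le)
      also have "\<dots> \<le> 2 * (p x)\<^sup>2 + 2 * (e x * e x)"
        using sum_squares_bound[of "p x" "e x"] unfolding power2_sum by (simp add: power2_eq_square)
      also have "e x * e x \<le> m * e x" using e by (intro mult_right_mono) auto
      finally show "norm ((?q x)\<^sup>2) \<le> norm (2 * (p x)\<^sup>2 + 2 * (m * e x))" by simp
    qed
  qed measurable
  have "sobolev_norm_sq \<beta> ?q \<le> ennreal (2 * (1 - \<delta>)\<^sup>2) * sobolev_norm_sq \<beta> p + ennreal (2 * 1\<^sup>2) * sobolev_norm_sq \<beta> e"
    using sobolev_norm_sq_lincomb[OF pint(1) e(1), of \<beta> "1 - \<delta>" 1] by simp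
  also have "\<dots> < ennreal (C\<^sup>2)"
  proof -
    obtain y where y: "y \<ge> 0" "sobolev_norm_sq \<beta> p = ennreal y" "y < (C / 2)\<^sup>2"
      using p(6) by (cases "sobolev_norm_sq \<beta> p") (auto simp: ennreal_less_iff)
    obtain z where z: "z \<ge> 0" "sobolev_norm_sq \<beta> e = ennreal z" "z \<le> C\<^sup>2 / 4"
      using e(6) by (cases "sobolev_norm_sq \<beta> e") (auto simp: ennreal_le_iff top_unique)
    have "(1 - \<delta>)\<^sup>2 \<le> 1" using \<delta> by (simp add: power_le_one)
    then have "2 * (1 - \<delta>)\<^sup>2 * y + 2 * 1\<^sup>2 * z \<le> 2 * 1 * y + 2 * 1\<^sup>2 * z"
      using y(1) by (intro add_right_mono mult_right_mono mult_left_mono) auto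
    also have "\<dots> < C\<^sup>2" using y(3) z(3) by (simp add: power_divide)
    finally have less: "2 * (1 - \<delta>)\<^sup>2 * y + 2 * 1\<^sup>2 * z < C\<^sup>2" .
    have "ennreal a * ennreal y + ennreal c * ennreal z = ennreal (a * y + c * z)" if "0 \<le> a" "0 \<le> c" for a c
      using that y z by (simp add: ennreal_plus ennreal_mult')
    from this[of "2 * (1 - \<delta>)\<^sup>2" "2 * 1\<^sup>2"]
    have "ennreal (2 * (1 - \<delta>)\<^sup>2) * ennreal y + ennreal (2 * 1\<^sup>2) * ennreal z = ennreal (2 * (1 - \<delta>)\<^sup>2 * y + 2 * 1\<^sup>2 * z)"
      by fastforce
    then show ?thesis
      unfolding y(2) z(2) using C by (simp only:) (rule ennreal_lessI[OF _ less], simp)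
  qed
  finally have "sobolev_norm \<beta> ?q < ennreal C" by (simp only: sobolev_norm_less_iff[OF C])
  with prob meas q0 sq show "?\<mu> \<in> sobolev_densities \<beta> C"
    unfolding sobolev_densities_def by (auto intro!: exI[of _ ?q])
qed

lemma gauss_form_scale:
  "gauss_form s (\<lambda>x. a * f x) (\<lambda>x. a * f x) = a\<^sup>2 * gauss_form s f f"
proof -
  have "(LINT y|lborel. exp (- s * (norm (x - y))\<^sup>2) * (a * f y)) = a * (LINT y|lborel. exp (- s * (norm (x - y))\<^sup>2) * f y)" for x
    unfolding integral_mult_right_zero[symmetric] by (simp only: mult.left_commute)
  moreover have "(a * f x) * (a * z) = a\<^sup>2 * (f x * z)" for x z
    by (simp only: power2_eq_square mult_ac)
  ultimately show ?thesis
    unfolding gauss_form_def by (simp only: integral_mult_right_zero)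
qed

section \<open>Choice of the parameters and the final estimate\<close>

theorem proposition5:
  fixes \<beta> \<gamma> C :: real
  assumes "\<beta> > 0"
    and "0 < \<gamma>" and "\<gamma> < 2"
    and "C > 0"
    and "(sobolev_densities \<beta> (C / 2) :: (real ^ 'd::finite) measure set) \<noteq> {}"
  shows "\<exists>C\<^sub>1::real. \<forall>\<epsilon>\<in>{0<..<1}.
           \<exists>\<mu>\<in>sobolev_densities \<beta> C. \<exists>\<nu>\<in>sobolev_densities \<beta> C.
             tv_dist \<mu> (\<nu> :: (real ^ 'd) measure) / \<epsilon> \<in> {1 / C\<^sub>1<..<C\<^sub>1} \<and>
             energy_dist \<gamma> \<mu> \<nu> \<le>
               C\<^sub>1 * tv_dist \<mu> \<nu> powr ((2 * \<beta> + real CARD('d) + \<gamma>) / (2 * \<beta>))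
                 * ln (3 + 1 / tv_dist \<mu> \<nu>) ^ (CARD('d) - 1)"
proof -
  define d where "d = CARD('d)"
  have d: "d \<ge> 1" unfolding d_def using zero_less_card_finite[where 'a = 'd] by linarith
  \<comment> \<open>As \<gamma> < 2, this exceeds (d + \<gamma>) / 2, the order of vanishing beyond
    which the s-integral converges at 0.\<close>
  define K where "K = d + 1"
  have K: "K \<ge> 1" by (simp add: K_def)
  from assms(5) obtain \<mu>0 :: "(real ^ 'd) measure" where "\<mu>0 \<in> sobolev_densities \<beta> (C / 2)" by blast
  then obtain p :: "real ^ 'd \<Rightarrow> real" where p: "p \<in> borel_measurable borel" "\<And>x. 0 \<le> p x"
      "integrable lborel (\<lambda>x. (p x)\<^sup>2)" "prob_space (density lborel p)" "measure (density lborel p) (cball 0 1) = 1"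
      and "sobolev_norm \<beta> p < ennreal (C / 2)"
    unfolding sobolev_densities_def by blast
  then have pS: "sobolev_norm_sq \<beta> p < ennreal ((C / 2)\<^sup>2)"
    using assms(4) by (subst sobolev_norm_less_iff[symmetric]) auto
  obtain M c h0 S :: real and b :: "real ^ 'd \<Rightarrow> real" and b1 :: real and f :: "real \<Rightarrow> real ^ 'd \<Rightarrow> real"
    where f: "M > 0" "c > 0" "h0 > 0" "h0 \<le> 1" "S \<ge> 0"
    "integrable lborel b" "\<And>x. 0 \<le> b x" "\<And>x. b x \<le> b1" "\<And>x. x \<notin> cball 0 1 \<Longrightarrow> b x = 0" "(LINT x|lborel. b x) = 1"
    "sobolev_norm_sq \<beta> b \<le> ennreal S"
    "\<And>h. 0 < h \<Longrightarrow> h \<le> h0 \<Longrightarrow> integrable lborel (f h)"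
    "\<And>h x. 0 < h \<Longrightarrow> h \<le> h0 \<Longrightarrow> \<bar>f h x\<bar> \<le> M * b x"
    "\<And>h. 0 < h \<Longrightarrow> h \<le> h0 \<Longrightarrow> (LINT x|lborel. f h x) = 0"
    "\<And>h. 0 < h \<Longrightarrow> h \<le> h0 \<Longrightarrow> \<exists>w\<in>borel_measurable borel. (\<forall>x. 0 \<le> w x \<and> w x \<le> 1) \<and> c \<le> (LINT x|lborel. w x * f h x)"
    "\<And>h. 0 < h \<Longrightarrow> h \<le> h0 \<Longrightarrow> sobolev_norm_sq \<beta> (f h) \<le> ennreal (h powr (- 2 * \<beta>) * S)"
    "\<And>h s. 0 < h \<Longrightarrow> h \<le> h0 \<Longrightarrow> s > 0 \<Longrightarrow>
       gauss_form s (f h) (f h) \<le> S * (s powr (- real CARD('d) / 2) * min 1 ((s / (1 / h\<^sup>2)) ^ K))"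
  proof -
    show ?thesis
    proof (rule oscillating_perturbation[OF assms(1) K, where 'd = 'd], goal_cases)
      case (1 M c h0 S b b1 f)
      then show ?case by (rule that)
    qed
  qed
  obtain ce :: real where ce: "ce > 0"
    "\<And>(\<mu> :: (real ^ 'd) measure) \<nu> b D. prob_space \<mu> \<Longrightarrow> prob_space \<nu> \<Longrightarrow> sets \<mu> = sets borel \<Longrightarrow> sets \<nu> = sets borel \<Longrightarrow>
      measure \<mu> (cball 0 1) = 1 \<Longrightarrow> measure \<nu> (cball 0 1) = 1 \<Longrightarrow> D \<ge> 0 \<Longrightarrow>
      (\<And>s. s > 0 \<Longrightarrow> gauss_mean s \<mu> \<mu> + gauss_mean s \<nu> \<nu> - 2 * gauss_mean s \<mu> \<nu> \<le> b s) \<Longrightarrow>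
      (\<integral>\<^sup>+s. ennreal (riesz \<gamma> s * b s) \<partial>lborel) \<le> ennreal D \<Longrightarrow>
      energy_dist \<gamma> \<mu> \<nu> \<le> sqrt (ce * D)"
  proof -
    show ?thesis
    proof (rule energy_dist_bound[OF assms(2,3), where 'd = 'd], goal_cases)
      case (1 c)
      then show ?case by (rule that)
    qed
  qed
  \<comment> \<open>At most 1 to be a mixture weight, and so small that \<delta> b uses only part of
    the Sobolev budget.\<close>
  define \<delta> where "\<delta> = min 1 (C / (4 * (S + 1)))"
  \<comment> \<open>This is the Sobolev bound of \<open>f h\<close> at h = h0; smaller h will be
    compensated by a smaller amplitude.\<close>
  define S' where "S' = h0 powr (- 2 * \<beta>) * S"
  \<comment> \<open>The first entry keeps the perturbation below \<delta> b, hence the density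
    nonnegative; the second bounds its Sobolev norm.\<close>
  define A where "A = min (\<delta> / M) (C / (4 * (S' + 1)))"
  have S'0: "S' \<ge> 0" using f(5) by (simp add: S'_def)
  have \<delta>: "\<delta> > 0" "\<delta> \<le> 1" using assms(4) f(5) by (auto simp: \<delta>_def intro!: divide_pos_pos)
  have A: "A > 0" "A * M \<le> \<delta>"
    using \<delta> assms(4) f(1) S'0 by (auto simp: A_def min_def field_simps intro!: divide_pos_pos)
  \<comment> \<open>The summand 1 prevents division by zero at T = 0, and T \<le> (T + 1)^2 does the
    rest. Two such contributions add up to C^2 / 4, the amount that
    \<open>mixture_in_sobolev_densities\<close> allows.\<close>
  have small: "2 * x\<^sup>2 * T \<le> C\<^sup>2 / 8" if "0 \<le> x" "x \<le> C / (4 * (T + 1))" "0 \<le> T" for x T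
  proof -
    have sq: "2 * (C / (4 * u))\<^sup>2 * T = C\<^sup>2 / 8 * (T / u\<^sup>2)" for u
      by (simp add: power_divide power_mult_distrib)
    have "x\<^sup>2 \<le> (C / (4 * (T + 1)))\<^sup>2" using that by (intro power_mono)
    then have "2 * x\<^sup>2 * T \<le> 2 * (C / (4 * (T + 1)))\<^sup>2 * T" using that by (intro mult_mono) auto
    also have "\<dots> = C\<^sup>2 / 8 * (T / (T + 1)\<^sup>2)" by (rule sq)
    also have "\<dots> \<le> C\<^sup>2 / 8 * 1"
    proof (rule mult_left_mono)
      have "T \<le> (T + 1)\<^sup>2" using that(3) by (simp add: power2_eq_square algebra_simps)
      then show "T / (T + 1)\<^sup>2 \<le> 1" using that(3) by (simp add: divide_le_eq)
    qed simp
    finally show ?thesis by simp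
  qed
  have \<delta>S: "2 * \<delta>\<^sup>2 * S \<le> C\<^sup>2 / 8" by (rule small) (use \<delta> f(5) in \<open>auto simp: \<delta>_def\<close>)
  have AS: "2 * A\<^sup>2 * S' \<le> C\<^sup>2 / 8" by (rule small) (use A S'0 in \<open>auto simp: A_def\<close>)
  define q where "q = real d / 2"
  define L where "L = 1 / (- \<gamma> / 2 - q + real K) + 1 / (\<gamma> / 2 + q)"
  have Kq: "- \<gamma> / 2 - q + real K > 0" using assms(3) d by (simp add: q_def K_def field_simps)
  have q0: "- \<gamma> / 2 - q < 0" using assms(2) d by (simp add: q_def)
  have L: "L \<ge> 0" using Kq q0 assms(2) by (auto simp: L_def q_def intro!: add_nonneg_nonneg)
  \<comment> \<open>Inserting a = A \<epsilon> and h = h0 \<epsilon>^(1/\<beta>) into the energy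
    bound gives \<open>Q\<close> times \<epsilon> to the power 1 + (\<gamma> + d) / (2 \<beta>),
    which is \<open>e\<close> below.\<close>
  define Q where "Q = A * sqrt (ce * S * L) * h0 powr ((\<gamma> + real d) / 2)"
  define e where "e = (2 * \<beta> + real d + \<gamma>) / (2 * \<beta>)"
  have e: "e > 0" using assms by (simp add: e_def)
  have Q: "Q \<ge> 0" using A(1) f ce L by (simp add: Q_def)
  \<comment> \<open>\<open>A * M\<close> bounds the ratio of total variation to \<epsilon> from
    above, \<open>1 / (A * c)\<close> inverts its lower bound, and the last summand pays for
    replacing \<epsilon> by the total variation. The 1 makes the inequalities strict.\<close>
  define C1 where "C1 = 1 + A * M + 1 / (A * c) + Q * (A * c) powr (- e)"
  have Ac: "A * c > 0" using A f by simp
  have AM: "A * M > 0" using A f by simp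
  have main: "\<exists>\<mu>\<in>sobolev_densities \<beta> C. \<exists>\<nu>\<in>sobolev_densities \<beta> C.
             tv_dist \<mu> (\<nu> :: (real ^ 'd) measure) / \<epsilon> \<in> {1 / C1<..<C1} \<and>
             energy_dist \<gamma> \<mu> \<nu> \<le> C1 * tv_dist \<mu> \<nu> powr e * ln (3 + 1 / tv_dist \<mu> \<nu>) ^ (d - 1)"
    if \<epsilon>: "0 < \<epsilon>" "\<epsilon> < 1" for \<epsilon> :: real
  proof -
    \<comment> \<open>With a = A \<epsilon> this gives a^2 h^(-2 \<beta>) = A^2 h0^(-2 \<beta>): the
      Sobolev bound of the perturbation does not depend on \<epsilon>.\<close>
    define h where "h = h0 * \<epsilon> powr (1 / \<beta>)"
    have h: "0 < h" "h \<le> h0"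
      using f(3) \<epsilon> assms(1) powr_mono2[of "1 / \<beta>" \<epsilon> 1] by (auto simp: h_def)
    define a where "a = A * \<epsilon>"
    have a: "a > 0" "a \<le> A" using A \<epsilon> by (auto simp: a_def mult_left_le)
    define e1 where "e1 x = \<delta> * b x + a * f h x" for x
    define e2 where "e2 x = \<delta> * b x" for x
    have af: "\<bar>a * f h x\<bar> \<le> \<delta> * b x" for x
    proof -
      have "\<bar>a * f h x\<bar> \<le> A * (M * b x)"
        using a f(13)[OF h, of x] A(1) by (auto simp: abs_mult intro!: mult_mono)
      also have "\<dots> \<le> \<delta> * b x" using mult_right_mono[OF A(2) f(7)[of x]] by (simp add: mult.assoc)
      finally show ?thesis .
    qed
    have aS: "2 * a\<^sup>2 * (h powr (- 2 * \<beta>) * S) = 2 * A\<^sup>2 * S'"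
    proof -
      have "h powr (- 2 * \<beta>) = h0 powr (- 2 * \<beta>) * \<epsilon> powr (- 2)"
        using f(3) \<epsilon> assms(1) by (simp add: h_def powr_mult powr_powr)
      moreover have "\<epsilon>\<^sup>2 * \<epsilon> powr (- 2) = 1"
        using \<epsilon> by (simp add: powr_minus powr_numeral)
      ultimately show ?thesis by (simp add: a_def S'_def power_mult_distrib mult_ac)
    qed
    have e1: "integrable lborel e1" "\<And>x. 0 \<le> e1 x" "\<And>x. e1 x \<le> 2 * \<delta> * b1" "\<And>x. x \<notin> cball 0 1 \<Longrightarrow> e1 x = 0"
      "(LINT x|lborel. e1 x) = \<delta>" "sobolev_norm_sq \<beta> e1 \<le> ennreal (C\<^sup>2 / 4)"
    proof -
      show "integrable lborel e1" unfolding e1_def[abs_def] using f(6) f(12)[OF h] by simp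
      show "0 \<le> e1 x" for x using af[of x] unfolding e1_def by linarith
      show "e1 x \<le> 2 * \<delta> * b1" for x
        using af[of x] mult_left_mono[OF f(8)[of x], of \<delta>] \<delta> unfolding e1_def by linarith
      show "x \<notin> cball 0 1 \<Longrightarrow> e1 x = 0" for x using af[of x] f(9)[of x] by (simp add: e1_def)
      show "(LINT x|lborel. e1 x) = \<delta>" unfolding e1_def[abs_def] using f(6,10) f(12)[OF h] f(14)[OF h] by simp
      have "sobolev_norm_sq \<beta> e1 \<le> ennreal (2 * \<delta>\<^sup>2) * sobolev_norm_sq \<beta> b + ennreal (2 * a\<^sup>2) * sobolev_norm_sq \<beta> (f h)"
        unfolding e1_def[abs_def] by (rule sobolev_norm_sq_lincomb[OF f(6) f(12)[OF h]])
      also have "\<dots> \<le> ennreal (2 * \<delta>\<^sup>2) * ennreal S + ennreal (2 * a\<^sup>2) * ennreal (h powr (- 2 * \<beta>) * S)"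
        by (intro add_mono mult_left_mono f(11) f(16)[OF h]) auto
      also have "\<dots> = ennreal (2 * \<delta>\<^sup>2 * S + 2 * A\<^sup>2 * S')"
        unfolding aS[symmetric] using f(5) by (simp add: ennreal_plus ennreal_mult')
      also have "\<dots> \<le> ennreal (C\<^sup>2 / 4)" using \<delta>S AS by (intro ennreal_leI) simp
      finally show "sobolev_norm_sq \<beta> e1 \<le> ennreal (C\<^sup>2 / 4)" .
    qed
    have e2: "integrable lborel e2" "\<And>x. 0 \<le> e2 x" "\<And>x. e2 x \<le> 2 * \<delta> * b1" "\<And>x. x \<notin> cball 0 1 \<Longrightarrow> e2 x = 0"
      "(LINT x|lborel. e2 x) = \<delta>" "sobolev_norm_sq \<beta> e2 \<le> ennreal (C\<^sup>2 / 4)"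
    proof -
      show "integrable lborel e2" unfolding e2_def[abs_def] using f(6) by simp
      show "0 \<le> e2 x" for x using \<delta> f(7) by (simp add: e2_def)
      have "0 \<le> b1" using order.trans[OF f(7) f(8)] .
      then show "e2 x \<le> 2 * \<delta> * b1" for x
        using mult_left_mono[OF f(8)[of x], of \<delta>] \<delta> mult_nonneg_nonneg[of \<delta> b1] unfolding e2_def by linarith
      show "x \<notin> cball 0 1 \<Longrightarrow> e2 x = 0" for x using f(9)[of x] by (simp add: e2_def)
      show "(LINT x|lborel. e2 x) = \<delta>" unfolding e2_def[abs_def] using f(6,10) by simp
      have "sobolev_norm_sq \<beta> e2 \<le> ennreal (2 * \<delta>\<^sup>2) * sobolev_norm_sq \<beta> b"
        using sobolev_norm_sq_lincomb[OF f(6) f(6), of \<beta> \<delta> 0] by (simp add: e2_def[abs_def])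
      also have "\<dots> \<le> ennreal (2 * \<delta>\<^sup>2) * ennreal S" by (intro mult_left_mono f(11)) auto
      also have "\<dots> = ennreal (2 * \<delta>\<^sup>2 * S)" by (simp add: ennreal_mult')
      also have "\<dots> \<le> ennreal (C\<^sup>2 / 4)" by (rule ennreal_leI) (use \<delta>S zero_le_power2[of C] in linarith)
      finally show "sobolev_norm_sq \<beta> e2 \<le> ennreal (C\<^sup>2 / 4)" .
    qed
    define p1 where "p1 x = (1 - \<delta>) * p x + e1 x" for x
    define p2 where "p2 x = (1 - \<delta>) * p x + e2 x" for x
    note mx = mixture_in_sobolev_densities[OF assms(4) less_imp_le[OF \<delta>(1)] \<delta>(2) p pS]
    note m1 = mx[OF e1, folded p1_def] and m2 = mx[OF e2, folded p2_def]
    let ?\<mu> = "density lborel p1" and ?\<nu> = "density lborel p2"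
    have nn: "0 \<le> p1 x" "0 \<le> p2 x" for x
      using \<delta> p(2)[of x] e1(2)[of x] e2(2)[of x] by (simp_all add: p1_def p2_def)
    have diff: "p1 x - p2 x = a * f h x" for x by (simp add: p1_def p2_def e1_def e2_def)
    obtain w where w: "w \<in> borel_measurable borel" "\<And>x. 0 \<le> w x" "\<And>x. w x \<le> 1" "c \<le> (LINT x|lborel. w x * f h x)"
      using f(15)[OF h] by blast
    note tvb = tv_dist_density_bounds[OF m1(1) nn(1) m2(1) nn(2) m1(2) m2(2) w(1-3), unfolded diff]
    let ?t = "tv_dist ?\<mu> ?\<nu>"
    have t1: "a * c \<le> ?t"
    proof -
      have "a * c \<le> a * (LINT x|lborel. w x * f h x)" using w(4) a by simp
      also have "\<dots> = (LINT x|lborel. w x * (a * f h x))"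
        unfolding integral_mult_right_zero[symmetric] by (simp only: mult.left_commute)
      finally show ?thesis using tvb(1) by simp
    qed
    have t2: "?t \<le> a * M"
    proof -
      have "(LINT x|lborel. \<bar>a * f h x\<bar>) \<le> (LINT x|lborel. a * (M * b x))"
        using f(6) f(12)[OF h] f(13)[OF h] a by (intro integral_mono) (auto simp: abs_mult)
      also have "\<dots> = a * M" using f(10) by simp
      finally show ?thesis using tvb(2) by simp
    qed
    have t0: "?t > 0" using t1 a f(2) by (meson less_le_trans mult_pos_pos)
    have "energy_dist \<gamma> ?\<mu> ?\<nu> \<le> sqrt (ce * (a\<^sup>2 * S * (h powr (\<gamma> + real d) * L)))"
    proof (rule ce(2)[where b = "\<lambda>s. a\<^sup>2 * (S * (s powr (- q) * min 1 ((s / (1 / h\<^sup>2)) ^ K)))"])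
      show "0 \<le> a\<^sup>2 * S * (h powr (\<gamma> + real d) * L)" using f(5) L by simp
      show "gauss_mean s ?\<mu> ?\<mu> + gauss_mean s ?\<nu> ?\<nu> - 2 * gauss_mean s ?\<mu> ?\<nu>
          \<le> a\<^sup>2 * (S * (s powr (- q) * min 1 ((s / (1 / h\<^sup>2)) ^ K)))" if s: "s > 0" for s
      proof -
        have "gauss_mean s ?\<mu> ?\<mu> + gauss_mean s ?\<nu> ?\<nu> - 2 * gauss_mean s ?\<mu> ?\<nu> = a\<^sup>2 * gauss_form s (f h) (f h)"
          using gauss_mean_diff[OF m1(1) nn(1) m2(1) nn(2) m1(2) m2(2) less_imp_le[OF s]]
          unfolding diff gauss_form_scale .
        also have "\<dots> \<le> a\<^sup>2 * (S * (s powr (- q) * min 1 ((s / (1 / h\<^sup>2)) ^ K)))"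
          using f(17)[OF h s] by (intro mult_left_mono) (simp_all add: q_def d_def)
        finally show ?thesis .
      qed
      have b': "1 / h\<^sup>2 > 0" using h by simp
      \<comment> \<open>The threshold s = 1 / h^2, where the gain of the oscillating factor
        saturates, sets the size of the whole s-integral.\<close>
      have hp: "(1 / h\<^sup>2) powr (- \<gamma> / 2 - q) = h powr (\<gamma> + real d)"
      proof -
        have "1 / h\<^sup>2 = h powr (- 2)" using h by (simp add: powr_minus_divide)
        then show ?thesis by (simp add: powr_powr q_def algebra_simps)
      qed
      have "(\<integral>\<^sup>+s. ennreal (riesz \<gamma> s * (a\<^sup>2 * (S * (s powr (- q) * min 1 ((s / (1 / h\<^sup>2)) ^ K))))) \<partial>lborel)
        = (\<integral>\<^sup>+s. ennreal (a\<^sup>2 * S) * ennreal (riesz \<gamma> s * (s powr (- q) * min 1 ((s / (1 / h\<^sup>2)) ^ K))) \<partial>lborel)"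
        using f(5) by (intro nn_integral_cong) (simp add: mult_ac flip: ennreal_mult')
      also have "\<dots> = ennreal (a\<^sup>2 * S) * (\<integral>\<^sup>+s. ennreal (riesz \<gamma> s * (s powr (- q) * min 1 ((s / (1 / h\<^sup>2)) ^ K))) \<partial>lborel)"
        by (rule nn_integral_cmult) measurable
      also have "\<dots> \<le> ennreal (a\<^sup>2 * S) * ennreal (h powr (\<gamma> + real d) * L)"
        using nn_integral_riesz_min[OF q0 Kq b'] unfolding hp L_def by (intro mult_left_mono) auto
      also have "\<dots> = ennreal (a\<^sup>2 * S * (h powr (\<gamma> + real d) * L))"
        using f(5) by (simp add: ennreal_mult')
      finally show "(\<integral>\<^sup>+s. ennreal (riesz \<gamma> s * (a\<^sup>2 * (S * (s powr (- q) * min 1 ((s / (1 / h\<^sup>2)) ^ K))))) \<partial>lborel)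
          \<le> ennreal (a\<^sup>2 * S * (h powr (\<gamma> + real d) * L))" .
    qed (use m1 m2 in auto)
    also have "\<dots> = Q * \<epsilon> powr e"
    proof -
      have "ce * (a\<^sup>2 * S * (h powr (\<gamma> + real d) * L)) = (ce * S * L) * (a * h powr ((\<gamma> + real d) / 2))\<^sup>2"
        by (simp add: power_mult_distrib power2_eq_square[of "h powr _"] powr_add[symmetric])
      then have "sqrt (ce * (a\<^sup>2 * S * (h powr (\<gamma> + real d) * L))) = sqrt ((ce * S * L) * (a * h powr ((\<gamma> + real d) / 2))\<^sup>2)"
        by (simp only:)
      also have "\<dots> = sqrt (ce * S * L) * (a * h powr ((\<gamma> + real d) / 2))"
        using a h unfolding real_sqrt_mult[of "ce * S * L"] real_sqrt_abs by simp
      also have "h powr ((\<gamma> + real d) / 2) = h0 powr ((\<gamma> + real d) / 2) * \<epsilon> powr ((\<gamma> + real d) / (2 * \<beta>))"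
        using f(3) \<epsilon> by (simp add: h_def powr_mult powr_powr mult.commute)
      also have "sqrt (ce * S * L) * (a * (h0 powr ((\<gamma> + real d) / 2) * \<epsilon> powr ((\<gamma> + real d) / (2 * \<beta>))))
        = Q * (\<epsilon> powr 1 * \<epsilon> powr ((\<gamma> + real d) / (2 * \<beta>)))"
        using \<epsilon> by (simp add: Q_def a_def mult_ac)
      also have "\<epsilon> powr 1 * \<epsilon> powr ((\<gamma> + real d) / (2 * \<beta>)) = \<epsilon> powr e"
        unfolding powr_add[symmetric] e_def using assms(1) by (simp add: field_simps)
      finally show ?thesis .
    qed
    \<comment> \<open>The lower bound A \<epsilon> c on the total variation, together with e > 0,
      lets the total variation take the place of \<epsilon>.\<close>
    also have "\<dots> \<le> Q * (?t / (A * c)) powr e"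
    proof (intro mult_left_mono powr_mono2)
      show "\<epsilon> \<le> ?t / (A * c)" using t1 Ac by (simp add: a_def field_simps)
    qed (use e \<epsilon> Q in auto)
    also have "\<dots> = Q * (A * c) powr (- e) * ?t powr e"
      using Ac t0 by (simp add: powr_divide powr_minus_divide)
    also have "\<dots> \<le> C1 * ?t powr e"
      by (intro mult_right_mono) (use Ac AM in \<open>simp_all add: C1_def\<close>)
    also have "\<dots> \<le> C1 * ?t powr e * ln (3 + 1 / ?t) ^ (d - 1)"
    proof -
      \<comment> \<open>The 3 inside the logarithm keeps it at least 1 for every positive total
        variation, so its power is at least 1 as well, also when the exponent is 0.\<close>
      have "exp 1 \<le> 3 + 1 / ?t" using exp_le t0 by (smt (verit) zero_less_divide_1_iff)
      then have "1 \<le> ln (3 + 1 / ?t)" using t0 by (subst ln_ge_iff) (auto intro: add_pos_pos)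
      then have "1 \<le> ln (3 + 1 / ?t) ^ (d - 1)" by (rule one_le_power)
      moreover have "0 \<le> C1 * ?t powr e" using Ac AM Q by (simp add: C1_def)
      ultimately show ?thesis using mult_left_mono[of 1 "ln (3 + 1 / ?t) ^ (d - 1)" "C1 * ?t powr e"] by simp
    qed
    finally have E: "energy_dist \<gamma> ?\<mu> ?\<nu> \<le> C1 * ?t powr e * ln (3 + 1 / ?t) ^ (d - 1)" .
    have R: "0 \<le> Q * (A * c) powr (- e)" using Q by simp
    have "?t / \<epsilon> < C1"
    proof -
      have "?t / \<epsilon> \<le> A * M" using t2 \<epsilon> by (simp add: a_def field_simps)
      also have "\<dots> < C1" using R Ac by (simp add: C1_def add_pos_nonneg)
      finally show ?thesis .
    qed
    moreover have "1 / C1 < ?t / \<epsilon>"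
    proof -
      have 1: "1 / (A * c) < C1" using R AM by (simp add: C1_def)
      have 2: "0 < 1 / (A * c)" using Ac by simp
      have "1 / C1 < 1 / (1 / (A * c))"
        using 1 2 less_trans[OF 2 1] by (intro divide_strict_left_mono mult_pos_pos) simp_all
      also have "\<dots> = A * c" by simp
      also have "A * c \<le> ?t / \<epsilon>" using t1 \<epsilon> by (simp add: a_def field_simps)
      finally show ?thesis .
    qed
    ultimately show ?thesis using E m1(4) m2(4) by (intro bexI[of _ ?\<mu>] bexI[of _ ?\<nu>]) auto
  qed
  show ?thesis
    using main unfolding e_def d_def by (intro exI[of _ C1]) auto
qed

end
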